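(* Let $\beta>1$. Let $\varphi$ be the canonical morphism of $\beta$ (over a finite alphabet if $\beta$ is a Parry number, over $\mathbb N$ otherwise) and let $\psi$ be the antimorphism fixing the word coding the $(-\beta)$-integers $\mathbb Z_{-\beta}$ (over the corresponding alphabet). Then the following conditions are equivalent: (1) $\beta$ is a zero of $x^d-mx^{d-1}-\cdots-mx-n$ for some integers $d\ge 1$ and $m\ge n\ge 1$, with $n=m$ whenever $d$ is even; (2) $\varphi^2$ is conjugated with $\psi^2$; (3) $\mathbb Z_{-\beta}=X(-\beta)$, where $X(-\beta)=\{\sum_{j=0}^N a_j(-\beta)^j : N\in\mathbb N,\ a_j\in\mathbb Z,\ 0\le a_j\le\beta\}$.
   Context: Positive base. For $\beta>1$ and $x\in[0,1)$ let $T_\beta(x)=\beta x-\lfloor\beta x\rfloor$ and $d_\beta(x)=x_1x_2\cdots$ with $x_i=\lfloor\beta T_\beta^{i-1}(x)\rfloor$. The Rényi expansion of unity is $d_\beta(1)=d_1d_2\cdots$ with $d_1=\lfloor\beta\rfloor$, $d_2d_3\cdots=d_\beta(\beta-\lfloor\beta\rfloor)$. $\beta$ is a Parry number if $d_\beta(1)$ is eventually periodic, and a simple Parry number if $d_\beta(1)=d_1\cdots d_k0^\omega$ with $d_k\neq0$. Put $d^*_\beta(1)=(d_1\cdots d_{k-1}(d_k-1))^\omega$ in the simple Parry case and $d^*_\beta(1)=d_\beta(1)$ otherwise, and write $d^*_\beta(1)=d'_1d'_2\cdots$. The canonical morphism $\varphi$: if $\beta$ is not a Parry number, $\varphi:\mathbb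 N^*\to\mathbb N^*$, $\varphi(i)=0^{d'_{i+1}}(i+1)$; if $d_\beta(1)=d_1\cdots d_k0^\omega$ ($d_k\ne0$), $\varphi$ acts on $\{0,\dots,k-1\}$ by $\varphi(i)=0^{d_{i+1}}(i+1)$ for $i\le k-2$, $\varphi(k-1)=0^{d_k}$; if $d_\beta(1)=d_1\cdots d_k(d_{k+1}\cdots d_{k+p})^\omega$ with $k,p$ minimal (not finite), $\varphi$ acts on $\{0,\dots,k+p-1\}$ by $\varphi(i)=0^{d_{i+1}}(i+1)$ for $i\le k+p-2$, $\varphi(k+p-1)=0^{d_{k+p}}k$. Here $0^j$ denotes $j$ copies of the letter $0$. (Letter $i$ codes the gap $\Delta_i=\sum_{s\ge1}d'_{s+i}\beta^{-s}$ between consecutive nonnegative $\beta$-integers.) Negative base. Let $\ell=-\beta/(\beta+1)$, $T_{-\beta}(x)=-\beta x-\lfloor-\beta x-\ell\rfloor$ on $[\ell,\ell+1)$ and $d_{-\beta}(x)=x_1x_2\cdots$ with $x_i=\lfloor -\beta T_{-\beta}^{i-1}(x)-\ell\rfloor\in\{0,\dots,\lfloor\beta\rfloor\}$. The alternate order: $x_1x_2\cdots\prec_{alt}y_1y_2\cdots$ iff $(-1)^k(x_k-y_k)<0$ for the least $k$ with $x_k\ne y_k$ (finite strings are compared after appending $0^\omega$). Let $d^*_{-\beta}(\ell+1)=(0l_1\cdots l_{q-1}(l_q-1))^\omega$ if $d_{-\beta}(\ell)=(l_1\cdots l_q)^\omega$ with $q$ odd, and $d^*_{-\beta}(\ell+1)=0\,d_{-\beta}(\ell)$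 otherwise. A digit sequence is $(-\beta)$-admissible iff each of its suffixes $s$ satisfies $d_{-\beta}(\ell)\preceq_{alt}s\prec_{alt}d^*_{-\beta}(\ell+1)$. For $x\in\mathbb R$ let $K\ge0$ be minimal with $x/(-\beta)^K\in(\ell,\ell+1)$ and $d_{-\beta}(x/(-\beta)^K)=x_1x_2\cdots$; the $(-\beta)$-expansion of $x$ places digit $x_i$ at the power $(-\beta)^{K-i}$. $\mathbb Z_{-\beta}$ is the set of $x$ whose $(-\beta)$-expansion has no nonzero digit at a negative power; equivalently $\{\sum_{i=0}^N a_i(-\beta)^i: a_N\cdots a_0 0^\omega \text{ admissible}\}$. Let $\gamma(x_{k-1}\cdots x_0)=\sum_i x_i(-\beta)^i$; $\min(k)$ (resp. $\max(k)$) is the $\prec_{alt}$-smallest (resp. largest) string $a_{k-1}\cdots a_0$ with $a_{k-1}\cdots a_0 0^\omega$ admissible. Write $\mathbb Z_{-\beta}=\{\cdots<z_{-1}<z_0=0<z_1<\cdots\}$ and define the bidirectional word $v_{-\beta}=\cdots v_{-1}|v_0v_1\cdots$ by $v_j=$ the largest index of a power of $-\beta$ at which the $(-\beta)$-expansions of $z_j,z_{j+1}$ differ; then $z_{j+1}-z_j=\Delta'_{v_j}$ with $\Delta'_k=|(-\beta)^k+\gamma(\min(k))-\gamma(\max(k))|$. The antimorphism $\psi:\mathbb N^*\to\mathbb N^*$ (i.e. $\psi(uw)=\psi(w)\psi(u)$) is $\psi(k)=S_k(k+1)\widetilde{R_k}$ for $k$ even and $\psi(k)=R_k(k+1)\widetilde{S_k}$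 for $k$ odd, where $S_k$ is the word (letters as in $v_{-\beta}$) coding the successive gaps between consecutive $(-\beta)$-integers going from $\gamma(\min(k)0)$ to $\gamma(\min(k+1))$, $R_k$ likewise from $\gamma(\max(k)0)$ to $\gamma(\max(k+1))$, and $\widetilde{u}$ is the mirror image of $u$; $\psi$ fixes $v_{-\beta}$, acting on pointed bidirectional words by $\psi(\cdots u_{-1}|u_0u_1\cdots)=\cdots\psi(u_1)\psi(u_0)|\psi(u_{-1})\psi(u_{-2})\cdots$. When $d_{-\beta}(\ell)$ is eventually periodic, letters coding gaps of equal length are identified, so that the word coding $\mathbb Z_{-\beta}$ and $\psi$ live on a finite alphabet. Two morphisms $\pi,\rho$ on an alphabet $\mathcal A$ are conjugated if there is a finite word $w$ with $w\pi(a)=\rho(a)w$ for all $a\in\mathcal A$, or $\pi(a)w=w\rho(a)$ for all $a\in\mathcal A$. *)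

theory Defs
  imports Complex_Main
begin

text \<open>
  Infinite digit sequences are functions on \<open>nat\<close> and are indexed from 0, so that
  \<open>x i\<close> is the digit usually written \<open>x_(i+1)\<close>.
  Finite digit strings are lists with the most significant digit first.
\<close>

definition periodic_from :: "(nat \<Rightarrow> int) \<Rightarrow> nat \<Rightarrow> nat \<Rightarrow> bool" where
  "periodic_from x k p \<longleftrightarrow> p > 0 \<and> (\<forall>i\<ge>k. x (i + p) = x i)"

definition ev_periodic :: "(nat \<Rightarrow> int) \<Rightarrow> bool" where
  "ev_periodic x \<longleftrightarrow> (\<exists>k p. periodic_from x k p)"

definition preperiod :: "(nat \<Rightarrow> int) \<Rightarrow> nat" where
  "preperiod x = (LEAST k. \<exists>p. periodic_from x k p)"

definition period :: "(nat \<Rightarrow> int) \<Rightarrow> nat" where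
  "period x = (LEAST p. \<exists>k. periodic_from x k p)"


section \<open>Positive base\<close>

definition pos_T :: "real \<Rightarrow> real \<Rightarrow> real" where
  "pos_T \<beta> x = \<beta> * x - of_int \<lfloor>\<beta> * x\<rfloor>"

definition pos_digits :: "real \<Rightarrow> real \<Rightarrow> nat \<Rightarrow> int" where
  "pos_digits \<beta> x i = \<lfloor>\<beta> * (pos_T \<beta> ^^ i) x\<rfloor>"

definition renyi_unity :: "real \<Rightarrow> nat \<Rightarrow> int" where
  "renyi_unity \<beta> i =
     (case i of 0 \<Rightarrow> \<lfloor>\<beta>\<rfloor> | Suc j \<Rightarrow> pos_digits \<beta> (\<beta> - of_int \<lfloor>\<beta>\<rfloor>) j)"

definition parry :: "real \<Rightarrow> bool" where
  "parry \<beta> \<longleftrightarrow> ev_periodic (renyi_unity \<beta>)"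

definition simple_parry :: "real \<Rightarrow> bool" where
  "simple_parry \<beta> \<longleftrightarrow> (\<exists>k. \<forall>i\<ge>k. renyi_unity \<beta> i = 0)"

text \<open>
  In the simple Parry case the least such \<open>k\<close> is the position of the last nonzero digit
  (it is positive, because the first digit of the expansion of unity is).
\<close>

definition simple_length :: "real \<Rightarrow> nat" where
  "simple_length \<beta> = (LEAST k. \<forall>i\<ge>k. renyi_unity \<beta> i = 0)"

definition phi_alphabet :: "real \<Rightarrow> nat set" where
  "phi_alphabet \<beta> =
     (if simple_parry \<beta> then {..<simple_length \<beta>}
      else if parry \<beta> then {..<preperiod (renyi_unity \<beta>) + period (renyi_unity \<beta>)}
      else UNIV)"

text \<open>
  The canonical morphism, given by its values on letters; only the values on
  \<open>phi_alphabet \<beta>\<close> matter. In the third case the quasi-greedy expansion of unity is the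
  expansion of unity itself.
\<close>

definition phi :: "real \<Rightarrow> nat \<Rightarrow> nat list" where
  "phi \<beta> i =
     replicate (nat (renyi_unity \<beta> i)) 0 @
     (if simple_parry \<beta> then (if Suc i < simple_length \<beta> then [Suc i] else [])
      else if parry \<beta> then
        (if Suc i < preperiod (renyi_unity \<beta>) + period (renyi_unity \<beta>) then [Suc i]
         else [preperiod (renyi_unity \<beta>)])
      else [Suc i])"


section \<open>Negative base\<close>

definition ell :: "real \<Rightarrow> real" where
  "ell \<beta> = - \<beta> / (\<beta> + 1)"

definition neg_T :: "real \<Rightarrow> real \<Rightarrow> real" where
  "neg_T \<beta> x = - \<beta> * x - of_int \<lfloor>- \<beta> * x - ell \<beta>\<rfloor>"

definition neg_digits :: "real \<Rightarrow> real \<Rightarrow> nat \<Rightarrow> int" where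
  "neg_digits \<beta> x i = \<lfloor>- \<beta> * (neg_T \<beta> ^^ i) x - ell \<beta>\<rfloor>"

text \<open>The sign is that of the position counted from 1.\<close>

definition alt_less :: "(nat \<Rightarrow> int) \<Rightarrow> (nat \<Rightarrow> int) \<Rightarrow> bool" where
  "alt_less x y \<longleftrightarrow> (\<exists>k. (\<forall>i<k. x i = y i) \<and> (- 1) ^ Suc k * (x k - y k) < 0)"

definition alt_le :: "(nat \<Rightarrow> int) \<Rightarrow> (nat \<Rightarrow> int) \<Rightarrow> bool" where
  "alt_le x y \<longleftrightarrow> x = y \<or> alt_less x y"

definition ell_digits :: "real \<Rightarrow> nat \<Rightarrow> int" where
  "ell_digits \<beta> = neg_digits \<beta> (ell \<beta>)"

text \<open>
  The parity condition refers to the minimal period: the right-hand side would change if an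
  odd period were replaced by an odd multiple.
\<close>

definition upper_digits :: "real \<Rightarrow> nat \<Rightarrow> int" where
  "upper_digits \<beta> i =
     (let l = ell_digits \<beta>; q = period l in
      if ev_periodic l \<and> preperiod l = 0 \<and> odd q
      then (let r = i mod (q + 1) in
            if r = 0 then 0 else if r = q then l (q - 1) - 1 else l (r - 1))
      else (case i of 0 \<Rightarrow> 0 | Suc j \<Rightarrow> l j))"

definition admissible :: "real \<Rightarrow> (nat \<Rightarrow> int) \<Rightarrow> bool" where
  "admissible \<beta> s \<longleftrightarrow>
     (\<forall>n. alt_le (ell_digits \<beta>) (\<lambda>i. s (n + i)) \<and> alt_less (\<lambda>i. s (n + i)) (upper_digits \<beta>))"

definition pad0 :: "int list \<Rightarrow> nat \<Rightarrow> int" where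
  "pad0 w i = (if i < length w then w ! i else 0)"

definition adm_strings :: "real \<Rightarrow> nat \<Rightarrow> int list set" where
  "adm_strings \<beta> k = {w. length w = k \<and> admissible \<beta> (pad0 w)}"

definition min_string :: "real \<Rightarrow> nat \<Rightarrow> int list" where
  "min_string \<beta> k =
     (THE w. w \<in> adm_strings \<beta> k \<and> (\<forall>u\<in>adm_strings \<beta> k. alt_le (pad0 w) (pad0 u)))"

definition max_string :: "real \<Rightarrow> nat \<Rightarrow> int list" where
  "max_string \<beta> k =
     (THE w. w \<in> adm_strings \<beta> k \<and> (\<forall>u\<in>adm_strings \<beta> k. alt_le (pad0 u) (pad0 w)))"

definition gam :: "real \<Rightarrow> int list \<Rightarrow> real" where
  "gam \<beta> w = (\<Sum>i<length w. of_int (rev w ! i) * (- \<beta>) ^ i)"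

definition exp_shift :: "real \<Rightarrow> real \<Rightarrow> nat" where
  "exp_shift \<beta> x = (LEAST K. x / (- \<beta>) ^ K \<in> {ell \<beta> <..< ell \<beta> + 1})"

text \<open>The digit at the power \<open>i\<close> (possibly negative) of \<open>- \<beta>\<close> in the expansion of \<open>x\<close>.\<close>

definition neg_expansion :: "real \<Rightarrow> real \<Rightarrow> int \<Rightarrow> int" where
  "neg_expansion \<beta> x i =
     (let K = exp_shift \<beta> x in
      if i < int K then neg_digits \<beta> (x / (- \<beta>) ^ K) (nat (int K - 1 - i)) else 0)"

definition neg_integers :: "real \<Rightarrow> real set" where
  "neg_integers \<beta> = {x. \<forall>i<0. neg_expansion \<beta> x i = 0}"

text \<open>
  For consecutive elements \<open>z_j < z_(j+1)\<close> of \<open>neg_integers \<beta>\<close>, the value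
  \<open>gap_letter \<beta> z_j z_(j+1)\<close> is the letter \<open>v_j\<close> of the bidirectional word coding
  \<open>neg_integers \<beta>\<close>. All digits of these numbers at negative powers vanish, so
  natural-number positions suffice.
\<close>

definition gap_letter :: "real \<Rightarrow> real \<Rightarrow> real \<Rightarrow> nat" where
  "gap_letter \<beta> x y = Max {i. neg_expansion \<beta> x (int i) \<noteq> neg_expansion \<beta> y (int i)}"

text \<open>
  The letters met when walking from \<open>a\<close> to \<open>b\<close> along \<open>neg_integers \<beta>\<close>; they are read
  from right to left if \<open>a > b\<close>. Bounded parts of \<open>neg_integers \<beta>\<close> are finite.
\<close>

definition gap_word :: "real \<Rightarrow> real \<Rightarrow> real \<Rightarrow> nat list" where
  "gap_word \<beta> a b =
     (let zs = sorted_list_of_set (neg_integers \<beta> \<inter> {min a b..max a b});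
          u = map2 (gap_letter \<beta>) zs (tl zs)
      in if a \<le> b then u else rev u)"

definition S_word :: "real \<Rightarrow> nat \<Rightarrow> nat list" where
  "S_word \<beta> k = gap_word \<beta> (gam \<beta> (min_string \<beta> k @ [0])) (gam \<beta> (min_string \<beta> (k + 1)))"

definition R_word :: "real \<Rightarrow> nat \<Rightarrow> nat list" where
  "R_word \<beta> k = gap_word \<beta> (gam \<beta> (max_string \<beta> k @ [0])) (gam \<beta> (max_string \<beta> (k + 1)))"

text \<open>The antimorphism on the alphabet \<open>nat\<close>, before letters are identified.\<close>

definition psi_nat :: "real \<Rightarrow> nat \<Rightarrow> nat list" where
  "psi_nat \<beta> k =
     (if even k then S_word \<beta> k @ [k + 1] @ rev (R_word \<beta> k)
      else R_word \<beta> k @ [k + 1] @ rev (S_word \<beta> k))"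

definition gap_length :: "real \<Rightarrow> nat \<Rightarrow> real" where
  "gap_length \<beta> k = \<bar>(- \<beta>) ^ k + gam \<beta> (min_string \<beta> k) - gam \<beta> (max_string \<beta> k)\<bar>"

text \<open>
  If the expansion of \<open>ell \<beta>\<close> is eventually periodic, letters coding gaps of equal length are
  identified, and every class is named by its least element. For the canonical morphism the
  same naming is built in: its letter \<open>i\<close> is the least one coding a gap of its length.
\<close>

definition letter_rep :: "real \<Rightarrow> nat \<Rightarrow> nat" where
  "letter_rep \<beta> k =
     (if ev_periodic (ell_digits \<beta>) then (LEAST j. gap_length \<beta> j = gap_length \<beta> k) else k)"

definition psi_alphabet :: "real \<Rightarrow> nat set" where
  "psi_alphabet \<beta> = range (letter_rep \<beta>)"

definition psi :: "real \<Rightarrow> nat \<Rightarrow> nat list" where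
  "psi \<beta> k = map (letter_rep \<beta>) (psi_nat \<beta> k)"


section \<open>Morphisms and conjugacy\<close>

definition morphism_ext :: "('a \<Rightarrow> 'a list) \<Rightarrow> 'a list \<Rightarrow> 'a list" where
  "morphism_ext f w = concat (map f w)"

definition antimorphism_ext :: "('a \<Rightarrow> 'a list) \<Rightarrow> 'a list \<Rightarrow> 'a list" where
  "antimorphism_ext f w = concat (map f (rev w))"

definition conjugated_on :: "'a set \<Rightarrow> ('a \<Rightarrow> 'a list) \<Rightarrow> ('a \<Rightarrow> 'a list) \<Rightarrow> bool" where
  "conjugated_on A \<pi> \<rho> \<longleftrightarrow>
     (\<exists>w\<in>lists A. (\<forall>a\<in>A. w @ \<pi> a = \<rho> a @ w) \<or> (\<forall>a\<in>A. \<pi> a @ w = w @ \<rho> a))"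

definition phi_sq :: "real \<Rightarrow> nat \<Rightarrow> nat list" where
  "phi_sq \<beta> a = morphism_ext (phi \<beta>) (phi \<beta> a)"

definition psi_sq :: "real \<Rightarrow> nat \<Rightarrow> nat list" where
  "psi_sq \<beta> a = antimorphism_ext (psi \<beta>) (psi \<beta> a)"


section \<open>Integer combinations of powers of the base\<close>

definition X_set :: "real \<Rightarrow> real set" where
  "X_set \<beta> =
     {(\<Sum>j\<le>N. of_int (a j) * (- \<beta>) ^ j) | (N :: nat) (a :: nat \<Rightarrow> int).
        \<forall>j\<le>N. 0 \<le> a j \<and> of_int (a j) \<le> \<beta>}"

end

theory Submission
  imports Defs
begin

text \<open>
  Let \<open>m = \<lfloor>\<beta>\<rfloor>\<close>. A finite string is admissible iff the value of each suffix, of length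
  \<open>k\<close> say, lies in the tile \<open>(-\<beta>)^k [\<ell>, \<ell> + 1)\<close>, and the tile of level \<open>k + 1\<close> is cut into translates of the tile of level \<open>k\<close>
  by multiples of \<open>(-\<beta>)^k\<close>. Everything is read off from the numbers
  \<open>\<delta>_k = \<beta>^k - m (\<beta>^(k-1) + \<dots> + 1)\<close>: their signs decide which of the strings \<open>m0m0\<dots>\<close> and \<open>0m0m\<dots>\<close> of
  length \<open>k\<close>, which have extreme values among all strings over \<open>{0..m}\<close>, stay inside the tile.
  Condition (1) says that \<open>\<delta>_d = n - m\<close> at the first \<open>d\<close> with \<open>\<delta>_d \<le> 0\<close> (with \<open>n = m\<close> if \<open>d\<close> is even).

  (1) implies (3): up to a shift, sums of \<open>k\<close> digits in base \<open>-\<beta>\<close> are sums of \<open>k\<close> digits in base \<open>\<beta>\<close>. Under (1)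
  the translates of this set by multiples of \<open>\<beta>^k\<close> coincide where they overlap, so that the tiling picks
  exactly the elements of \<open>X(-\<beta>)\<close>. (3) implies (1): otherwise \<open>X(-\<beta>)\<close> has a point in a tile at a place where
  no string over \<open>{0..m}\<close> of the length of the tile has its value.

  (1) implies (2): after the identification of letters \<open>\<psi>\<close> agrees with \<open>\<phi>\<close> on letters, so that \<open>\<phi>(0)^m\<close> conjugates
  the squares. (2) implies (1): \<open>\<psi>(0) = 0^m 1\<close> and \<open>\<psi>(1) = 0^m 2\<close> (otherwise the lengths of \<open>\<phi>\<^sup>2(0)\<close> and
  \<open>\<psi>\<^sup>2(0)\<close> differ), hence the conjugating word starts with \<open>\<phi>(0)^m\<close>. If the expansion of unity starts with \<open>m^t j\<close>,
  where \<open>j < m\<close>, then comparing prefixes at the letter \<open>t\<close> shows that it stops there; counting letters excludes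
  odd \<open>t\<close>.
\<close>

section \<open>The alternate order and expansions in a negative base\<close>

lemma alt_less_irrefl: "\<not> alt_less x x"
  by (auto simp: alt_less_def)

lemma alt_less_asym: "alt_less x y \<Longrightarrow> \<not> alt_less y x"
proof
  assume "alt_less x y" "alt_less y x"
  then obtain j k where j: "\<forall>i<j. x i = y i" "(- 1) ^ Suc j * (x j - y j) < 0"
    and k: "\<forall>i<k. y i = x i" "(- 1) ^ Suc k * (y k - x k) < 0"
    unfolding alt_less_def by blast
  consider "j < k" | "k < j" | "j = k" by linarith
  then show False
  proof cases
    case 1 then show ?thesis using j k by simp
  next
    case 2 then show ?thesis using j k by simp
  next
    case 3
    have "(- 1) ^ Suc j * (y j - x j) = - ((- 1) ^ Suc j * (x j - y j))" by (simp add: algebra_simps)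
    then show ?thesis using j(2) k(2) unfolding 3 by linarith
  qed
qed

lemma alt_le_antisym: "alt_le x y \<Longrightarrow> alt_le y x \<Longrightarrow> x = y"
  using alt_less_asym by (auto simp: alt_le_def)

lemma alt_le_not_less: "alt_le x y \<Longrightarrow> \<not> alt_less y x"
  using alt_less_asym alt_less_irrefl by (auto simp: alt_le_def)

text \<open>Dropping a common prefix moves every position by \<open>n\<close>, and an odd move flips
  the sign in the order.\<close>

lemma alt_less_shift:
  assumes "\<forall>i<n. x i = y i" "alt_less x y"
  shows "if even n then alt_less (\<lambda>i. x (n + i)) (\<lambda>i. y (n + i))
         else alt_less (\<lambda>i. y (n + i)) (\<lambda>i. x (n + i))"
proof -
  obtain k where k: "\<forall>i<k. x i = y i" "(- 1) ^ Suc k * (x k - y k) < 0"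
    using assms(2) unfolding alt_less_def by blast
  have "n \<le> k" using assms(1) k(2) by (metis cancel_comm_monoid_add_class.diff_cancel mult_zero_right not_le less_irrefl)
  then obtain j where j: "k = n + j" using le_Suc_ex by blast
  have e: "\<forall>i<j. x (n + i) = y (n + i)" using k j by simp
  show ?thesis
  proof (cases "even n")
    case True
    then have "(- 1) ^ Suc j * (x (n + j) - y (n + j)) < 0" using k(2) j by (simp add: power_add)
    then show ?thesis using e True by (auto simp: alt_less_def)
  next
    case False
    then have "(- 1) ^ Suc j * (y (n + j) - x (n + j)) < 0" using k(2) j by (simp add: power_add algebra_simps)
    moreover have "\<forall>i<j. y (n + i) = x (n + i)" using e by simp
    ultimately have "alt_less (\<lambda>i. y (n + i)) (\<lambda>i. x (n + i))" unfolding alt_less_def by blast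
    then show ?thesis using False by simp
  qed
qed

lemma alt_less_unshift:
  assumes "\<forall>i<n. x i = y i"
    and "if even n then alt_less (\<lambda>i. x (n + i)) (\<lambda>i. y (n + i))
         else alt_less (\<lambda>i. y (n + i)) (\<lambda>i. x (n + i))"
  shows "alt_less x y"
proof -
  have "\<exists>j. (\<forall>i<j. x (n + i) = y (n + i)) \<and> (- 1) ^ Suc (n + j) * (x (n + j) - y (n + j)) < 0"
  proof (cases "even n")
    case True
    then show ?thesis using assms(2) by (auto simp: alt_less_def power_add)
  next
    case False
    then obtain j where "\<forall>i<j. y (n + i) = x (n + i)" "(- 1) ^ Suc j * (y (n + j) - x (n + j)) < 0"
      using assms(2) by (auto simp: alt_less_def)
    then show ?thesis using False by (intro exI[of _ j]) (auto simp: power_add algebra_simps)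
  qed
  then obtain j where j: "\<forall>i<j. x (n + i) = y (n + i)" "(- 1) ^ Suc (n + j) * (x (n + j) - y (n + j)) < 0"
    by blast
  have "\<forall>i<n + j. x i = y i"
  proof (intro allI impI)
    fix i assume "i < n + j"
    show "x i = y i"
    proof (cases "i < n")
      case True then show ?thesis using assms(1) by simp
    next
      case False
      then obtain i' where "i = n + i'" using le_Suc_ex not_less by blast
      then show ?thesis using j(1) \<open>i < n + j\<close> by simp
    qed
  qed
  then show ?thesis using j(2) unfolding alt_less_def by blast
qed

lemma alt_less_at: "\<forall>i<k. x i = y i \<Longrightarrow> (- 1) ^ Suc k * (x k - y k) < 0 \<Longrightarrow> alt_less x y"
  unfolding alt_less_def by blast

text \<open>The least preperiod and the least period are minimised independently, each with its own
  partner. The value at \<open>i\<close> is therefore carried by multiples of \<open>p\<close> to a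
  place where the least period is known to work, and back.\<close>

lemma ev_periodicD:
  assumes "ev_periodic x"
  shows "period x > 0" "i \<ge> preperiod x \<Longrightarrow> x (i + period x) = x i"
proof -
  have "\<exists>k p. periodic_from x k p" using assms by (simp add: ev_periodic_def)
  then have "\<exists>p. periodic_from x (preperiod x) p" unfolding preperiod_def by (rule LeastI_ex)
  then obtain p where p: "p > 0" "\<And>i. i \<ge> preperiod x \<Longrightarrow> x (i + p) = x i" by (auto simp: periodic_from_def)
  have "\<exists>p k. periodic_from x k p" using assms by (auto simp: ev_periodic_def)
  then have "\<exists>k. periodic_from x k (period x)" unfolding period_def by (rule LeastI_ex)
  then obtain k where k: "period x > 0" "\<And>i. i \<ge> k \<Longrightarrow> x (i + period x) = x i" by (auto simp: periodic_from_def)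
  have m: "x (i + n * p) = x i" if "i \<ge> preperiod x" for i n
  proof (induction n)
    case (Suc n)
    have "x (i + n * p + p) = x (i + n * p)" by (rule p(2)) (use that in simp)
    then show ?case using Suc by (simp add: ac_simps)
  qed simp
  show "period x > 0" by fact
  assume i: "i \<ge> preperiod x"
  have "k \<le> i + k * p" using p(1) by (metis add.commute le_add1 mult.right_neutral mult_le_mono2 Suc_leI One_nat_def trans_le_add2)
  then have "x (i + k * p + period x) = x (i + k * p)" by (rule k(2))
  then show "x (i + period x) = x i" using m[of i k] m[of "i + period x" k] i by (simp add: algebra_simps)
qed

text \<open>Typical use: a distance that stays bounded under all factors \<open>b ^ k\<close> must
  vanish.\<close>

lemma eventually_power_gt:
  assumes "(b::real) > 1" "\<And>k. b ^ k * c \<le> d" shows "c \<le> 0"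
proof (rule ccontr)
  assume "\<not> c \<le> 0"
  then obtain k where "d / c < b ^ k" using real_arch_pow[OF assms(1)] by blast
  then show False using assms(2)[of k] \<open>\<not> c \<le> 0\<close> by (simp add: field_simps)
qed

section \<open>The transformation in base -\<beta>, its digits and their order\<close>

locale neg_base =
  fixes \<beta> :: real
  assumes beta_gt1: "1 < \<beta>"
begin

abbreviation "L \<equiv> ell \<beta>"
abbreviation "T \<equiv> neg_T \<beta>"
abbreviation "D \<equiv> neg_digits \<beta>"
abbreviation "U \<equiv> {L..<L + 1}"
abbreviation "l \<equiv> ell_digits \<beta>"

lemma ell_eqs: "- \<beta> * L = \<beta> + L" "- \<beta> * (L + 1) = L" "L < 0" "- 1 < L"
  using beta_gt1 by (simp_all add: ell_def field_simps)

lemma beta_plus1: "\<beta> + 1 > 0" using beta_gt1 by simp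

lemma ell_mult: "L * (\<beta> + 1) = - \<beta>" "(L + 1) * (\<beta> + 1) = 1"
  using beta_gt1 by (simp_all add: ell_def field_simps)

lemma zero_in_U: "0 \<in> U" using ell_eqs by simp

lemma T_mem: "T x \<in> U"
proof -
  have "of_int \<lfloor>- \<beta> * x - L\<rfloor> \<le> - \<beta> * x - L" "- \<beta> * x - L < of_int \<lfloor>- \<beta> * x - L\<rfloor> + 1" by linarith+
  then show ?thesis unfolding neg_T_def atLeastLessThan_iff by linarith
qed

lemma T_pow_mem: "x \<in> U \<Longrightarrow> (T ^^ n) x \<in> U"
  by (cases n) (use T_mem in auto)

lemma D_0: "D x 0 = \<lfloor>- \<beta> * x - L\<rfloor>" by (simp add: neg_digits_def)

lemma T_digit: "T x = - \<beta> * x - of_int (D x 0)" by (simp add: neg_T_def D_0)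

lemma D_shift: "D x (n + i) = D ((T ^^ n) x) i"
  by (simp add: neg_digits_def funpow_add add.commute[of n])

lemma D_Suc: "D x (Suc i) = D (T x) i" using D_shift[of x 1 i] by simp

lemma T_eq:
  assumes "- \<beta> * x - of_int a \<in> U"
  shows "T x = - \<beta> * x - of_int a" "D x 0 = a"
proof -
  show "D x 0 = a" unfolding D_0 by (rule floor_unique) (use assms in auto)
  then show "T x = - \<beta> * x - of_int a" by (simp add: T_digit)
qed

lemma T_zero: "T 0 = 0" "D 0 0 = 0"
  using T_eq[of 0 0] zero_in_U by auto

lemma T_pow_zero: "(T ^^ n) 0 = 0"
  by (induction n) (auto simp: T_zero)

lemma D_zero: "D 0 = (\<lambda>_. 0)"
proof
  fix i show "D 0 i = 0" using D_shift[of 0 i 0] by (simp add: T_pow_zero T_zero)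
qed

lemma digit_bounds:
  assumes "x \<in> U" shows "0 \<le> D x 0" "D x 0 \<le> \<lfloor>\<beta>\<rfloor>"
proof -
  have "\<beta> * x < \<beta> * (L + 1)" using assms beta_gt1 by simp
  then have "- \<beta> * x - L > 0" using ell_eqs(2) by simp
  then show "0 \<le> D x 0" by (simp add: D_0)
  have "\<beta> * L \<le> \<beta> * x" using assms beta_gt1 by simp
  then have "- \<beta> * x - L \<le> \<beta>" using ell_eqs(1) by simp
  then show "D x 0 \<le> \<lfloor>\<beta>\<rfloor>" by (simp add: D_0 floor_mono)
qed

lemma orbit_diff:
  "\<forall>i<k. D x i = D y i \<Longrightarrow> (T ^^ k) x - (T ^^ k) y = (- \<beta>) ^ k * (x - y)"
proof (induction k)
  case (Suc k)
  have "D ((T ^^ k) x) 0 = D ((T ^^ k) y) 0"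
    using Suc.prems D_shift[of x k 0] D_shift[of y k 0] by simp
  then have "(T ^^ Suc k) x - (T ^^ Suc k) y = - \<beta> * ((T ^^ k) x - (T ^^ k) y)"
    by (simp add: T_digit algebra_simps)
  then show ?case using Suc by simp
qed simp

lemma D_inj:
  assumes "x \<in> U" "y \<in> U" "D x = D y" shows "x = y"
proof -
  have "\<beta> ^ k * \<bar>x - y\<bar> \<le> 1" for k
  proof -
    have "\<beta> ^ k * \<bar>x - y\<bar> = \<bar>(T ^^ k) x - (T ^^ k) y\<bar>"
      using orbit_diff[of k x y] assms(3) beta_gt1 by (simp add: abs_mult power_abs)
    also have "\<dots> \<le> 1" using T_pow_mem[OF assms(1), of k] T_pow_mem[OF assms(2), of k] by auto
    finally show ?thesis .
  qed
  then show ?thesis using eventually_power_gt[OF beta_gt1] by fastforce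
qed

text \<open>At the first differing digit \<open>k\<close> the orbits differ by (-\<beta>)^k (x - y).
  The sign of this alternates with \<open>k\<close> just as the alternate order does, and the floor
  cannot reverse it.\<close>

lemma D_strict_mono:
  assumes "x \<in> U" "y \<in> U" "x < y" shows "alt_less (D x) (D y)"
proof -
  have "\<exists>k. D x k \<noteq> D y k" using D_inj[OF assms(1,2)] assms(3) by fastforce
  then obtain k where k: "D x k \<noteq> D y k" "\<forall>i<k. D x i = D y i"
    using exists_least_iff[of "\<lambda>k. D x k \<noteq> D y k"] by blast
  define u v where "u = (T ^^ k) x" and "v = (T ^^ k) y"
  have uv: "u - v = (- \<beta>) ^ k * (x - y)" using orbit_diff[OF k(2)] by (simp add: u_def v_def)
  have dk: "D x k = \<lfloor>- \<beta> * u - L\<rfloor>" "D y k = \<lfloor>- \<beta> * v - L\<rfloor>"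
    using D_shift[of x k 0] D_shift[of y k 0] by (auto simp: D_0 u_def v_def)
  have bp: "\<beta> ^ k > 0" using beta_gt1 by simp
  show ?thesis
  proof (cases "even k")
    case True
    then have "u - v < 0" using uv bp assms(3) by (simp add: mult_pos_neg)
    then have "\<beta> * u \<le> \<beta> * v" using beta_gt1 by simp
    then have "D y k \<le> D x k" unfolding dk by (intro floor_mono) simp
    then show ?thesis using k True by (intro alt_less_at[of k]) auto
  next
    case False
    then have "u - v > 0" using uv bp assms(3) by (simp add: mult_pos_neg)
    then have "\<beta> * v \<le> \<beta> * u" using beta_gt1 by simp
    then have "D x k \<le> D y k" unfolding dk by (intro floor_mono) simp
    then show ?thesis using k False by (intro alt_less_at[of k]) auto
  qed
qed

lemma D_le_iff:
  assumes "x \<in> U" "y \<in> U" shows "alt_le (D x) (D y) \<longleftrightarrow> x \<le> y"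
proof
  assume a: "alt_le (D x) (D y)" show "x \<le> y"
  proof (rule ccontr)
    assume "\<not> x \<le> y"
    then show False using D_strict_mono[OF assms(2,1)] a alt_le_not_less by auto
  qed
next
  assume "x \<le> y" then show "alt_le (D x) (D y)"
    using D_strict_mono[OF assms] by (cases "x = y") (auto simp: alt_le_def)
qed

lemma D_less_imp: "x \<in> U \<Longrightarrow> y \<in> U \<Longrightarrow> alt_less (D x) (D y) \<Longrightarrow> x < y"
  using D_le_iff[of y x] alt_le_not_less by force

lemma L_in_U: "L \<in> U" by simp

lemma l_0: "l 0 = \<lfloor>\<beta>\<rfloor>"
proof -
  have "- \<beta> * L - L = \<beta>" using ell_eqs(1) by linarith
  then show ?thesis unfolding ell_digits_def D_0 by simp
qed

lemma floor_beta_pos: "\<lfloor>\<beta>\<rfloor> \<ge> 1" using beta_gt1 by linarith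

lemma l_eq: "l = D L" by (simp add: ell_digits_def)

text \<open>The sequence 0 followed by \<open>l\<close> plays the role of an expansion of the
  excluded end \<open>L + 1\<close>, because -\<beta>(L + 1) = L.\<close>

lemma D_less_0l:
  assumes "x \<in> U" shows "alt_less (D x) (case_nat 0 l)"
proof (cases "D x 0 = 0")
  case False
  then have "D x 0 > 0" using digit_bounds[OF assms] by simp
  then show ?thesis by (intro alt_less_at[of 0]) auto
next
  case True
  have "\<beta> * x < \<beta> * (L + 1)" using assms beta_gt1 by simp
  then have "L < T x" using ell_eqs(2) True by (simp add: T_digit)
  then have "alt_less l (D (T x))" unfolding l_eq by (intro D_strict_mono L_in_U T_mem)
  then show ?thesis using True by (intro alt_less_unshift[of 1]) (auto simp: D_Suc)
qed

text \<open>Serves to show that in an admissible string a digit 0 is not followed by a suffix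
  representing \<open>L\<close>. For an odd period the two sequences first differ at index
  \<open>q\<close>, an even position when counted from 1, and there the upper one has the smaller
  digit.\<close>

lemma not_less_upper: "\<not> alt_less (case_nat 0 l) (upper_digits \<beta>)"
proof (cases "ev_periodic l \<and> preperiod l = 0 \<and> odd (period l)")
  case False
  then have "upper_digits \<beta> = case_nat 0 l"
    by (intro ext) (auto simp: upper_digits_def Let_def split: nat.split)
  then show ?thesis using alt_less_irrefl by simp
next
  case True
  define q where "q = period l"
  have q: "q > 0" "odd q" using ev_periodicD(1) True by (auto simp: q_def)
  have "alt_less (upper_digits \<beta>) (case_nat 0 l)"
  proof (rule alt_less_at[of q])
    show "\<forall>i<q. upper_digits \<beta> i = case_nat 0 l i"
      using True by (auto simp: upper_digits_def Let_def q_def[symmetric] split: nat.split)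
    show "(- 1) ^ Suc q * (upper_digits \<beta> q - case_nat 0 l q) < 0"
      using True q by (cases q) (auto simp: upper_digits_def Let_def q_def[symmetric])
  qed
  then show ?thesis by (rule alt_less_asym)
qed

text \<open>For an odd period \<open>q\<close> the upper sequence is strictly below 0 followed by
  \<open>l\<close>, but no finite expansion falls in between. If \<open>x\<close> first differs from
  the latter after index \<open>q\<close>, its orbit point at time \<open>q + 1\<close> would be
  below \<open>L\<close>. If it does so at index \<open>q\<close>, its digit is at most
  \<open>l (q - 1) - 1\<close>, and equality leads to the same question for the rest, which is zero
  or has a smaller \<open>K\<close>.\<close>

lemma finite_less_upper:
  assumes "x \<in> U" "(T ^^ K) x = 0" shows "alt_less (D x) (upper_digits \<beta>)"
proof (cases "ev_periodic l \<and> preperiod l = 0 \<and> odd (period l)")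
  case False
  then have "upper_digits \<beta> = case_nat 0 l"
    by (intro ext) (auto simp: upper_digits_def Let_def split: nat.split)
  then show ?thesis using D_less_0l[OF assms(1)] by simp
next
  case True
  define q where "q = period l"
  define u where "u = upper_digits \<beta>"
  have q: "q > 0" "odd q" using ev_periodicD(1) True by (auto simp: q_def)
  have per: "l (i + q) = l i" for i using ev_periodicD(2) True by (auto simp: q_def)
  have u_lt: "u i = case_nat 0 l i" if "i < q" for i
    using True that by (auto simp: u_def upper_digits_def Let_def q_def[symmetric] split: nat.split)
  have u_q: "u q = l (q - 1) - 1"
    using True q by (auto simp: u_def upper_digits_def Let_def q_def[symmetric])
  have u_per: "u (Suc q + i) = u i" for i
  proof -
    have "(Suc q + i) mod (q + 1) = i mod (q + 1)" by (metis Suc_eq_plus1 mod_add_self1)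
    then show ?thesis using True unfolding u_def upper_digits_def Let_def q_def[symmetric] by simp
  qed
  have zero_less: "alt_less (D 0) u"
  proof -
    have "u 0 = 0" using u_lt[of 0] q by simp
    moreover have "u 1 \<ge> 1"
    proof (cases "q = 1")
      case False
      then have "u 1 = l 0" using u_lt[of 1] q by simp
      then show ?thesis using l_0 floor_beta_pos by simp
    next
      case True
      \<comment> \<open>With \<open>q = 1\<close> the point \<open>L\<close> is fixed by
        \<open>T\<close>, so \<beta> is an integer, at least 2, and the lowered digit
        \<open>l 0 - 1\<close> is still positive.\<close>
      have "D (T L) = D L"
      proof
        fix i show "D (T L) i = D L i" using per[of i] True by (simp add: l_eq D_Suc)
      qed
      then have "T L = L" using D_inj T_mem L_in_U by blast
      then have "\<beta> = of_int \<lfloor>\<beta>\<rfloor>" using T_digit[of L] ell_eqs(1) l_0 by (simp add: l_eq)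
      then have "\<lfloor>\<beta>\<rfloor> > 1" using beta_gt1 by linarith
      then show ?thesis using u_q True l_0 by simp
    qed
    ultimately show ?thesis by (intro alt_less_at[of 1]) (auto simp: D_zero)
  qed
  have "x \<in> U \<Longrightarrow> (T ^^ K) x = 0 \<Longrightarrow> alt_less (D x) u" for x K
  proof (induction K arbitrary: x rule: less_induct)
    case (less K)
    obtain k where k: "\<forall>i<k. D x i = case_nat 0 l i" "(- 1) ^ Suc k * (D x k - case_nat 0 l k) < 0"
      using D_less_0l[OF less.prems(1)] unfolding alt_less_def by blast
    have cq: "case_nat 0 l q = l (q - 1)" using q by (cases q) auto
    consider "k < q" | "k = q" | "k > q" by linarith
    then show ?case
    proof cases
      case 1
      then show ?thesis using k u_lt by (intro alt_less_at[of k]) auto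
    next
      case 3
      then have a: "\<forall>i<Suc q. D x i = case_nat 0 l i" using k(1) by simp
      have "alt_less (\<lambda>i. D x (Suc q + i)) (\<lambda>i. case_nat 0 l (Suc q + i))"
        using alt_less_shift[OF a D_less_0l[OF less.prems(1)]] q(2) by simp
      moreover have "(\<lambda>i. D x (Suc q + i)) = D ((T ^^ Suc q) x)" using D_shift by blast
      moreover have "(\<lambda>i. case_nat 0 l (Suc q + i)) = D L" using per by (auto simp: l_eq add.commute)
      ultimately have "(T ^^ Suc q) x < L"
        using D_less_imp T_pow_mem[OF less.prems(1), of "Suc q"] L_in_U by metis
      then show ?thesis using T_pow_mem[OF less.prems(1), of "Suc q"] by simp
    next
      case 2
      then have le: "D x q \<le> u q" using k(2) q cq u_q by simp
      have eq: "\<forall>i<q. D x i = u i" using k(1) 2 u_lt by simp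
      show ?thesis
      proof (cases "D x q = u q")
        case False
        then show ?thesis using le eq q by (intro alt_less_at[of q]) auto
      next
        case True
        then have eq': "\<forall>i<Suc q. D x i = u i" using eq less_Suc_eq by auto
        have "alt_less (D ((T ^^ Suc q) x)) u"
        proof (cases "Suc q \<le> K")
          case True
          then have "(T ^^ (K - Suc q)) ((T ^^ Suc q) x) = 0"
            using less.prems(2) funpow_add[of "K - Suc q" "Suc q" T] by simp
          then show ?thesis using True by (intro less.IH[of "K - Suc q"] T_pow_mem less.prems(1)) auto
        next
          case False
          then have "(T ^^ Suc q) x = (T ^^ (Suc q - K)) ((T ^^ K) x)"
            using funpow_add[of "Suc q - K" K T] by simp
          then show ?thesis using zero_less less.prems(2) T_pow_zero by simp
        qed
        then have "alt_less (\<lambda>i. D x (Suc q + i)) (\<lambda>i. u (Suc q + i))"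
          unfolding D_shift u_per by simp
        then show ?thesis using eq' q(2) by (intro alt_less_unshift[of "Suc q"]) auto
      qed
    qed
  qed
  then show ?thesis using assms u_def by blast
qed

lemma finite_admissible:
  assumes "x \<in> U" "(T ^^ K) x = 0" shows "admissible \<beta> (D x)"
  unfolding admissible_def
proof (intro allI conjI)
  fix n
  have e: "(\<lambda>i. D x (n + i)) = D ((T ^^ n) x)" using D_shift by blast
  have U: "(T ^^ n) x \<in> U" using T_pow_mem[OF assms(1)] .
  show "alt_le l (\<lambda>i. D x (n + i))" unfolding e l_eq using U by (subst D_le_iff) auto
  have "(T ^^ K) ((T ^^ n) x) = (T ^^ n) ((T ^^ K) x)"
    by (metis add.commute comp_apply funpow_add)
  then have "(T ^^ K) ((T ^^ n) x) = 0" using assms(2) T_pow_zero by simp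
  then show "alt_less (\<lambda>i. D x (n + i)) (upper_digits \<beta>)" unfolding e using U finite_less_upper by blast
qed

lemma pad0_Cons: "pad0 (a # w) = case_nat a (pad0 w)"
  by (auto simp: pad0_def split: nat.split)

lemma gam_Cons: "gam \<beta> (a # w) = of_int a * (- \<beta>) ^ length w + gam \<beta> w"
proof -
  have "rev (a # w) ! i = rev w ! i" if "i < length w" for i using that by (simp add: nth_append)
  then show ?thesis by (simp add: gam_def nth_append)
qed

lemma gam_snoc: "gam \<beta> (w @ [a]) = - \<beta> * gam \<beta> w + of_int a"
  by (induction w) (simp_all add: gam_Cons, simp_all add: gam_def algebra_simps)

lemma upper_0: "upper_digits \<beta> 0 = 0" by (simp add: upper_digits_def Let_def)

text \<open>If \<open>v'\<close> is the rescaled value of the suffix, prepending \<open>a\<close>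
  gives -\<beta> v = a + v'. Comparison with \<open>l\<close> bounds this by -\<beta> L, comparison
  with the upper sequence keeps it above -\<beta>(L + 1); hence \<open>v\<close> is in
  \<open>U\<close> and \<open>a\<close> is its first digit.\<close>

lemma admissible_expansion:
  "admissible \<beta> (pad0 w) \<Longrightarrow>
     gam \<beta> w / (- \<beta>) ^ length w \<in> U \<and> D (gam \<beta> w / (- \<beta>) ^ length w) = pad0 w"
proof (induction w)
  case Nil
  show ?case using zero_in_U by (simp add: gam_def D_zero pad0_def)
next
  case (Cons a w)
  define v' where "v' = gam \<beta> w / (- \<beta>) ^ length w"
  define v where "v = gam \<beta> (a # w) / (- \<beta>) ^ length (a # w)"
  have "admissible \<beta> (pad0 w)"
    unfolding admissible_def
  proof
    fix n
    have "(\<lambda>i. pad0 w (n + i)) = (\<lambda>i. pad0 (a # w) (Suc n + i))" by (simp add: pad0_Cons)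
    then show "alt_le l (\<lambda>i. pad0 w (n + i)) \<and> alt_less (\<lambda>i. pad0 w (n + i)) (upper_digits \<beta>)"
      using Cons.prems unfolding admissible_def by metis
  qed
  then have v': "v' \<in> U" "D v' = pad0 w" using Cons.IH by (auto simp: v'_def)
  have vv: "- \<beta> * v = of_int a + v'" using beta_gt1 by (simp add: v_def v'_def gam_Cons field_simps)
  have lo: "alt_le l (case_nat a (D v'))" and up: "alt_less (case_nat a (D v')) (upper_digits \<beta>)"
    using Cons.prems[unfolded admissible_def, rule_format, of 0] by (auto simp: pad0_Cons v')
  have "a \<le> \<lfloor>\<beta>\<rfloor>"
  proof (cases "l = case_nat a (D v')")
    case True then show ?thesis using l_0 by (metis nat.case(1) order_refl)
  next
    case False
    then obtain k where "\<forall>i<k. l i = case_nat a (D v') i" "(- 1) ^ Suc k * (l k - case_nat a (D v') k) < 0"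
      using lo unfolding alt_le_def alt_less_def by blast
    then show ?thesis using l_0 by (cases k) auto
  qed
  have "a \<ge> 0"
  proof -
    obtain k where "\<forall>i<k. case_nat a (D v') i = upper_digits \<beta> i"
      "(- 1) ^ Suc k * (case_nat a (D v') k - upper_digits \<beta> k) < 0"
      using up unfolding alt_less_def by blast
    then show ?thesis using upper_0 by (cases k) auto
  qed
  have top: "of_int a + v' \<le> \<beta> + L"
  proof (cases "a = \<lfloor>\<beta>\<rfloor>")
    case False
    then have "of_int a + 1 \<le> (of_int \<lfloor>\<beta>\<rfloor> :: real)" using \<open>a \<le> \<lfloor>\<beta>\<rfloor>\<close> by linarith
    then have "of_int a + 1 \<le> \<beta>" using of_int_floor_le[of \<beta>] by linarith
    then show ?thesis using v'(1) by simp
  next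
    case True
    \<comment> \<open>Removing the common first digit reverses the comparison with \<open>l\<close>,
      so the lower bound for the string becomes an upper bound for the suffix.\<close>
    have "alt_le (D v') (D (T L))"
    proof (cases "l = case_nat a (D v')")
      case True
      then have "D (T L) = D v'" by (intro ext) (simp add: D_Suc[symmetric] l_eq[symmetric])
      then show ?thesis by (simp add: alt_le_def)
    next
      case False
      then have "alt_less l (case_nat a (D v'))" using lo by (simp add: alt_le_def)
      then have "alt_less (D v') (\<lambda>i. l (Suc i))"
        using alt_less_shift[of 1 l "case_nat a (D v')"] True l_0 by simp
      then show ?thesis by (simp add: alt_le_def l_eq D_Suc)
    qed
    then have "v' \<le> T L" using D_le_iff v'(1) T_mem by blast
    also have "T L = \<beta> + L - of_int a" using T_digit[of L] ell_eqs(1) l_0 True by (simp add: l_eq)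
    finally show ?thesis by simp
  qed
  have bot: "of_int a + v' > L"
  proof (cases "a = 0")
    case False
    then have "(of_int a :: real) \<ge> 1" using \<open>a \<ge> 0\<close> by simp
    then show ?thesis using v'(1) by simp
  next
    case True
    have "v' \<noteq> L" using up not_less_upper True by (auto simp: l_eq)
    then show ?thesis using v'(1) True by simp
  qed
  have "v \<in> U"
  proof -
    have "- \<beta> * v \<le> - \<beta> * L" using top vv ell_eqs by linarith
    moreover have "- \<beta> * v > - \<beta> * (L + 1)" using bot vv ell_eqs by linarith
    ultimately show ?thesis using beta_gt1 by simp
  qed
  moreover have "- \<beta> * v - of_int a \<in> U" using vv v' by simp
  then have "T v = v'" "D v 0 = a" using T_eq[of v a] vv by auto
  then have "D v = pad0 (a # w)"
    by (intro ext) (auto simp: pad0_Cons D_Suc v' split: nat.split)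
  ultimately show ?case by (simp add: v_def)
qed

end

section \<open>Digit sums with digits 0 to \<open>m\<close>, in a base that will be -\<beta> or
  \<beta>\<close>

primrec digit_sums :: "real \<Rightarrow> int \<Rightarrow> nat \<Rightarrow> real set" where
  "digit_sums b m 0 = {0}"
| "digit_sums b m (Suc k) = (\<lambda>(x, a). x + of_int a * b ^ k) ` (digit_sums b m k \<times> {0..m})"

lemma digit_sums_Suc_iff:
  "x \<in> digit_sums b m (Suc k) \<longleftrightarrow> (\<exists>a. 0 \<le> a \<and> a \<le> m \<and> x - of_int a * b ^ k \<in> digit_sums b m k)"
proof
  assume "x \<in> digit_sums b m (Suc k)"
  then obtain y a where "y \<in> digit_sums b m k" "0 \<le> a" "a \<le> m" "x = y + of_int a * b ^ k" by auto
  then show "\<exists>a. 0 \<le> a \<and> a \<le> m \<and> x - of_int a * b ^ k \<in> digit_sums b m k" by (intro exI[of _ a]) auto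
next
  assume "\<exists>a. 0 \<le> a \<and> a \<le> m \<and> x - of_int a * b ^ k \<in> digit_sums b m k"
  then obtain a where "0 \<le> a" "a \<le> m" "x - of_int a * b ^ k \<in> digit_sums b m k" by blast
  then show "x \<in> digit_sums b m (Suc k)" by (auto intro!: image_eqI[of _ _ "(x - of_int a * b ^ k, a)"])
qed

declare digit_sums.simps(2) [simp del]

lemma finite_digit_sums: "finite (digit_sums b m k)"
  by (induction k) (auto simp: digit_sums.simps(2))

lemma digit_sums_mono: "m \<ge> 0 \<Longrightarrow> j \<le> k \<Longrightarrow> digit_sums b m j \<subseteq> digit_sums b m k"
proof (induction k)
  case (Suc k)
  have "digit_sums b m k \<subseteq> digit_sums b m (Suc k)"
    using Suc.prems by (auto simp: digit_sums_Suc_iff intro!: exI[of _ 0])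
  then show ?case using Suc by (cases "j = Suc k") auto
qed simp

lemma digit_sums_eq_sums:
  "x \<in> digit_sums b m k \<longleftrightarrow> (\<exists>a. (\<forall>j<k. 0 \<le> a j \<and> a j \<le> m) \<and> x = (\<Sum>j<k. of_int (a j) * b ^ j))"
proof (induction k arbitrary: x)
  case (Suc k)
  show ?case
  proof
    assume "x \<in> digit_sums b m (Suc k)"
    then obtain c a where c: "0 \<le> c" "c \<le> m" "\<forall>j<k. 0 \<le> a j \<and> a j \<le> m"
      "x - of_int c * b ^ k = (\<Sum>j<k. of_int (a j) * b ^ j)"
      unfolding digit_sums_Suc_iff Suc.IH by blast
    have "(\<Sum>j<k. of_int ((a(k := c)) j) * b ^ j) = (\<Sum>j<k. of_int (a j) * b ^ j)" by (intro sum.cong) auto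
    then have "x = (\<Sum>j<Suc k. of_int ((a(k := c)) j) * b ^ j)" using c(4) by simp
    moreover have "\<forall>j<Suc k. 0 \<le> (a(k := c)) j \<and> (a(k := c)) j \<le> m" using c by auto
    ultimately show "\<exists>a. (\<forall>j<Suc k. 0 \<le> a j \<and> a j \<le> m) \<and> x = (\<Sum>j<Suc k. of_int (a j) * b ^ j)" by blast
  next
    assume "\<exists>a. (\<forall>j<Suc k. 0 \<le> a j \<and> a j \<le> m) \<and> x = (\<Sum>j<Suc k. of_int (a j) * b ^ j)"
    then obtain a where a: "\<forall>j<Suc k. 0 \<le> a j \<and> a j \<le> m" "x = (\<Sum>j<Suc k. of_int (a j) * b ^ j)" by blast
    then show "x \<in> digit_sums b m (Suc k)" unfolding digit_sums_Suc_iff Suc.IH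
      by (intro exI[of _ "a k"] conjI exI[of _ a]) auto
  qed
qed simp

section \<open>Tiles, values of admissible strings and (-\<beta>)-integers\<close>

context neg_base begin

text \<open>
  \<open>J k\<close> is the tile of level \<open>k\<close> and \<open>Zf k\<close> consists of the values of admissible strings of length \<open>k\<close>. Because
  of the open interval in the choice of the exponent, a real number in the interior \<open>JO k\<close> of the tile is a
  \<open>(-\<beta>)\<close>-integer iff it is in \<open>Zf k\<close>; this can fail at the boundary of the tile.
\<close>

definition J :: "nat \<Rightarrow> real set" where "J k = {x. x / (- \<beta>) ^ k \<in> U}"
definition JO :: "nat \<Rightarrow> real set" where "JO k = {x. x / (- \<beta>) ^ k \<in> {L<..<L + 1}}"
definition Zf :: "nat \<Rightarrow> real set" where "Zf k = {x \<in> J k. (T ^^ k) (x / (- \<beta>) ^ k) = 0}"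

definition m :: int where "m = \<lfloor>\<beta>\<rfloor>"
abbreviation "Xf \<equiv> digit_sums (- \<beta>) m"

lemma mb_nz: "(- \<beta>) ^ k \<noteq> 0" using beta_gt1 by simp

lemma pow_pos: "\<beta> ^ k > 0" using beta_gt1 by simp

lemma JO_sub: "JO k \<subseteq> J k" by (auto simp: J_def JO_def)

lemma J_iff: "x \<in> J k \<longleftrightarrow>
   (if even k then - (\<beta> ^ Suc k) \<le> x * (\<beta> + 1) \<and> x * (\<beta> + 1) < \<beta> ^ k
    else - (\<beta> ^ k) < x * (\<beta> + 1) \<and> x * (\<beta> + 1) \<le> \<beta> ^ Suc k)"
proof -
  have L1: "L = - \<beta> / (\<beta> + 1)" "L + 1 = 1 / (\<beta> + 1)" using beta_gt1 by (auto simp: ell_def field_simps)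
  show ?thesis
    unfolding J_def atLeastLessThan_iff mem_Collect_eq L1 
    using beta_gt1 pow_pos[of k] by (cases "even k") (auto simp: field_simps)
qed

lemma JO_iff: "x \<in> JO k \<longleftrightarrow>
   (if even k then - (\<beta> ^ Suc k) < x * (\<beta> + 1) \<and> x * (\<beta> + 1) < \<beta> ^ k
    else - (\<beta> ^ k) < x * (\<beta> + 1) \<and> x * (\<beta> + 1) < \<beta> ^ Suc k)"
proof -
  have L1: "L = - \<beta> / (\<beta> + 1)" "L + 1 = 1 / (\<beta> + 1)" using beta_gt1 by (auto simp: ell_def field_simps)
  show ?thesis
    unfolding JO_def greaterThanLessThan_iff mem_Collect_eq L1 
    using beta_gt1 pow_pos[of k] by (cases "even k") (auto simp: field_simps)
qed

lemma J_between:
  assumes "x \<in> J k" "z \<in> J k" "x < y" "y < z" shows "y \<in> JO k"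
proof -
  have "x * (\<beta> + 1) < y * (\<beta> + 1)" "y * (\<beta> + 1) < z * (\<beta> + 1)" using assms(3,4) beta_gt1 by auto
  then show ?thesis using assms(1,2) unfolding J_iff JO_iff by (auto split: if_splits)
qed

lemma Zf_0: "Zf 0 = {0}" using zero_in_U by (auto simp: Zf_def J_def)

text \<open>Applying \<open>T\<close> to x / (-\<beta>)^(k+1) strips the leading digit
  \<open>a\<close> and rescales the rest to level \<open>k\<close>.\<close>

lemma Zf_Suc: "x \<in> Zf (Suc k) \<longleftrightarrow>
   x \<in> J (Suc k) \<and> (\<exists>a. 0 \<le> a \<and> a \<le> m \<and> x - of_int a * (- \<beta>) ^ k \<in> Zf k)"
proof -
  define u where "u = x / (- \<beta>) ^ Suc k"
  have e: "- \<beta> * u - of_int a = (x - of_int a * (- \<beta>) ^ k) / (- \<beta>) ^ k" for a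
    using mb_nz[of k] beta_gt1 by (simp add: u_def field_simps)
  have s: "(T ^^ Suc k) u = (T ^^ k) (T u)" by (simp add: funpow_swap1)
  show ?thesis
  proof
    assume x: "x \<in> Zf (Suc k)"
    then have u: "u \<in> U" "(T ^^ Suc k) u = 0" by (auto simp: Zf_def J_def u_def)
    have "T u = (x - of_int (D u 0) * (- \<beta>) ^ k) / (- \<beta>) ^ k" unfolding T_digit e ..
    then have "x - of_int (D u 0) * (- \<beta>) ^ k \<in> Zf k"
      using u(2) T_mem[of u] unfolding s by (simp add: Zf_def J_def)
    then show "x \<in> J (Suc k) \<and> (\<exists>a. 0 \<le> a \<and> a \<le> m \<and> x - of_int a * (- \<beta>) ^ k \<in> Zf k)"
      using x digit_bounds[OF u(1)] by (auto simp: Zf_def m_def)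
  next
    assume "x \<in> J (Suc k) \<and> (\<exists>a. 0 \<le> a \<and> a \<le> m \<and> x - of_int a * (- \<beta>) ^ k \<in> Zf k)"
    then obtain a where a: "x \<in> J (Suc k)" "x - of_int a * (- \<beta>) ^ k \<in> Zf k" by blast
    then have "- \<beta> * u - of_int a \<in> U" unfolding e by (simp add: Zf_def J_def)
    then have "T u = (x - of_int a * (- \<beta>) ^ k) / (- \<beta>) ^ k" using T_eq(1) e by simp
    then have "(T ^^ Suc k) u = 0" unfolding s using a(2) by (simp add: Zf_def)
    then show "x \<in> Zf (Suc k)" using a(1) by (simp add: Zf_def u_def)
  qed
qed

lemma Zf_sub_J: "Zf k \<subseteq> J k" by (auto simp: Zf_def)

lemma Zf_sub_Xf: "Zf k \<subseteq> Xf k"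
proof (induction k)
  case (Suc k) then show ?case unfolding digit_sums_Suc_iff Zf_Suc subset_iff by blast
qed (simp add: Zf_0)

lemma finite_Zf: "finite (Zf k)" using Zf_sub_Xf finite_digit_sums finite_subset by blast

lemma zero_in_Zf: "0 \<in> Zf k" using zero_in_U by (simp add: Zf_def J_def T_pow_zero)

text \<open>Criterion for explicit strings: if all suffix values lie in their tiles, the string is
  the expansion of its value. Here \<open>a i\<close> belongs to the power \<open>i\<close>, while
  \<open>D\<close> counts from the top, whence \<open>k - 1 - j\<close>.\<close>

lemma digit_string:
  assumes "\<And>j. j \<le> k \<Longrightarrow> (\<Sum>i<j. of_int (a i) * (- \<beta>) ^ i) \<in> J j"
  defines "s \<equiv> \<lambda>j. (\<Sum>i<j. of_int (a i) * (- \<beta>) ^ i)"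
  shows "s k \<in> Zf k" "j < k \<Longrightarrow> D (s k / (- \<beta>) ^ k) j = a (k - 1 - j)"
proof -
  have "s k \<in> Zf k \<and> (\<forall>j<k. D (s k / (- \<beta>) ^ k) j = a (k - 1 - j))" using assms(1)
  proof (induction k)
    case 0 show ?case by (simp add: s_def Zf_0)
  next
    case (Suc k)
    have IH: "s k \<in> Zf k" "\<And>j. j < k \<Longrightarrow> D (s k / (- \<beta>) ^ k) j = a (k - 1 - j)" using Suc by auto
    define u where "u = s (Suc k) / (- \<beta>) ^ Suc k"
    have e: "- \<beta> * u - of_int (a k) = s k / (- \<beta>) ^ k"
      using mb_nz[of k] beta_gt1 by (simp add: u_def s_def field_simps)
    have "s k / (- \<beta>) ^ k \<in> U" using Suc.prems[of k] by (simp add: J_def s_def)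
    then have T: "T u = s k / (- \<beta>) ^ k" "D u 0 = a k" using T_eq[of u "a k"] e by auto
    have "(T ^^ Suc k) u = 0" using IH(1) by (simp add: funpow_swap1 T Zf_def)
    moreover have "u \<in> U" using Suc.prems[of "Suc k"] by (simp add: J_def s_def u_def)
    ultimately have "s (Suc k) \<in> Zf (Suc k)" by (simp add: Zf_def J_def u_def)
    moreover have "D u j = a (Suc k - 1 - j)" if "j < Suc k" for j
      using that IH(2) by (cases j) (auto simp: T D_Suc)
    ultimately show ?case by (simp add: u_def)
  qed
  then show "s k \<in> Zf k" "j < k \<Longrightarrow> D (s k / (- \<beta>) ^ k) j = a (k - 1 - j)" by auto
qed

lemma T_div: 
  assumes "u \<in> U" shows "T (u / (- \<beta>)) = u" "D (u / (- \<beta>)) 0 = 0"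
proof -
  have "- \<beta> * (u / (- \<beta>)) = u" using beta_gt1 by simp
  then show "T (u / (- \<beta>)) = u" "D (u / (- \<beta>)) 0 = 0" using T_eq[of "u / (- \<beta>)" 0] assms by auto
qed

lemma div_Suc: "x / (- \<beta>) ^ Suc k = (x / (- \<beta>) ^ k) / (- \<beta>)"
  by (simp add: mult.commute)

lemma JO_Suc: "x \<in> JO k \<Longrightarrow> x \<in> JO (Suc k)"
proof -
  assume "x \<in> JO k"
  moreover have "\<beta> ^ k < \<beta> ^ Suc k" "\<beta> ^ Suc k < \<beta> ^ Suc (Suc k)"
    using beta_gt1 by (auto intro: power_strict_increasing)
  ultimately show ?thesis unfolding JO_iff by (auto split: if_splits)
qed

lemma JO_mono:
  assumes "x \<in> JO k" "k \<le> k'" shows "x \<in> JO k'"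
  using assms(2,1) by (induction k' rule: dec_induct) (auto intro: JO_Suc)

lemma ex_JO: "\<exists>k. x \<in> JO k"
proof -
  obtain k where k: "\<bar>x\<bar> * (\<beta> + 1) < \<beta> ^ k" using real_arch_pow[OF beta_gt1] by blast
  have "\<beta> ^ k < \<beta> ^ Suc k" using beta_gt1 by (auto intro: power_strict_increasing)
  moreover have "\<bar>x * (\<beta> + 1)\<bar> < \<beta> ^ k" using k beta_gt1 by (simp add: abs_mult)
  ultimately have "x \<in> JO k" unfolding JO_iff by (auto split: if_splits)
  then show ?thesis ..
qed

text \<open>The exponent in the definition is the least possible one. Open tiles are nested and
  raising the exponent only puts a digit 0 in front, so every \<open>k\<close> with \<open>x\<close>
  in \<open>JO k\<close> gives the same digits.\<close>

lemma neg_expansion_eq: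
  assumes "x \<in> JO k"
  shows "neg_expansion \<beta> x i = (if i < int k then D (x / (- \<beta>) ^ k) (nat (int k - 1 - i)) else 0)"
proof -
  define E where "E k i = (if i < int k then D (x / (- \<beta>) ^ k) (nat (int k - 1 - i)) else 0)" for k i
  define K where "K = exp_shift \<beta> x"
  have K: "x \<in> JO K" "K \<le> k"
    using assms LeastI[of "\<lambda>k. x \<in> JO k" k] Least_le[of "\<lambda>k. x \<in> JO k" k]
    by (simp_all add: K_def exp_shift_def JO_def)
  have step: "E (Suc k) i = E k i" if "x \<in> JO k" for k
  proof -
    have u: "x / (- \<beta>) ^ k \<in> U" using that JO_sub by (auto simp: J_def)
    consider "i < int k" | "i = int k" | "i > int k" by linarith
    then show ?thesis
    proof cases
      case 1
      then have "nat (int (Suc k) - 1 - i) = Suc (nat (int k - 1 - i))" by simp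
      then show ?thesis using 1 T_div(1)[OF u] unfolding E_def div_Suc by (simp add: D_Suc)
    next
      case 2 then show ?thesis using T_div(2)[OF u] unfolding E_def div_Suc by simp
    qed (simp add: E_def)
  qed
  have "E k i = E K i" using K(2) K(1)
  proof (induction k rule: dec_induct)
    case (step n) then show ?case using step(3) \<open>\<And>k. x \<in> JO k \<Longrightarrow> E (Suc k) i = E k i\<close> JO_mono by metis
  qed simp
  moreover have "neg_expansion \<beta> x i = E K i" by (simp add: neg_expansion_def E_def K_def Let_def)
  ultimately show ?thesis by (simp add: E_def)
qed

lemma neg_integers_iff:
  assumes "x \<in> JO k" shows "x \<in> neg_integers \<beta> \<longleftrightarrow> x \<in> Zf k"
proof -
  define u where "u = x / (- \<beta>) ^ k"
  have u: "u \<in> U" "x \<in> J k" using assms JO_sub by (auto simp: J_def u_def)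
  have "x \<in> neg_integers \<beta> \<longleftrightarrow> (\<forall>i<0. D u (nat (int k - 1 - i)) = 0)"
    unfolding neg_integers_def mem_Collect_eq neg_expansion_eq[OF assms] u_def by auto
  also have "\<dots> \<longleftrightarrow> (\<forall>j. D u (k + j) = 0)"
  proof
    assume a: "\<forall>i<0. D u (nat (int k - 1 - i)) = 0"
    show "\<forall>j. D u (k + j) = 0"
    proof
      fix j
      have "(- 1 - int j) < 0" by simp
      then have "D u (nat (int k - 1 - (- 1 - int j))) = 0" using a by blast
      moreover have "nat (int k - 1 - (- 1 - int j)) = k + j" by linarith
      ultimately show "D u (k + j) = 0" by (simp only:)
    qed
  next
    assume a: "\<forall>j. D u (k + j) = 0"
    show "\<forall>i<0. D u (nat (int k - 1 - i)) = 0"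
    proof (intro allI impI)
      fix i :: int assume "i < 0"
      then have "nat (int k - 1 - i) = k + nat (- 1 - i)" by simp
      then show "D u (nat (int k - 1 - i)) = 0" using a by simp
    qed
  qed
  also have "\<dots> \<longleftrightarrow> D ((T ^^ k) u) = D 0"
  proof -
    have "D u (k + j) = D ((T ^^ k) u) j" for j by (rule D_shift)
    then show ?thesis by (simp add: D_zero fun_eq_iff)
  qed
  also have "\<dots> \<longleftrightarrow> (T ^^ k) u = 0" using D_inj[OF T_pow_mem[OF u(1)] zero_in_U] by auto
  finally show ?thesis using u(2) by (simp add: Zf_def u_def)
qed

lemma adm_string_value:
  assumes "w \<in> adm_strings \<beta> k"
  shows "gam \<beta> w \<in> Zf k" "D (gam \<beta> w / (- \<beta>) ^ k) = pad0 w"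
proof -
  have w: "length w = k" "admissible \<beta> (pad0 w)" using assms by (auto simp: adm_strings_def)
  define v where "v = gam \<beta> w / (- \<beta>) ^ k"
  have v: "v \<in> U" "D v = pad0 w" using admissible_expansion[OF w(2)] w(1) by (auto simp: v_def)
  have "D ((T ^^ k) v) = D 0" unfolding D_zero
  proof
    fix i show "D ((T ^^ k) v) i = 0" using D_shift[of v k i] v(2) w(1) by (simp add: pad0_def)
  qed
  then have "(T ^^ k) v = 0" using D_inj[OF T_pow_mem[OF v(1)] zero_in_U] by auto
  then show "gam \<beta> w \<in> Zf k" using v(1) by (simp add: Zf_def J_def v_def)
  show "D (gam \<beta> w / (- \<beta>) ^ k) = pad0 w" using v by (simp add: v_def)
qed

text \<open>Together with \<open>adm_string_value\<close> this turns questions on admissible strings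
  of length \<open>k\<close> into questions on the finite set \<open>Zf k\<close> of reals.\<close>

lemma ex_adm_string:
  assumes "x \<in> Zf k" shows "\<exists>w\<in>adm_strings \<beta> k. gam \<beta> w = x"
proof -
  define u where "u = x / (- \<beta>) ^ k"
  have u: "u \<in> U" "(T ^^ k) u = 0" using assms by (auto simp: Zf_def J_def u_def)
  define w where "w = map (D u) [0..<k]"
  have "pad0 w = D u"
  proof
    fix i show "pad0 w i = D u i"
    proof (cases "i < k")
      case False
      then obtain j where "i = k + j" using le_Suc_ex not_less by blast
      then show ?thesis using D_shift[of u k j] u(2) by (simp add: pad0_def w_def D_zero)
    qed (simp add: pad0_def w_def)
  qed
  then have w: "w \<in> adm_strings \<beta> k"
    using finite_admissible[OF u] by (simp add: adm_strings_def w_def)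
  have "gam \<beta> w / (- \<beta>) ^ k \<in> U" "D (gam \<beta> w / (- \<beta>) ^ k) = D u"
    using adm_string_value[OF w] \<open>pad0 w = D u\<close> by (auto simp: Zf_def J_def)
  then have "gam \<beta> w / (- \<beta>) ^ k = u" using D_inj[OF _ u(1)] by blast
  then have "gam \<beta> w = x" using beta_gt1 by (simp add: u_def)
  then show ?thesis using w by blast
qed

lemma adm_string_le_iff:
  assumes "w \<in> adm_strings \<beta> k" "v \<in> adm_strings \<beta> k"
  shows "alt_le (pad0 w) (pad0 v) \<longleftrightarrow> gam \<beta> w / (- \<beta>) ^ k \<le> gam \<beta> v / (- \<beta>) ^ k"
  using D_le_iff[of "gam \<beta> w / (- \<beta>) ^ k" "gam \<beta> v / (- \<beta>) ^ k"]
    adm_string_value[OF assms(1)] adm_string_value[OF assms(2)]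
  by (auto simp: Zf_def J_def)

lemma pad0_inj: "pad0 w = pad0 v \<Longrightarrow> length w = length v \<Longrightarrow> w = v"
  by (metis nth_equalityI pad0_def)

lemma gam_min_string:
  assumes "x \<in> Zf k" "\<And>y. y \<in> Zf k \<Longrightarrow> x / (- \<beta>) ^ k \<le> y / (- \<beta>) ^ k"
  shows "gam \<beta> (min_string \<beta> k) = x"
proof -
  obtain w where w: "w \<in> adm_strings \<beta> k" "gam \<beta> w = x" using ex_adm_string[OF assms(1)] by blast
  have "min_string \<beta> k = w" unfolding min_string_def
  proof (rule the_equality)
    show "w \<in> adm_strings \<beta> k \<and> (\<forall>u\<in>adm_strings \<beta> k. alt_le (pad0 w) (pad0 u))"
      using w assms(2) adm_string_value(1) by (auto simp: adm_string_le_iff)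
    then show "v = w" if "v \<in> adm_strings \<beta> k \<and> (\<forall>u\<in>adm_strings \<beta> k. alt_le (pad0 v) (pad0 u))" for v
      using that w(1) by (intro pad0_inj alt_le_antisym) (auto simp: adm_strings_def)
  qed
  then show ?thesis using w by simp
qed

lemma gam_max_string:
  assumes "x \<in> Zf k" "\<And>y. y \<in> Zf k \<Longrightarrow> y / (- \<beta>) ^ k \<le> x / (- \<beta>) ^ k"
  shows "gam \<beta> (max_string \<beta> k) = x"
proof -
  obtain w where w: "w \<in> adm_strings \<beta> k" "gam \<beta> w = x" using ex_adm_string[OF assms(1)] by blast
  have "max_string \<beta> k = w" unfolding max_string_def
  proof (rule the_equality)
    show "w \<in> adm_strings \<beta> k \<and> (\<forall>u\<in>adm_strings \<beta> k. alt_le (pad0 u) (pad0 w))"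
      using w assms(2) adm_string_value(1) by (auto simp: adm_string_le_iff)
    then show "v = w" if "v \<in> adm_strings \<beta> k \<and> (\<forall>u\<in>adm_strings \<beta> k. alt_le (pad0 u) (pad0 v))" for v
      using that w(1) by (intro pad0_inj alt_le_antisym) (auto simp: adm_strings_def)
  qed
  then show ?thesis using w by simp
qed

definition zmax :: "nat \<Rightarrow> real" where "zmax k = Max (Zf k)"
definition zmin :: "nat \<Rightarrow> real" where "zmin k = Min (Zf k)"

lemma zmax_in: "zmax k \<in> Zf k" and zmin_in: "zmin k \<in> Zf k"
  unfolding zmax_def zmin_def using finite_Zf zero_in_Zf by (metis Max_in Min_in empty_iff)+

lemma zmax_ge: "x \<in> Zf k \<Longrightarrow> x \<le> zmax k" and zmin_le: "x \<in> Zf k \<Longrightarrow> zmin k \<le> x"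
  unfolding zmax_def zmin_def using finite_Zf by auto

lemma zmaxI: "x \<in> Zf k \<Longrightarrow> (\<And>y. y \<in> Zf k \<Longrightarrow> y \<le> x) \<Longrightarrow> zmax k = x"
  unfolding zmax_def by (rule Max_eqI) (use finite_Zf in auto)

lemma zminI: "x \<in> Zf k \<Longrightarrow> (\<And>y. y \<in> Zf k \<Longrightarrow> x \<le> y) \<Longrightarrow> zmin k = x"
  unfolding zmin_def by (rule Min_eqI) (use finite_Zf in auto)

text \<open>Division by (-\<beta>)^k reverses the order for odd \<open>k\<close>; the smallest
  string then has the largest value.\<close>

lemma gam_extreme:
  "gam \<beta> (min_string \<beta> k) = (if even k then zmin k else zmax k)"
  "gam \<beta> (max_string \<beta> k) = (if even k then zmax k else zmin k)"
proof -
  have d: "x / (- \<beta>) ^ k \<le> y / (- \<beta>) ^ k \<longleftrightarrow> (if even k then x \<le> y else y \<le> x)" for x y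
    using pow_pos[of k] beta_gt1 by (cases "even k") (auto simp: divide_le_cancel field_simps)
  show "gam \<beta> (min_string \<beta> k) = (if even k then zmin k else zmax k)"
    by (rule gam_min_string) (auto simp: d zmax_in zmin_in intro: zmax_ge zmin_le)
  show "gam \<beta> (max_string \<beta> k) = (if even k then zmax k else zmin k)"
    by (rule gam_max_string) (auto simp: d zmax_in zmin_in intro: zmax_ge zmin_le)
qed

text \<open>The parity cases of the definition merge: the order reversals at the levels
  \<open>k\<close> and \<open>k + 1\<close> exchange the two words exactly when the definition
  does.\<close>

lemma psi_nat_eq:
  "psi_nat \<beta> k = gap_word \<beta> (- \<beta> * zmin k) (zmax (Suc k)) @ [Suc k] @
     rev (gap_word \<beta> (- \<beta> * zmax k) (zmin (Suc k)))"
  by (simp add: psi_nat_def S_word_def R_word_def gam_snoc gam_extreme)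

lemma gap_length_eq: "gap_length \<beta> k = \<bar>\<beta> ^ k - zmax k + zmin k\<bar>"
proof -
  have "\<bar>- (\<beta> ^ k) + zmax k - zmin k\<bar> = \<bar>\<beta> ^ k - zmax k + zmin k\<bar>" by linarith
  then show ?thesis by (auto simp: gap_length_def gam_extreme algebra_simps)
qed

end

section \<open>Gap words along arithmetic progressions of step 1\<close>

lemma sorted_list_of_set_arith:
  "sorted_list_of_set ((\<lambda>t. c + real t) ` {..<n}) = map (\<lambda>t. c + real t) [0..<n]"
proof (rule sorted_distinct_set_unique)
  show "sorted (map (\<lambda>t. c + real t) [0..<n])" by (auto simp: sorted_iff_nth_mono)
  show "distinct (map (\<lambda>t. c + real t) [0..<n])" by (auto simp: distinct_map inj_on_def)
qed (auto simp: atLeast0LessThan)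

lemma gap_word_arith:
  assumes "neg_integers \<beta> \<inter> {c..c + real n} = (\<lambda>t. c + real t) ` {..<Suc n}"
  shows "gap_word \<beta> c (c + real n) = map (\<lambda>t. gap_letter \<beta> (c + real t) (c + real (Suc t))) [0..<n]"
proof -
  have "sorted_list_of_set (neg_integers \<beta> \<inter> {c..c + real n}) = map (\<lambda>t. c + real t) [0..<Suc n]"
    unfolding assms by (rule sorted_list_of_set_arith)
  moreover have "map2 f (map g [0..<Suc n]) (tl (map g [0..<Suc n])) = map (\<lambda>t. f (g t) (g (Suc t))) [0..<n]"
    for f :: "real \<Rightarrow> real \<Rightarrow> nat" and g
    by (rule nth_equalityI) (auto simp: nth_tl simp del: upt_Suc)
  ultimately show ?thesis by (simp add: gap_word_def del: upt_Suc)
qed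

lemma gap_word_same: "gap_word \<beta> a a = []"
proof -
  consider "neg_integers \<beta> \<inter> {a..a} = {}" | "neg_integers \<beta> \<inter> {a..a} = {a}" by auto
  then show ?thesis by cases (simp_all add: gap_word_def)
qed

lemma length_gap_word: "length (gap_word \<beta> a b) = card (neg_integers \<beta> \<inter> {min a b..max a b}) - 1"
  by (simp add: gap_word_def Let_def)

section \<open>The numbers \<open>dl k\<close> and the extreme digit sums\<close>

context neg_base begin

lemma m_pos: "m \<ge> 1" unfolding m_def by (rule floor_beta_pos)

lemma m_le: "of_int m \<le> \<beta>" and m_gt: "\<beta> < of_int m + 1" unfolding m_def by linarith+

lemma m_ge1_real: "(1::real) \<le> of_int m" using m_pos by simp

text \<open>
  As long as \<open>dl k\<close> is nonnegative, it is \<open>T_\<beta>^k(1)\<close>, the gap coded by the letter \<open>k\<close> of the canonical morphism.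
\<close>

definition dl :: "nat \<Rightarrow> real" where "dl k = \<beta> ^ k - of_int m * (\<Sum>i<k. \<beta> ^ i)"

lemma dl_0 [simp]: "dl 0 = 1" by (simp add: dl_def)

lemma dl_Suc: "dl (Suc k) = \<beta> * dl k - of_int m"
  unfolding dl_def sum.lessThan_Suc_shift by (simp add: sum_distrib_left algebra_simps)

lemma dl_le1: "dl k \<le> 1"
proof (induction k)
  case (Suc k)
  have "\<beta> * dl k \<le> \<beta> * 1" using Suc beta_gt1 by (intro mult_left_mono) auto
  then show ?case using m_gt by (simp add: dl_Suc)
qed simp

lemma dl_Suc_less: "dl (Suc k) < dl k"
proof -
  have "(\<beta> - 1) * dl k \<le> (\<beta> - 1) * 1" using dl_le1 beta_gt1 by (intro mult_left_mono) auto
  then show ?thesis using m_gt by (simp add: dl_Suc algebra_simps)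
qed

lemma dl_less: "i < j \<Longrightarrow> dl j < dl i"
  by (rule strict_mono_less[of "\<lambda>k. - dl k", simplified, THEN iffD2])
    (auto simp: strict_mono_Suc_iff dl_Suc_less)

lemma dl_le: "i \<le> j \<Longrightarrow> dl j \<le> dl i"
  using dl_less by (cases "i = j") (auto simp: less_imp_le)

lemma dl_pred_pos: "dl (Suc k) \<ge> 0 \<Longrightarrow> dl k > 0"
proof -
  assume "dl (Suc k) \<ge> 0"
  then have "\<beta> * dl k > 0" using m_ge1_real by (simp add: dl_Suc)
  then show ?thesis using beta_gt1 by (simp add: zero_less_mult_iff)
qed

text \<open>
  \<open>Q k\<close> and \<open>- P k\<close> are the extreme values of strings of length \<open>k\<close> over \<open>{0..m}\<close>: the digit \<open>m\<close> stands at
  all even positions for \<open>Q k\<close> and at all odd positions for \<open>- P k\<close>.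
\<close>

definition Q :: "nat \<Rightarrow> real" where
  "Q k = (\<Sum>j<k. of_int (if even j then m else 0) * (- \<beta>) ^ j)"
definition P :: "nat \<Rightarrow> real" where
  "P k = - (\<Sum>j<k. of_int (if odd j then m else 0) * (- \<beta>) ^ j)"

lemma Q_0 [simp]: "Q 0 = 0" and P_0 [simp]: "P 0 = 0" by (simp_all add: Q_def P_def)

lemma Q_add: "Q (Suc k) = Q k + (if even k then of_int m * \<beta> ^ k else 0)"
  and P_add: "P (Suc k) = P k + (if odd k then of_int m * \<beta> ^ k else 0)"
  by (simp_all add: Q_def P_def)

lemma Q_Suc: "Q (Suc k) = \<beta> * P k + of_int m" and P_Suc: "P (Suc k) = \<beta> * Q k"
proof (induction k)
  case (Suc k)
  { case 1 show ?case by (subst Q_add, subst P_add, subst Suc(1)) (simp add: algebra_simps) }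
  { case 2 show ?case by (subst P_add, subst Q_add, subst Suc(2)) (simp add: algebra_simps) }
qed (simp_all add: Q_add P_add)

text \<open>The tile bounds in \<open>J_iff\<close> carry the factor \<beta> + 1. In this
  normalisation the extreme digit sums miss the powers bounding the tile by multiples of some
  \<open>dl\<close>, so that signs of \<open>dl\<close> decide whether they are inside.\<close>

lemma QP_even: "Q (2 * j) * (\<beta> + 1) = \<beta> ^ (2 * j) - dl (2 * j)"
    "P (2 * j) * (\<beta> + 1) = \<beta> ^ Suc (2 * j) - \<beta> * dl (2 * j)"
  and QP_odd: "Q (Suc (2 * j)) * (\<beta> + 1) = \<beta> ^ Suc (Suc (2 * j)) - dl (Suc (Suc (2 * j)))"
    "P (Suc (2 * j)) * (\<beta> + 1) = \<beta> ^ Suc (2 * j) - \<beta> * dl (2 * j)"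
proof -
  have e: "Q (2 * j) * (\<beta> + 1) = \<beta> ^ (2 * j) - dl (2 * j) \<and>
        P (2 * j) * (\<beta> + 1) = \<beta> ^ Suc (2 * j) - \<beta> * dl (2 * j)" for j
  proof (induction j)
    case (Suc j)
    have "Q (2 * Suc j) = \<beta> * (\<beta> * Q (2 * j)) + of_int m"
      "P (2 * Suc j) = \<beta> * (\<beta> * P (2 * j) + of_int m)" by (simp_all add: Q_Suc P_Suc)
    then have "Q (2 * Suc j) * (\<beta> + 1) = \<beta> * \<beta> * (Q (2 * j) * (\<beta> + 1)) + of_int m * (\<beta> + 1)"
      "P (2 * Suc j) * (\<beta> + 1) = \<beta> * \<beta> * (P (2 * j) * (\<beta> + 1)) + of_int m * \<beta> * (\<beta> + 1)"
      by (simp_all add: algebra_simps)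
    then show ?case unfolding Suc.IH[THEN conjunct1] Suc.IH[THEN conjunct2] by (simp add: dl_Suc algebra_simps)
  qed simp
  then show "Q (2 * j) * (\<beta> + 1) = \<beta> ^ (2 * j) - dl (2 * j)"
    "P (2 * j) * (\<beta> + 1) = \<beta> ^ Suc (2 * j) - \<beta> * dl (2 * j)" by blast+
  have "Q (Suc (2 * j)) * (\<beta> + 1) = \<beta> * (P (2 * j) * (\<beta> + 1)) + of_int m * (\<beta> + 1)"
    "P (Suc (2 * j)) * (\<beta> + 1) = \<beta> * (Q (2 * j) * (\<beta> + 1))"
    by (simp_all add: Q_Suc P_Suc algebra_simps)
  then show "Q (Suc (2 * j)) * (\<beta> + 1) = \<beta> ^ Suc (Suc (2 * j)) - dl (Suc (Suc (2 * j)))"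
    "P (Suc (2 * j)) * (\<beta> + 1) = \<beta> ^ Suc (2 * j) - \<beta> * dl (2 * j)"
    unfolding e[of j, THEN conjunct1] e[of j, THEN conjunct2] by (simp_all add: dl_Suc algebra_simps)
qed

lemma Q_mult: "Q k * (\<beta> + 1) = (if even k then \<beta> ^ k - dl k else \<beta> ^ Suc k - dl (Suc k))"
  using QP_even(1)[of "k div 2"] QP_odd(1)[of "k div 2"] by (cases "even k") auto

lemma P_mult: "P k * (\<beta> + 1) = (if even k then \<beta> ^ Suc k - \<beta> * dl k else \<beta> ^ k - \<beta> * dl (k - 1))"
  using QP_even(2)[of "k div 2"] QP_odd(2)[of "k div 2"] by (cases "even k") auto

lemma Q_nonneg: "Q k \<ge> 0" and P_nonneg: "P k \<ge> 0"
  by (induction k) (use m_ge1_real beta_gt1 in \<open>auto simp: Q_add P_add\<close>)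

lemma Q_ge_m: "k \<ge> 1 \<Longrightarrow> Q k \<ge> of_int m"
proof (cases k)
  case (Suc j)
  have "\<beta> * P j \<ge> 0" using P_nonneg beta_gt1 by simp
  then show ?thesis using Suc by (simp add: Q_Suc)
qed simp

lemma QP_sum: "Q k + P k = \<beta> ^ k - dl k"
  by (induction k) (auto simp: Q_add P_add dl_def algebra_simps)

section \<open>Digit sums near the ends of their range\<close>

abbreviation "Yf \<equiv> digit_sums \<beta> m"

text \<open>At odd powers the digit \<open>a\<close> is exchanged for \<open>m - a\<close>; then
  only powers of \<beta> remain, and the least element \<open>- P k\<close> goes to 0.\<close>

lemma Xf_Yf: "x \<in> Xf k \<longleftrightarrow> x + P k \<in> Yf k"
proof (induction k arbitrary: x)
  case (Suc k)
  show ?case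
  proof (cases "even k")
    case True
    then show ?thesis unfolding digit_sums_Suc_iff Suc.IH by (simp add: P_add algebra_simps)
  next
    case False
    have "(\<exists>a. 0 \<le> a \<and> a \<le> m \<and> x - of_int a * (- \<beta>) ^ k + P k \<in> Yf k) \<longleftrightarrow>
       (\<exists>a. 0 \<le> a \<and> a \<le> m \<and> x + P (Suc k) - of_int a * \<beta> ^ k \<in> Yf k)" (is "?l \<longleftrightarrow> ?r")
    proof
      assume ?l
      then obtain a where "0 \<le> a" "a \<le> m" "x - of_int a * (- \<beta>) ^ k + P k \<in> Yf k" by blast
      then show ?r using False by (intro exI[of _ "m - a"]) (auto simp: P_add algebra_simps)
    next
      assume ?r
      then obtain a where "0 \<le> a" "a \<le> m" "x + P (Suc k) - of_int a * \<beta> ^ k \<in> Yf k" by blast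
      then show ?l using False by (intro exI[of _ "m - a"]) (auto simp: P_add algebra_simps)
    qed
    then show ?thesis unfolding digit_sums_Suc_iff Suc.IH .
  qed
qed simp

text \<open>All digits \<open>a\<close> are replaced by \<open>m - a\<close>.\<close>

lemma Yf_sym: "y \<in> Yf k \<longleftrightarrow> Q k + P k - y \<in> Yf k"
proof -
  have "y \<in> Yf k \<Longrightarrow> Q k + P k - y \<in> Yf k" for y
  proof (induction k arbitrary: y)
    case (Suc k)
    then obtain a where a: "0 \<le> a" "a \<le> m" "y - of_int a * \<beta> ^ k \<in> Yf k" unfolding digit_sums_Suc_iff by blast
    then have "Q k + P k - (y - of_int a * \<beta> ^ k) \<in> Yf k" using Suc.IH by blast
    moreover have "Q k + P k - (y - of_int a * \<beta> ^ k) = Q (Suc k) + P (Suc k) - y - of_int (m - a) * \<beta> ^ k"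
      by (cases "even k") (auto simp: Q_add P_add algebra_simps)
    ultimately show ?case unfolding digit_sums_Suc_iff using a by (intro exI[of _ "m - a"]) auto
  qed simp
  from this[of y] this[of "Q k + P k - y"] show ?thesis by auto
qed

lemma Yf_nonneg: "y \<in> Yf k \<Longrightarrow> y \<ge> 0"
proof (induction k arbitrary: y)
  case (Suc k)
  then obtain a where a: "0 \<le> a" "y - of_int a * \<beta> ^ k \<ge> 0" unfolding digit_sums_Suc_iff by blast
  moreover have "of_int a * \<beta> ^ k \<ge> 0" using a beta_gt1 by simp
  ultimately show ?case by linarith
qed simp

text \<open>A nonzero digit at a positive power already contributes at least \<beta>, and \<beta> is
  at least \<open>m\<close>.\<close>

lemma Yf_small: "y \<in> Yf k \<Longrightarrow> y \<le> of_int m \<Longrightarrow> \<exists>i. 0 \<le> i \<and> i \<le> m \<and> y = of_int i"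
proof (induction k arbitrary: y)
  case (Suc k)
  then obtain a where a: "0 \<le> a" "a \<le> m" "y - of_int a * \<beta> ^ k \<in> Yf k" unfolding digit_sums_Suc_iff by blast
  consider "a = 0" | "k = 0" | "a \<ge> 1" "k \<ge> 1" using a by linarith
  then show ?case
  proof cases
    case 1 then show ?thesis using Suc a by simp
  next
    case 2 then show ?thesis using a by auto
  next
    case 3
    have "\<beta> \<le> \<beta> ^ k" using 3 beta_gt1 by (intro self_le_power) auto
    also have "\<beta> ^ k \<le> of_int a * \<beta> ^ k" using 3 pow_pos[of k] by simp
    also have "\<dots> \<le> y" using Yf_nonneg[OF a(3)] by simp
    finally have "y = of_int m" using Suc.prems m_le by linarith
    then show ?thesis using m_pos by (intro exI[of _ m]) auto
  qed
qed (use m_pos in auto)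

lemma Xf_ge: "x \<in> Xf k \<Longrightarrow> - P k \<le> x" and Xf_le: "x \<in> Xf k \<Longrightarrow> x \<le> Q k"
  using Yf_nonneg[of "x + P k" k] Yf_nonneg[of "Q k + P k - (x + P k)" k]
  unfolding Xf_Yf Yf_sym[of "x + P k"] by auto

lemma Xf_near_bot: "x \<in> Xf k \<Longrightarrow> x \<le> - P k + of_int m \<Longrightarrow> \<exists>i. 0 \<le> i \<and> i \<le> m \<and> x = - P k + of_int i"
  using Yf_small[of "x + P k" k] unfolding Xf_Yf by (auto simp: algebra_simps)

lemma Xf_near_top: "x \<in> Xf k \<Longrightarrow> Q k - of_int m \<le> x \<Longrightarrow> \<exists>i. 0 \<le> i \<and> i \<le> m \<and> x = Q k - of_int i"
  using Yf_small[of "Q k + P k - (x + P k)" k] unfolding Xf_Yf Yf_sym[of "x + P k"]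
  by (auto simp: algebra_simps)

section \<open>Extremal admissible values\<close>

lemma Q_J_iff:
  assumes "k \<ge> 1" "0 \<le> i" "i \<le> m"
  shows "Q k - of_int i \<in> J k \<longleftrightarrow>
    (if even k then dl k + of_int i * (\<beta> + 1) > 0 else dl (Suc k) + of_int i * (\<beta> + 1) \<ge> 0)"
proof -
  have "Q k - of_int i \<ge> 0" using Q_ge_m[OF assms(1)] assms by linarith
  then have "(Q k - of_int i) * (\<beta> + 1) \<ge> 0" using beta_gt1 by simp
  then have "- (\<beta> ^ k) < (Q k - of_int i) * (\<beta> + 1)" "- (\<beta> ^ Suc k) \<le> (Q k - of_int i) * (\<beta> + 1)"
    using pow_pos[of k] pow_pos[of "Suc k"] by linarith+
  then show ?thesis unfolding J_iff using Q_mult[of k] by (auto simp: algebra_simps)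
qed

lemma Q_JO_iff:
  assumes "k \<ge> 1" "0 \<le> i" "i \<le> m"
  shows "Q k - of_int i \<in> JO k \<longleftrightarrow>
    (if even k then dl k + of_int i * (\<beta> + 1) > 0 else dl (Suc k) + of_int i * (\<beta> + 1) > 0)"
proof -
  have "Q k - of_int i \<ge> 0" using Q_ge_m[OF assms(1)] assms by linarith
  then have "(Q k - of_int i) * (\<beta> + 1) \<ge> 0" using beta_gt1 by simp
  then have "- (\<beta> ^ k) < (Q k - of_int i) * (\<beta> + 1)" "- (\<beta> ^ Suc k) < (Q k - of_int i) * (\<beta> + 1)"
    using pow_pos[of k] pow_pos[of "Suc k"] by linarith+
  then show ?thesis unfolding JO_iff using Q_mult[of k] by (auto simp: algebra_simps)
qed

lemma P_J_iff: "- P k \<in> J k \<longleftrightarrow> (if even k then dl k \<ge> 0 else dl (k - 1) > 0)"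
proof -
  have "P k * (\<beta> + 1) \<ge> 0" using P_nonneg[of k] beta_gt1 by simp
  then have "- P k * (\<beta> + 1) < \<beta> ^ k" "- P k * (\<beta> + 1) \<le> \<beta> ^ Suc k"
    using pow_pos[of k] pow_pos[of "Suc k"] by linarith+
  then show ?thesis unfolding J_iff using P_mult[of k] beta_gt1
    by (auto simp: algebra_simps zero_le_mult_iff zero_less_mult_iff)
qed

text \<open>One sequence serves all lengths: its first \<open>k\<close> entries, least power first,
  are meant as the digits of \<open>Q k - i\<close>.\<close>

definition qdig :: "int \<Rightarrow> nat \<Rightarrow> int" where
  "qdig i j = (if j = 0 then m - i else if even j then m else 0)"

lemma qdig_sum: "k \<ge> 1 \<Longrightarrow> (\<Sum>j<k. of_int (qdig i j) * (- \<beta>) ^ j) = Q k - of_int i"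
proof (induction k rule: nat_induct_at_least)
  case (Suc n) then show ?case by (simp add: qdig_def Q_add)
qed (simp add: qdig_def Q_def)

text \<open>The criterion \<open>digit_string\<close> asks for every suffix to be in its tile; as
  \<open>dl\<close> decreases, the condition for the full length implies those for the shorter
  suffixes.\<close>

lemma Q_string:
  assumes "k \<ge> 1" "0 \<le> i" "i \<le> m" "Q k - of_int i \<in> J k"
  shows "Q k - of_int i \<in> Zf k"
    and "j < k \<Longrightarrow> D ((Q k - of_int i) / (- \<beta>) ^ k) j = qdig i (k - 1 - j)"
proof -
  have "(\<Sum>i'<j. of_int (qdig i i') * (- \<beta>) ^ i') \<in> J j" if "j \<le> k" for j
  proof (cases "j = 0")
    case False
    then have j: "j \<ge> 1" by simp
    have c: "if even k then dl k + of_int i * (\<beta> + 1) > 0 else dl (Suc k) + of_int i * (\<beta> + 1) \<ge> 0"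
      using assms(4) Q_J_iff[OF assms(1-3)] by simp
    have "if even j then dl j + of_int i * (\<beta> + 1) > 0 else dl (Suc j) + of_int i * (\<beta> + 1) \<ge> 0"
    proof (cases "even k")
      case True
      have "dl k \<le> dl j" using that dl_le by blast
      moreover have "odd j \<Longrightarrow> dl k \<le> dl (Suc j)" using that True dl_le by (metis Suc_leI le_neq_implies_less)
      ultimately show ?thesis using c True by auto
    next
      case False
      have "dl (Suc k) < dl j" "dl (Suc k) \<le> dl (Suc j)" using that dl_le dl_less by simp_all
      then show ?thesis using c False by auto
    qed
    then show ?thesis using Q_J_iff[OF j assms(2,3)] qdig_sum[OF j] by simp
  qed (use zero_in_U in \<open>simp add: J_def\<close>)
  note * = digit_string[of k "qdig i", OF this] 
  show "Q k - of_int i \<in> Zf k" using *(1) qdig_sum[OF assms(1)] by simp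
  show "j < k \<Longrightarrow> D ((Q k - of_int i) / (- \<beta>) ^ k) j = qdig i (k - 1 - j)"
    using *(2) qdig_sum[OF assms(1)] by simp
qed

lemma P_in_Zf:
  assumes "if even k then dl k \<ge> 0 else dl (k - 1) > 0" shows "- P k \<in> Zf k"
proof -
  have s: "(\<Sum>i<j. of_int (if odd i then m else 0) * (- \<beta>) ^ i) = - P j" for j by (simp add: P_def)
  have "- P j \<in> J j" if "j \<le> k" for j
  proof -
    have "if even j then dl j \<ge> 0 else dl (j - 1) > 0"
    proof (cases "even k")
      case True
      have "dl k \<le> dl j" using that dl_le by blast
      moreover have "odd j \<Longrightarrow> dl k < dl (j - 1)" using that True dl_less
        by (metis One_nat_def Suc_pred less_le_trans lessI odd_pos)
      ultimately show ?thesis using assms True by auto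
    next
      case False
      have "even j \<Longrightarrow> dl (k - 1) \<le> dl j" using that False dl_le
        by (metis One_nat_def Suc_pred le_SucE odd_pos)
      moreover have "dl (k - 1) \<le> dl (j - 1)" using that dl_le by simp
      ultimately show ?thesis using assms False by (auto dest: le_less_trans)
    qed
    then show ?thesis unfolding P_J_iff .
  qed
  then show ?thesis using digit_string(1)[of k "\<lambda>i. if odd i then m else 0"] unfolding s by blast
qed

lemma zmin_eq: "if even k then dl k \<ge> 0 else dl (k - 1) > 0 \<Longrightarrow> zmin k = - P k"
  using P_in_Zf Xf_ge Zf_sub_Xf by (intro zminI) blast+

text \<open>Within distance \<open>m\<close> of the top, the only digit sums are \<open>Q k\<close>
  minus integers. The hypothesis \<open>in_J\<close> keeps the candidate inside the tile, and
  \<open>max\<close> puts the next larger one outside.\<close>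

lemma zmax_eq:
  assumes "k \<ge> 1" "0 \<le> i" "i \<le> m"
    and in_J: "if even k then dl k + of_int i * (\<beta> + 1) > 0 else dl (Suc k) + of_int i * (\<beta> + 1) \<ge> 0"
    and max: "i > 0 \<Longrightarrow> if even k then dl k + of_int (i - 1) * (\<beta> + 1) \<le> 0
                       else dl (Suc k) + of_int (i - 1) * (\<beta> + 1) < 0"
  shows "zmax k = Q k - of_int i"
proof (rule zmaxI)
  have J: "Q k - of_int i \<in> J k" using Q_J_iff[OF assms(1-3)] in_J by simp
  then show "Q k - of_int i \<in> Zf k" using Q_string(1) assms by blast
  fix y assume y: "y \<in> Zf k"
  show "y \<le> Q k - of_int i"
  proof (rule ccontr)
    assume n: "\<not> y \<le> Q k - of_int i"
    moreover have "of_int i \<le> (of_int m :: real)" using assms(3) by simp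
    ultimately have "Q k - of_int m \<le> y" by linarith
    then obtain i' where i': "0 \<le> i'" "i' \<le> m" "y = Q k - of_int i'" using Xf_near_top y Zf_sub_Xf by blast
    then have "i' \<le> i - 1" using n by simp
    then have i: "i > 0" using i' by simp
    have "Q k - of_int i' \<in> J k" using y i' Zf_sub_J by auto
    then have c: "if even k then dl k + of_int i' * (\<beta> + 1) > 0 else dl (Suc k) + of_int i' * (\<beta> + 1) \<ge> 0"
      using Q_J_iff[OF assms(1) i'(1,2)] by simp
    have "of_int i' * (\<beta> + 1) \<le> of_int (i - 1) * (\<beta> + 1)"
      using \<open>i' \<le> i - 1\<close> beta_gt1 by (intro mult_right_mono) (auto simp del: of_int_diff)
    then show False using c max[OF i] by (auto split: if_splits)
  qed
qed

lemma neg_expansion_Q: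
  assumes "k \<ge> 1" "0 \<le> i" "i \<le> m" "Q k - of_int i \<in> JO k"
  shows "neg_expansion \<beta> (Q k - of_int i) (int p) = (if p < k then qdig i p else 0)"
proof -
  have "Q k - of_int i \<in> J k" using assms JO_sub by blast
  then have "p < k \<Longrightarrow> D ((Q k - of_int i) / (- \<beta>) ^ k) (nat (int k - 1 - int p)) = qdig i p"
    using Q_string(2)[OF assms(1-3), of "k - 1 - p"] by (simp add: nat_diff_distrib nat_minus_as_int[symmetric] of_nat_diff)
  then show ?thesis unfolding neg_expansion_eq[OF assms(4)] by auto
qed

text \<open>The two expansions differ in the units digit only.\<close>

lemma gap_letter_Q:
  assumes "k \<ge> 1" "0 \<le> i" "i < m" "Q k - of_int i \<in> JO k"
  shows "gap_letter \<beta> (Q k - of_int (i + 1)) (Q k - of_int i) = 0"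
proof -
  have "Q k - of_int (i + 1) \<in> JO k"
  proof -
    have "of_int (i + 1) * (\<beta> + 1) \<ge> of_int i * (\<beta> + 1)" using beta_gt1 by (intro mult_right_mono) auto
    then show ?thesis using assms Q_JO_iff[of k i] Q_JO_iff[of k "i + 1"] by (auto split: if_splits)
  qed
  then have "{p. neg_expansion \<beta> (Q k - of_int (i + 1)) (int p) \<noteq> neg_expansion \<beta> (Q k - of_int i) (int p)} = {0}"
    using assms neg_expansion_Q[of k i] neg_expansion_Q[of k "i + 1"]
    by (auto simp: qdig_def split: if_splits)
  then show ?thesis unfolding gap_letter_def by (metis Max_singleton)
qed

text \<open>The top point may lie on the boundary of its tile, where \<open>Zf\<close> does not
  decide membership in \<open>neg_integers\<close>; that is why this membership is assumed
  separately. The points below it are interior.\<close>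

lemma Z_near_top:
  assumes "k \<ge> 1" "0 \<le> i" "i \<le> m" "Q k - of_int i \<in> J k" "Q k - of_int i \<in> neg_integers \<beta>"
  shows "neg_integers \<beta> \<inter> {Q k - of_int m..Q k - of_int m + real (nat (m - i))} =
     (\<lambda>t. Q k - of_int m + real t) ` {..<Suc (nat (m - i))}" (is "?A = ?B")
proof
  have e: "Q k - of_int m + real (nat (m - i)) = Q k - of_int i" using assms(3) by simp
  have mJ: "Q k - of_int i' \<in> J k" if "i \<le> i'" "i' \<le> m" for i'
  proof -
    have "of_int i' * (\<beta> + 1) \<ge> of_int i * (\<beta> + 1)" using that beta_gt1 by (intro mult_right_mono) auto
    then show ?thesis using assms that Q_J_iff[of k i] Q_J_iff[of k i'] by (auto split: if_splits)
  qed
  have mZ: "Q k - of_int i' \<in> neg_integers \<beta>" if "i < i'" "i' \<le> m" for i'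
  proof -
    have "Q k - of_int i' \<in> JO k"
    proof -
      have "of_int i' * (\<beta> + 1) > of_int i * (\<beta> + 1)" using that beta_gt1 by (intro mult_strict_right_mono) auto
      then show ?thesis using assms that Q_J_iff[of k i] Q_JO_iff[of k i'] by (auto split: if_splits)
    qed
    then show ?thesis using neg_integers_iff Q_string(1)[of k i'] mJ[of i'] that assms by auto
  qed
  show "?A \<subseteq> ?B"
  proof
    fix x assume x: "x \<in> ?A"
    have "\<exists>i'. i \<le> i' \<and> i' \<le> m \<and> x = Q k - of_int i'"
    proof (cases "x = Q k - of_int i \<or> x = Q k - of_int m")
      case True then show ?thesis using assms by auto
    next
      case False
      then have "Q k - of_int m < x" "x < Q k - of_int i" using x e by auto
      then have "x \<in> JO k" using J_between mJ[of m] mJ[of i] assms(3) by blast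
      then have "x \<in> Xf k" using x neg_integers_iff Zf_sub_Xf by blast
      then obtain i' where "0 \<le> i'" "i' \<le> m" "x = Q k - of_int i'" using Xf_near_top x by auto
      then show ?thesis using \<open>x < Q k - of_int i\<close> by (intro exI[of _ i']) auto
    qed
    then obtain i' where "i \<le> i'" "i' \<le> m" "x = Q k - of_int i'" by blast
    then show "x \<in> ?B" by (intro image_eqI[of _ _ "nat (m - i')"]) auto
  qed
  show "?B \<subseteq> ?A"
  proof
    fix x assume "x \<in> ?B"
    then obtain t where t: "t \<le> nat (m - i)" "x = Q k - of_int m + real t" by auto
    define i' where "i' = m - int t"
    have i': "i \<le> i'" "i' \<le> m" "x = Q k - of_int i'" using t assms(3) by (auto simp: i'_def)
    then have "x \<in> neg_integers \<beta>" using mZ assms(5) by (cases "i = i'") auto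
    moreover have "of_int i \<le> (of_int i' :: real)" "of_int i' \<le> (of_int m :: real)" using i' by auto
    ultimately show "x \<in> ?A" using i' e by auto
  qed
qed

lemma gap_word_top_map:
  assumes "k \<ge> 1" "0 \<le> i" "i \<le> m" "Q k - of_int i \<in> J k" "Q k - of_int i \<in> neg_integers \<beta>"
  shows "gap_word \<beta> (Q k - of_int m) (Q k - of_int i) =
    map (\<lambda>t. gap_letter \<beta> (Q k - of_int (m - int t)) (Q k - of_int (m - int (Suc t)))) [0..<nat (m - i)]"
proof -
  have e: "Q k - of_int m + real (nat (m - i)) = Q k - of_int i" using assms(3) by simp
  have "Q k - of_int m + real t = Q k - of_int (m - int t)" for t by simp
  then show ?thesis using gap_word_arith[OF Z_near_top[OF assms]] unfolding e by (simp only:)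
qed

lemma gap_word_top:
  assumes "k \<ge> 1" "0 \<le> i" "i \<le> m" "Q k - of_int i \<in> JO k"
  shows "gap_word \<beta> (Q k - of_int m) (Q k - of_int i) = replicate (nat (m - i)) 0"
proof -
  have J: "Q k - of_int i \<in> J k" using assms(4) JO_sub by blast
  have Z: "Q k - of_int i \<in> neg_integers \<beta>" using neg_integers_iff[OF assms(4)] Q_string(1)[OF assms(1-3) J] by simp
  have "gap_letter \<beta> (Q k - of_int (m - int t)) (Q k - of_int (m - int (Suc t))) = 0" if "t < nat (m - i)" for t
  proof -
    define i' where "i' = m - int (Suc t)"
    have i': "i \<le> i'" "i' < m" "m - int t = i' + 1" using that by (auto simp: i'_def)
    have "of_int i' * (\<beta> + 1) \<ge> of_int i * (\<beta> + 1)" using i' beta_gt1 by (intro mult_right_mono) auto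
    then have "Q k - of_int i' \<in> JO k" using assms i' Q_JO_iff[of k i] Q_JO_iff[of k i'] by (auto split: if_splits)
    then show ?thesis using gap_letter_Q[of k i'] assms i' unfolding i'(3) i'_def[symmetric] by simp
  qed
  then show ?thesis unfolding gap_word_top_map[OF assms(1-3) J Z]
    by (intro nth_equalityI) auto
qed

section \<open>The set X(-\<beta>) and the polynomial condition\<close>

lemma X_set_iff: "x \<in> X_set \<beta> \<longleftrightarrow> (\<exists>k. x \<in> Xf k)"
proof
  assume "x \<in> X_set \<beta>"
  then obtain N a where "x = (\<Sum>j\<le>N. of_int (a j) * (- \<beta>) ^ j)" "\<forall>j\<le>N. 0 \<le> a j \<and> of_int (a j) \<le> \<beta>"
    unfolding X_set_def by blast
  then have "x \<in> Xf (Suc N)" unfolding digit_sums_eq_sums m_def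
    by (intro exI[of _ a]) (auto simp: le_floor_iff lessThan_Suc_atMost)
  then show "\<exists>k. x \<in> Xf k" ..
next
  assume "\<exists>k. x \<in> Xf k"
  then obtain k where "x \<in> Xf k" ..
  \<comment> \<open>Sums in \<open>X_set\<close> have at least the term for \<open>j = 0\<close>,
    whereas \<open>Xf 0\<close> contains only the empty sum.\<close>
  then have "x \<in> Xf (Suc k)" using digit_sums_mono[of m k "Suc k"] m_pos by auto
  then obtain a where "\<forall>j<Suc k. 0 \<le> a j \<and> a j \<le> m" "x = (\<Sum>j<Suc k. of_int (a j) * (- \<beta>) ^ j)"
    unfolding digit_sums_eq_sums by blast
  then show "x \<in> X_set \<beta>" unfolding X_set_def m_def
    by (auto simp: le_floor_iff lessThan_Suc_atMost less_Suc_eq_le simp del: sum.lessThan_Suc sum.atMost_Suc)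
qed

lemma neg_integers_sub_X: "neg_integers \<beta> \<subseteq> X_set \<beta>"
  using ex_JO neg_integers_iff Zf_sub_Xf unfolding X_set_iff subset_iff by blast

text \<open>Condition (1); the coefficient of the middle powers is forced to be \<open>\<lfloor>\<beta>\<rfloor>\<close>.\<close>

definition confluent :: "nat \<Rightarrow> int \<Rightarrow> bool" where
  "confluent d n \<longleftrightarrow> d \<ge> 1 \<and> 1 \<le> n \<and> n \<le> m \<and> (even d \<longrightarrow> n = m) \<and> dl d = of_int n - of_int m"

lemma dl_alt: "dl d = \<beta> ^ d - (\<Sum>i=1..<d. of_int m * \<beta> ^ i) - of_int m" if "d \<ge> 1"
proof -
  have "(\<Sum>i<d. \<beta> ^ i) = 1 + (\<Sum>i=1..<d. \<beta> ^ i)"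
    using that by (simp add: lessThan_atLeast0 sum.atLeast_Suc_lessThan)
  then show ?thesis by (simp add: dl_def algebra_simps sum_distrib_left)
qed

text \<open>For \<open>d = 1\<close> the middle coefficient m' does not occur. For larger
  \<open>d\<close> it must be the floor of \<beta>: n \<ge> 1 gives m' < \<beta>, and m' \<le>
  \<beta> - 1 would contradict n \<le> m' by the geometric sum.\<close>

lemma confluent_iff:
  "(\<exists>(d::nat) (m::int) (n::int). d \<ge> 1 \<and> m \<ge> n \<and> n \<ge> 1 \<and> (even d \<longrightarrow> n = m) \<and>
      \<beta> ^ d - (\<Sum>i=1..<d. of_int m * \<beta> ^ i) - of_int n = 0) \<longleftrightarrow> (\<exists>d n. confluent d n)" (is "?l \<longleftrightarrow> ?r")
proof
  assume ?l
  then obtain d :: nat and m' n :: int where d: "d \<ge> 1" "m' \<ge> n" "n \<ge> 1" "even d \<longrightarrow> n = m'"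
    and eq: "\<beta> ^ d - (\<Sum>i=1..<d. of_int m' * \<beta> ^ i) - of_int n = 0" by blast
  show ?r
  proof (cases "d = 1")
    case True
    then have "\<beta> = of_int n" using eq by simp
    then have "m = n" unfolding m_def by (metis floor_of_int)
    have "dl 1 = \<beta> - of_int m" by (simp add: dl_Suc)
    then have "dl 1 = of_int n - of_int m" using \<open>\<beta> = of_int n\<close> by linarith
    then have "confluent 1 n" using d(3) \<open>m = n\<close> by (simp add: confluent_def)
    then show ?thesis by blast
  next
    case False
    define S where "S = (\<Sum>i=1..<d. \<beta> ^ i)"
    have eq': "\<beta> ^ d = of_int m' * S + of_int n" using eq by (simp add: S_def sum_distrib_left)
    have "\<beta> ^ (d - 1) \<le> S" unfolding S_def using False d beta_gt1 by (intro member_le_sum) auto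
    then have "of_int m' * \<beta> ^ (d - 1) \<le> of_int m' * S" using d by (intro mult_left_mono) auto
    then have "of_int m' * \<beta> ^ (d - 1) < \<beta> * \<beta> ^ (d - 1)"
      using eq' d(3) power_Suc[of \<beta> "d - 1"] d(1) by simp
    then have lo: "of_int m' < \<beta>" using pow_pos[of "d - 1"] mult_less_cancel_right_pos by blast
    have hi: "\<beta> < of_int m' + 1"
    proof (rule ccontr)
      assume "\<not> \<beta> < of_int m' + 1"
      then have "of_int m' \<le> \<beta> - 1" by simp
      have s: "(\<Sum>i<d. \<beta> ^ i) = 1 + S"
        unfolding S_def using d by (simp add: lessThan_atLeast0 sum.atLeast_Suc_lessThan)
      have "\<beta> ^ d - 1 = (\<beta> - 1) * (1 + S)" using power_diff_1_eq[of \<beta> d] s by simp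
      also have "\<dots> \<ge> of_int m' * (1 + S)"
        using \<open>of_int m' \<le> \<beta> - 1\<close> pow_pos[of "d - 1"] \<open>\<beta> ^ (d - 1) \<le> S\<close> by (intro mult_right_mono) auto
      finally have "of_int m' * S + of_int m' \<le> \<beta> ^ d - 1" by (simp add: algebra_simps)
      moreover have "(of_int n :: real) \<le> of_int m'" using d by simp
      ultimately show False using eq' by linarith
    qed
    have "m = m'" unfolding m_def using lo hi by (intro floor_unique) auto
    then have "dl d = of_int n - of_int m" using dl_alt[OF d(1)] eq by simp
    then have "confluent d n" using d \<open>m = m'\<close> by (simp add: confluent_def)
    then show ?thesis by blast
  qed
next
  assume ?r
  then obtain d n where "confluent d n" by blast
  then show ?l using dl_alt[of d] unfolding confluent_def
    by (intro exI[of _ d] exI[of _ m] exI[of _ n]) auto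
qed

lemma ex_dl_nonpos: "\<exists>k. dl k \<le> 0"
proof (rule ccontr)
  assume "\<not> (\<exists>k. dl k \<le> 0)"
  then have pos: "dl k > 0" for k by (simp add: not_le)
  \<comment> \<open>This is the fixed point of x \<mapsto> \<beta> x - m, the step from
    \<open>dl k\<close> to \<open>dl (Suc k)\<close>. It exceeds \<open>dl 0 = 1\<close>, so the
    expanding step drives the sequence below every bound.\<close>
  define c where "c = of_int m / (\<beta> - 1)"
  have c: "(\<beta> - 1) * c = of_int m" using beta_gt1 by (simp add: c_def)
  have "dl k = c - \<beta> ^ k * (c - 1)" for k
  proof (induction k)
    case (Suc k)
    have "dl (Suc k) = \<beta> * c - of_int m - \<beta> * \<beta> ^ k * (c - 1)" unfolding dl_Suc Suc by (simp add: algebra_simps)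
    also have "\<beta> * c - of_int m = c" using c by (simp add: algebra_simps)
    finally show ?case by simp
  qed simp
  then have "\<beta> ^ k * (c - 1) \<le> c" for k using pos[of k] by simp
  then have "c - 1 \<le> 0" by (rule eventually_power_gt[OF beta_gt1])
  moreover have "c > 1" using m_gt beta_gt1 by (simp add: c_def)
  ultimately show False by simp
qed

lemma ex_last_pos: "\<exists>t. dl t > 0 \<and> dl (Suc t) \<le> 0"
proof -
  obtain k where "dl k \<le> 0" "\<forall>i<k. \<not> dl i \<le> 0" using ex_dl_nonpos exists_least_iff[of "\<lambda>k. dl k \<le> 0"] by blast
  then show ?thesis
    by (cases k) (auto simp: not_le intro!: exI[of _ "k - 1"])
qed

lemma confluent_if_zero: "dl (Suc t) = 0 \<Longrightarrow> confluent (Suc t) m"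
  using m_pos by (simp add: confluent_def)

lemma Q_in_Xf: "k \<ge> 1 \<Longrightarrow> 0 \<le> i \<Longrightarrow> i \<le> m \<Longrightarrow> Q k - of_int i \<in> Xf k"
  unfolding digit_sums_eq_sums using qdig_sum[of k i] m_pos
  by (intro exI[of _ "qdig i"]) (auto simp: qdig_def)

text \<open>
  Let \<open>\<delta>_(t+1) < 0 < \<delta>_t\<close>. If \<open>t\<close> is odd, the largest element \<open>Q t - \<beta>^t\<close> of a neighbouring translate of the digit
  sums of length \<open>t\<close> is in \<open>J t\<close>, but lies below all these digit sums. If \<open>t\<close> is even, a point of \<open>X(-\<beta>)\<close> falls strictly between
  two consecutive integers shifted by \<open>- P (t + 1)\<close>, unless \<open>\<delta>_(t+1)\<close> is an integer.
\<close>

lemma X_eq_imp_confluent: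
  assumes "neg_integers \<beta> = X_set \<beta>" shows "\<exists>d n. confluent d n"
proof -
  obtain t where t: "dl t > 0" "dl (Suc t) \<le> 0" using ex_last_pos by blast
  have XZ: "x \<in> Xf t'" if "x \<in> Xf k" "x \<in> JO t'" for x k t'
    using that assms X_set_iff neg_integers_iff Zf_sub_Xf by blast
  show ?thesis
  proof (cases "dl (Suc t) = 0")
    case True then show ?thesis using confluent_if_zero by blast
  next
    case False
    then have neg: "dl (Suc t) < 0" using t by simp
    have t1: "t \<ge> 1"
    proof (rule ccontr)
      assume "\<not> t \<ge> 1"
      then have "t = 0" by simp
      then show False using neg m_le by (simp add: dl_Suc)
    qed
    have bd: "\<beta> * dl t = dl (Suc t) + of_int m" by (simp add: dl_Suc)
    have bdpos: "\<beta> * dl t > 0" using t beta_gt1 by simp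
    show ?thesis
    proof (cases "even (Suc t)")
      case True
      define p where "p = Q t - \<beta> ^ t"
      have p: "p = - P t - dl t" using QP_sum[of t] by (simp add: p_def)
      have "p \<in> Xf (Suc t)" unfolding digit_sums_Suc_iff
        using Q_in_Xf[OF t1, of 0] m_pos True by (intro exI[of _ 1]) (auto simp: p_def)
      moreover have "p \<in> JO t"
      proof -
        have dt: "dl t = \<beta> * dl (t - 1) - of_int m" using dl_Suc[of "t - 1"] t1 by simp
        have "p * (\<beta> + 1) = - (\<beta> ^ t) + \<beta> * dl (t - 1) - (\<beta> * dl t + dl t)"
          using P_mult[of t] True unfolding p by (simp add: algebra_simps)
        also have "\<dots> = - (\<beta> ^ t) - dl (Suc t)" using dt bd by simp
        finally have "p * (\<beta> + 1) > - (\<beta> ^ t)" using neg by simp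
        moreover have "p * (\<beta> + 1) < 0" using p P_nonneg[of t] t beta_gt1 by (simp add: mult_neg_pos)
        ultimately show ?thesis using True pow_pos[of "Suc t"] unfolding JO_iff by auto
      qed
      ultimately have "p \<in> Xf t" by (rule XZ)
      then show ?thesis using Xf_ge p t(1) by fastforce
    next
      case odd: False
      define n where "n = \<lfloor>\<beta> * dl t\<rfloor>"
      define f where "f = \<beta> * dl t - of_int n"
      have f: "0 \<le> f" "f < 1" unfolding f_def n_def by linarith+
      have dT: "dl (Suc t) = of_int n + f - of_int m" using bd by (simp add: f_def)
      have "n < m"
      proof -
        have "(of_int n :: real) < of_int m" using dT f neg by linarith
        then show ?thesis by simp
      qed
      have "n \<ge> 0" unfolding n_def using bdpos by simp
      show ?thesis
      proof (cases "f = 0")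
        case True
        then have "(of_int n :: real) > 0" using bdpos by (simp add: f_def)
        then have "confluent (Suc t) n" unfolding confluent_def using odd dT True \<open>n < m\<close> by auto
        then show ?thesis by blast
      next
        case False
        \<comment> \<open>The top of a neighbouring translate is lowered by \<open>m - n - 1\<close>
          units, so that it comes to lie \<open>1 - f\<close> above the least digit sum, and
          \<open>0 < 1 - f < 1\<close>.\<close>
        define x where "x = - P (Suc t) + 1 - f"
        have x: "x = Q (Suc t) - of_int (m - n - 1) - \<beta> ^ Suc t"
          using QP_sum[of "Suc t"] dT by (simp add: x_def)
        have "x \<in> Xf (Suc (Suc t))" unfolding digit_sums_Suc_iff[of _ _ _ "Suc t"]
          using Q_in_Xf[of "Suc t" "m - n - 1"] m_pos odd \<open>n < m\<close> \<open>n \<ge> 0\<close>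
          by (intro exI[of _ 1]) (auto simp: x)
        moreover have "x \<in> JO (Suc t)"
        proof (rule J_between)
          show "- P (Suc t) \<in> J (Suc t)" unfolding P_J_iff using t odd by simp
          show "0 \<in> J (Suc t)" using zero_in_Zf Zf_sub_J by blast
          show "- P (Suc t) < x" using f by (simp add: x_def)
          have "1 \<le> Q t" using Q_ge_m[OF t1] m_ge1_real by linarith
          then have "1 * 1 \<le> \<beta> * Q t" using beta_gt1 by (intro mult_mono) auto
          then show "x < 0" using False f by (simp add: x_def P_Suc)
        qed
        ultimately have "x \<in> Xf (Suc t)" by (rule XZ)
        moreover have "x \<le> - P (Suc t) + of_int m" using f m_ge1_real by (simp add: x_def)
        ultimately obtain i where "x = - P (Suc t) + of_int i" using Xf_near_bot by blast
        then have "1 - f = of_int i" by (simp add: x_def)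
        moreover have "0 < 1 - f" "1 - f < 1" using f False by auto
        ultimately show ?thesis by simp
      qed
    qed
  qed
qed

end

section \<open>Bases satisfying the first condition\<close>

locale confluent_base = neg_base +
  fixes d :: nat and n :: int
  assumes conf: "confluent d n"
begin

lemma d_pos: "d \<ge> 1" and n_ge1: "n \<ge> 1" and n_le_m: "n \<le> m" and n_eq_m: "even d \<Longrightarrow> n = m"
  and dl_d: "dl d = of_int n - of_int m"
  using conf by (auto simp: confluent_def)

lemma dl_d_pred: "\<beta> * dl (d - 1) = of_int n"
  using dl_Suc[of "d - 1"] d_pos dl_d by simp

lemma dl_pos_iff: "dl k > 0 \<longleftrightarrow> k < d"
proof
  assume "dl k > 0"
  then show "k < d" using dl_le[of d k] dl_d n_le_m by (metis diff_le_0_iff_le leI linorder_not_less of_int_le_iff order_trans)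
next
  assume "k < d"
  have "\<beta> * dl (d - 1) > 0" using dl_d_pred n_ge1 by simp
  then have "dl (d - 1) > 0" using beta_gt1 by (simp add: zero_less_mult_iff)
  moreover have "k \<le> d - 1" using \<open>k < d\<close> by simp
  ultimately show "dl k > 0" using dl_le[of k "d - 1"] by linarith
qed

lemma Yf_le: "y \<in> Yf k \<Longrightarrow> y \<le> Q k + P k"
  using Yf_nonneg[of "Q k + P k - y" k] unfolding Yf_sym[of y] by simp

text \<open>While the leading digit is below \<open>c\<close>, the remainder is at least \<beta>^j,
  and one \<beta>^j can be moved from the remainder to the digit. The assumption \<open>C\<close>
  will be the induction hypothesis of \<open>Yf_sub_pow\<close>.\<close>

lemma Yf_raise_digit:
  assumes C: "\<And>y. y \<in> Yf j \<Longrightarrow> y \<ge> \<beta> ^ j \<Longrightarrow> y - \<beta> ^ j \<in> Yf j"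
    and "y \<in> Yf (Suc j)" "c \<le> m" "y \<ge> of_int c * \<beta> ^ j"
  shows "\<exists>a\<ge>c. 0 \<le> a \<and> a \<le> m \<and> y - of_int a * \<beta> ^ j \<in> Yf j"
proof -
  obtain a where "0 \<le> a" "a \<le> m" "y - of_int a * \<beta> ^ j \<in> Yf j"
    using assms(2) unfolding digit_sums_Suc_iff by blast
  then show ?thesis
  proof (induction "nat (c - a)" arbitrary: a rule: less_induct)
    case less
    show ?case
    proof (cases "c \<le> a")
      case True then show ?thesis using less by blast
    next
      case False
      then have "of_int (a + 1) * \<beta> ^ j \<le> of_int c * \<beta> ^ j"
        using pow_pos[of j] by (intro mult_right_mono) auto
      then have "\<beta> ^ j \<le> y - of_int a * \<beta> ^ j" using assms(4) by (simp add: algebra_simps)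
      then have "y - of_int a * \<beta> ^ j - \<beta> ^ j \<in> Yf j" using C less by blast
      then have "y - of_int (a + 1) * \<beta> ^ j \<in> Yf j" by (simp add: algebra_simps)
      then show ?thesis using less(1)[of "a + 1"] less(2,3) False assms(3) by auto
    qed
  qed
qed

text \<open>
  \<open>\<beta>^k = m \<beta>^(k-1) + \<dots> + m \<beta>^(k-d+1) + n \<beta>^(k-d)\<close>; the leading digits of \<open>y \<ge> \<beta>^k\<close> can be raised, one after
  the other, until this string can be subtracted digit by digit.
\<close>

lemma Yf_sub_pow: "y \<in> Yf k \<Longrightarrow> y \<ge> \<beta> ^ k \<Longrightarrow> y - \<beta> ^ k \<in> Yf k"
proof (induction k arbitrary: y rule: less_induct)
  case (less k)
  have raise: "\<exists>a\<ge>c. 0 \<le> a \<and> a \<le> m \<and> z - of_int a * \<beta> ^ j \<in> Yf j"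
    if "j < k" "z \<in> Yf (Suc j)" "c \<le> m" "z \<ge> of_int c * \<beta> ^ j" for z j c
    using Yf_raise_digit[OF less.IH[OF that(1)]] that by blast
  \<comment> \<open>Below \<open>d\<close> the largest digit sum, \<beta>^k - dl k, is less than
    \<beta>^k.\<close>
  have "d \<le> k"
  proof (rule ccontr)
    assume "\<not> d \<le> k"
    then have "dl k > 0" using dl_pos_iff by simp
    then show False using Yf_le[OF less.prems(1)] QP_sum[of k] less.prems(2) by linarith
  qed
  \<comment> \<open>After \<open>m\<close> has been subtracted at the \<open>i\<close> leading
    powers, the part of \<beta>^k still to be subtracted is \<beta>^(k-i) dl i.\<close>
  have step: "y - \<beta> ^ k + \<beta> ^ (k - i) * dl i \<in> Yf (k - i)" if "i < d" for i
    using that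
  proof (induction i)
    case (Suc i)
    define j where "j = k - Suc i"
    have j: "k - i = Suc j" "j < k" using Suc.prems \<open>d \<le> k\<close> by (auto simp: j_def)
    define z where "z = y - \<beta> ^ k + \<beta> ^ Suc j * dl i"
    have z: "z \<in> Yf (Suc j)" using Suc unfolding z_def j(1) by simp
    have e: "\<beta> ^ Suc j * dl i = \<beta> ^ j * dl (Suc i) + of_int m * \<beta> ^ j" by (simp add: dl_Suc algebra_simps)
    have "\<beta> ^ j * dl (Suc i) \<ge> 0" using dl_pos_iff[of "Suc i"] Suc.prems pow_pos[of j] by simp
    then have "z \<ge> of_int m * \<beta> ^ j" using less.prems(2) e by (simp add: z_def)
    then obtain a where "a \<ge> m" "a \<le> m" "z - of_int a * \<beta> ^ j \<in> Yf j" using raise[OF j(2) z] by blast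
    then have "z - of_int m * \<beta> ^ j \<in> Yf j" by simp
    moreover have "z - of_int m * \<beta> ^ j = y - \<beta> ^ k + \<beta> ^ j * dl (Suc i)" using e by (simp add: z_def)
    ultimately show ?case unfolding j_def by simp
  qed (use less.prems in simp)
  define j where "j = k - d"
  have j: "k - (d - 1) = Suc j" "j < k" using d_pos \<open>d \<le> k\<close> by (auto simp: j_def)
  define z where "z = y - \<beta> ^ k + \<beta> ^ Suc j * dl (d - 1)"
  have z: "z \<in> Yf (Suc j)" using step[of "d - 1"] d_pos unfolding z_def j(1) by simp
  have e: "\<beta> ^ Suc j * dl (d - 1) = of_int n * \<beta> ^ j" using dl_d_pred by simp
  then have "z \<ge> of_int n * \<beta> ^ j" using less.prems(2) unfolding z_def e by simp
  then obtain a where a: "a \<ge> n" "a \<le> m" "z - of_int a * \<beta> ^ j \<in> Yf j" using raise[OF j(2) z n_le_m] by blast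
  have "y - \<beta> ^ k - of_int (a - n) * \<beta> ^ j = z - of_int a * \<beta> ^ j"
    unfolding z_def e by (simp add: algebra_simps)
  then have "y - \<beta> ^ k \<in> Yf (Suc j)" unfolding digit_sums_Suc_iff
    using a n_ge1 by (intro exI[of _ "a - n"]) simp
  then show "y - \<beta> ^ k \<in> Yf k" using digit_sums_mono[of m "Suc j" k] j(2) m_pos by auto
qed

lemma Yf_sub_mult: "y \<in> Yf k \<Longrightarrow> y \<ge> real c * \<beta> ^ k \<Longrightarrow> y - real c * \<beta> ^ k \<in> Yf k"
proof (induction c arbitrary: y)
  case (Suc c)
  have "real c * \<beta> ^ k \<ge> 0" using pow_pos[of k] by simp
  then have "y - \<beta> ^ k \<in> Yf k" using Suc.prems by (intro Yf_sub_pow) (auto simp: algebra_simps)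
  then have "y - \<beta> ^ k - real c * \<beta> ^ k \<in> Yf k" using Suc.prems by (intro Suc.IH) (auto simp: algebra_simps)
  then show ?case by (simp add: algebra_simps)
qed simp

text \<open>Some leading digit \<open>b\<close> is possible for \<open>v\<close>, perhaps not
  \<open>a\<close>. If b \<le> a, multiples of \<beta>^k are subtracted from the remainder;
  otherwise they are subtracted from its complement under \<open>Yf_sym\<close>.\<close>

lemma Yf_window:
  assumes "v \<in> Yf (Suc k)" "0 \<le> v - of_int a * \<beta> ^ k" "v - of_int a * \<beta> ^ k \<le> Q k + P k"
  shows "v - of_int a * \<beta> ^ k \<in> Yf k"
proof -
  define x where "x = v - of_int a * \<beta> ^ k"
  obtain b where b: "v - of_int b * \<beta> ^ k \<in> Yf k" using assms(1) unfolding digit_sums_Suc_iff by blast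
  define y where "y = v - of_int b * \<beta> ^ k"
  show ?thesis
  proof (cases "b \<le> a")
    case True
    then have "real (nat (a - b)) = of_int a - of_int b" by simp
    then have e: "x = y - real (nat (a - b)) * \<beta> ^ k" by (simp add: x_def y_def algebra_simps)
    have "x \<ge> 0" using assms(2) by (simp add: x_def)
    then have "real (nat (a - b)) * \<beta> ^ k \<le> y" using e by linarith
    then have "x \<in> Yf k" unfolding e using b by (intro Yf_sub_mult) (auto simp: y_def)
    then show ?thesis by (simp add: x_def)
  next
    case False
    define c where "c = real (nat (b - a))"
    have c: "c = of_int b - of_int a" using False by (simp add: c_def)
    have xy: "x = y + c * \<beta> ^ k" unfolding c by (simp add: x_def y_def algebra_simps)
    have y': "Q k + P k - y \<in> Yf k" using b Yf_sym by (simp add: y_def)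
    have "Q k + P k - y \<ge> c * \<beta> ^ k" using assms(3) xy by (simp add: x_def)
    then have "Q k + P k - y - c * \<beta> ^ k \<in> Yf k" unfolding c_def by (rule Yf_sub_mult[OF y'])
    then have "Q k + P k - x \<in> Yf k" using xy by (simp add: algebra_simps)
    then show ?thesis using Yf_sym x_def by simp
  qed
qed

lemma Xf_window:
  assumes "x \<in> Xf (Suc k)" "- P k \<le> x - of_int a * (- \<beta>) ^ k" "x - of_int a * (- \<beta>) ^ k \<le> Q k"
  shows "x - of_int a * (- \<beta>) ^ k \<in> Xf k"
proof -
  define a' where "a' = (if even k then a else m - a)"
  have e: "x + P (Suc k) - of_int a' * \<beta> ^ k = x - of_int a * (- \<beta>) ^ k + P k"
    by (auto simp: a'_def P_add algebra_simps)
  have "x + P (Suc k) \<in> Yf (Suc k)" using assms(1) Xf_Yf by blast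
  then have "x + P (Suc k) - of_int a' * \<beta> ^ k \<in> Yf k"
    by (rule Yf_window) (use assms(2,3) in \<open>auto simp: e\<close>)
  then show ?thesis unfolding Xf_Yf e .
qed

text \<open>
  Where the tile exceeds the range \<open>{- P k..Q k}\<close>, the neighbouring translates of the range do not reach into
  the tile, by the sign of \<open>\<delta>_k\<close> or \<open>\<delta>_(k+1)\<close>; only for odd \<open>k = d\<close> they may, by less than one unit.
\<close>

lemma Xf_tile:
  assumes "x \<in> Xf (Suc k)" "x - of_int a * (- \<beta>) ^ k \<in> J k"
  shows "x - of_int a * (- \<beta>) ^ k \<in> Xf k"
proof (rule ccontr)
  define x' where "x' = x - of_int a * (- \<beta>) ^ k"
  assume n: "x - of_int a * (- \<beta>) ^ k \<notin> Xf k"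
  then have out: "x' > Q k \<or> x' < - P k" using Xf_window[OF assms(1), of a] by (force simp: x'_def)
  obtain b where b: "x - of_int b * (- \<beta>) ^ k \<in> Xf k" using assms(1) unfolding digit_sums_Suc_iff by blast
  define y where "y = x - of_int b * (- \<beta>) ^ k"
  define c where "c = (if even k then b - a else a - b)"
  have x'y: "x' = of_int c * \<beta> ^ k + y" by (auto simp: x'_def y_def c_def algebra_simps)
  have y: "- P k \<le> y" "y \<le> Q k" "y \<in> Xf k" using Xf_ge Xf_le b by (auto simp: y_def)
  have J: "x' \<in> J k" using assms(2) by (simp add: x'_def)
  have Jb: "if even k then - (\<beta> ^ Suc k) \<le> x' * (\<beta> + 1) \<and> x' * (\<beta> + 1) < \<beta> ^ k
    else - (\<beta> ^ k) < x' * (\<beta> + 1) \<and> x' * (\<beta> + 1) \<le> \<beta> ^ Suc k" using J unfolding J_iff .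
  consider "x' > Q k" | "x' < - P k" using out by blast
  then show False
  proof cases
    case 1
    then have "of_int c * \<beta> ^ k > 0" using x'y y by linarith
    then have "(0::real) < of_int c" using pow_pos[of k] zero_less_mult_pos2 by blast
    then have "c \<ge> 1" by simp
    then have "1 * \<beta> ^ k \<le> of_int c * \<beta> ^ k" using pow_pos[of k] by (intro mult_right_mono) auto
    then have "x' \<ge> \<beta> ^ k - P k" using x'y y by linarith
    then have "x' * (\<beta> + 1) \<ge> (\<beta> ^ k - P k) * (\<beta> + 1)" using beta_gt1 by (intro mult_right_mono) auto
    then have lo: "x' * (\<beta> + 1) \<ge> \<beta> ^ Suc k + \<beta> ^ k - P k * (\<beta> + 1)" by (simp add: algebra_simps)
    have "Q k * (\<beta> + 1) < x' * (\<beta> + 1)" using 1 beta_gt1 by simp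
    then show False
    proof (cases "even k")
      case True
      then have "dl k > 0" using Jb Q_mult[of k] \<open>Q k * (\<beta> + 1) < x' * (\<beta> + 1)\<close> by simp
      then have "\<beta> * dl k > 0" using beta_gt1 by simp
      then show False using lo Jb P_mult[of k] True by simp
    next
      case False
      then have "dl (Suc k) > 0" using Jb Q_mult[of k] \<open>Q k * (\<beta> + 1) < x' * (\<beta> + 1)\<close> by simp
      moreover have "dl (Suc k) < dl (k - 1)" by (rule dl_less) simp
      ultimately have "dl (k - 1) > 0" by linarith
      then have "\<beta> * dl (k - 1) > 0" using beta_gt1 by simp
      then show False using lo Jb P_mult[of k] False by simp
    qed
  next
    case 2
    then have "of_int c * \<beta> ^ k < 0" using x'y y by linarith
    then have "of_int c < (0::real)" using pow_pos[of k] by (metis mult_less_0_iff order_less_asym)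
    then have c: "c \<le> - 1" by simp
    then have "of_int c * \<beta> ^ k \<le> - 1 * \<beta> ^ k" using pow_pos[of k] by (intro mult_right_mono) auto
    then have "x' \<le> Q k - \<beta> ^ k" using x'y y by linarith
    then have "x' * (\<beta> + 1) \<le> (Q k - \<beta> ^ k) * (\<beta> + 1)" using beta_gt1 by (intro mult_right_mono) auto
    then have hi: "x' * (\<beta> + 1) \<le> Q k * (\<beta> + 1) - \<beta> ^ Suc k - \<beta> ^ k" by (simp add: algebra_simps)
    have "P k * (\<beta> + 1) < - x' * (\<beta> + 1)" using 2 by (intro mult_strict_right_mono beta_plus1) simp
    then have Pl: "P k * (\<beta> + 1) < - (x' * (\<beta> + 1))" by simp
    show False
    proof (cases "even k")
      case True
      then have "\<beta> * dl k > 0" using Jb P_mult[of k] Pl by simp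
      then have "dl k > 0" using beta_gt1 by (simp add: zero_less_mult_iff)
      then show False using hi Jb Q_mult[of k] True by simp
    next
      case False
      then have "\<beta> * dl (k - 1) > 0" using Jb P_mult[of k] Pl by simp
      then have k1: "dl (k - 1) > 0" using beta_gt1 by (simp add: zero_less_mult_iff)
      have "dl (Suc k) < 0" using hi Jb Q_mult[of k] False by force
      then have "\<not> Suc k < d" using dl_pos_iff[of "Suc k"] by force
      moreover have "k - 1 < d" using k1 dl_pos_iff by blast
      moreover have "Suc k \<noteq> d" using \<open>dl (Suc k) < 0\<close> dl_d n_eq_m False by auto
      \<comment> \<open>The signs leave only the odd level \<open>k = d\<close>, where the tile
        reaches less than one unit below \<open>- P k\<close>.\<close>
      ultimately have kd: "k = d" using False by (cases k) auto
      have "P k * (\<beta> + 1) = \<beta> ^ k - of_int n" using P_mult[of k] False dl_d_pred kd by simp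
      then have "(- P k - 1) * (\<beta> + 1) < - (\<beta> ^ k)" using n_le_m m_le by (simp add: algebra_simps)
      then have "(- P k - 1) * (\<beta> + 1) < x' * (\<beta> + 1)" using Jb False by simp
      then have x'P: "x' > - P k - 1" using beta_gt1 mult_less_cancel_right_pos[OF beta_plus1] by blast
      have yx: "y = x' + of_int (- c) * \<beta> ^ k" using x'y by simp
      have qp: "\<beta> ^ k = Q k + P k + of_int n - of_int m" using QP_sum[of k] dl_d kd by simp
      have nm: "(1 :: real) \<le> of_int n" using n_ge1 by simp
      have "c = - 1"
      proof (rule ccontr)
        assume "c \<noteq> - 1"
        then have "- c \<ge> 2" using c by simp
        then have "2 * \<beta> ^ k \<le> of_int (- c) * \<beta> ^ k" using pow_pos[of k] by (intro mult_right_mono) auto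
        then have "y > - P k - 1 + 2 * \<beta> ^ k" using x'P yx by linarith
        moreover have "\<beta> \<le> \<beta> ^ k" using kd d_pos beta_gt1 by (intro self_le_power) auto
        ultimately show False using qp y(2) m_le nm by linarith
      qed
      then have x'2: "x' = y - \<beta> ^ k" using x'y by simp
      \<comment> \<open>Near the top all digit sums differ from \<open>Q k\<close> by integers;
        hence \<open>x' + P k\<close> would be an integer strictly between -1 and 0.\<close>
      then have "Q k - of_int m \<le> y" using x'P qp nm by linarith
      then obtain i where "y = Q k - of_int i" using Xf_near_top y(3) by blast
      then have "x' + P k = of_int (m - n - i)" using x'2 qp by simp
      moreover have "- 1 < x' + P k" "x' + P k < 0" using x'P 2 by auto
      ultimately have "- 1 < m - n - i" "m - n - i < 0" by linarith+
      then show False by simp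
    qed
  qed
qed

text \<open>The leading digit is prescribed by \<open>T\<close> and need not be the one in the given
  sum; by \<open>Xf_tile\<close> the remainder is a digit sum nevertheless, so the induction goes
  on.\<close>

lemma Xf_J_Zf: "x \<in> Xf k \<Longrightarrow> x \<in> J k \<Longrightarrow> x \<in> Zf k"
proof (induction k arbitrary: x)
  case (Suc k)
  define u where "u = x / (- \<beta>) ^ Suc k"
  have u: "u \<in> U" using Suc.prems by (simp add: J_def u_def)
  define a where "a = D u 0"
  have "T u = (x - of_int a * (- \<beta>) ^ k) / (- \<beta>) ^ k"
    using beta_gt1 by (simp add: T_digit a_def u_def field_simps)
  then have J: "x - of_int a * (- \<beta>) ^ k \<in> J k" using T_mem[of u] by (simp add: J_def)
  then have "x - of_int a * (- \<beta>) ^ k \<in> Zf k" using Xf_tile Suc by blast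
  then show ?case unfolding Zf_Suc using Suc.prems digit_bounds[OF u] by (auto simp: a_def m_def)
qed (simp add: Zf_0)

lemma Z_eq_X: "neg_integers \<beta> = X_set \<beta>"
proof
  show "X_set \<beta> \<subseteq> neg_integers \<beta>"
  proof
    fix x assume "x \<in> X_set \<beta>"
    then obtain k where k: "x \<in> Xf k" using X_set_iff by blast
    obtain k' where "x \<in> JO k'" using ex_JO by blast
    then have "x \<in> JO (max k k')" using JO_mono by simp
    moreover have "x \<in> Xf (max k k')" using k digit_sums_mono[of m k "max k k'"] m_pos by auto
    ultimately show "x \<in> neg_integers \<beta>" using Xf_J_Zf JO_sub neg_integers_iff by blast
  qed
qed (rule neg_integers_sub_X)

text \<open>Let \<open>a\<close> be the last leading digit whose translate has \<open>x\<close> in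
  its range. If \<open>y\<close> is in this range too, both belong to that translate by
  \<open>Yf_window\<close>, and induction applies. Otherwise \<open>x\<close> is the top of the
  translate and \<open>y\<close> the bottom of the next one, and the gap is \<beta>^k - (Q k + P k)
  = dl k.\<close>

lemma Yf_gap:
  assumes "x \<in> Yf k" "y \<in> Yf k" "x < y" "\<And>z. z \<in> Yf k \<Longrightarrow> x < z \<Longrightarrow> z < y \<Longrightarrow> False"
  shows "\<exists>i<d. y - x = dl i"
  using assms
proof (induction k arbitrary: x y)
  case (Suc k)
  define M where "M = Q k + P k"
  have M: "M \<in> Yf k" "0 \<in> Yf k"
  proof -
    show "0 \<in> Yf k" using digit_sums_mono[of m 0 k] m_pos by auto
    then show "M \<in> Yf k" using Yf_sym[of 0 k] by (simp add: M_def)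
  qed
  have up: "z + of_int a * \<beta> ^ k \<in> Yf (Suc k)" if "z \<in> Yf k" "0 \<le> a" "a \<le> m" for z a
    unfolding digit_sums_Suc_iff using that by (intro exI[of _ a] conjI) simp_all
  define A where "A = {a \<in> {0..m}. of_int a * \<beta> ^ k \<le> x \<and> x \<le> of_int a * \<beta> ^ k + M}"
  have digit: "\<exists>b. 0 \<le> b \<and> b \<le> m \<and> of_int b * \<beta> ^ k \<le> v \<and> v \<le> of_int b * \<beta> ^ k + M" if v: "v \<in> Yf (Suc k)" for v
  proof -
    obtain b where b: "0 \<le> b" "b \<le> m" "v - of_int b * \<beta> ^ k \<in> Yf k"
      using v unfolding digit_sums_Suc_iff by blast
    have "0 \<le> v - of_int b * \<beta> ^ k" "v - of_int b * \<beta> ^ k \<le> M"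
      using Yf_nonneg[OF b(3)] Yf_le[OF b(3)] by (simp_all add: M_def)
    then show ?thesis using b(1,2) by (intro exI[of _ b]) simp
  qed
  have A: "finite A" "A \<noteq> {}"
  proof -
    show "finite A" by (rule finite_subset[of _ "{0..m}"]) (auto simp: A_def)
    show "A \<noteq> {}" using digit[OF Suc.prems(1)] by (auto simp: A_def)
  qed
  define a where "a = Max A"
  have a: "0 \<le> a" "a \<le> m" "of_int a * \<beta> ^ k \<le> x" "x \<le> of_int a * \<beta> ^ k + M"
    using Max_in[OF A] by (auto simp: a_def A_def)
  show ?case
  proof (cases "y \<le> of_int a * \<beta> ^ k + M")
    case True
    have "x - of_int a * \<beta> ^ k \<in> Yf k" "y - of_int a * \<beta> ^ k \<in> Yf k"
      by (rule Yf_window; use Suc.prems a True in \<open>simp add: M_def\<close>)+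
    then have "\<exists>i<d. (y - of_int a * \<beta> ^ k) - (x - of_int a * \<beta> ^ k) = dl i"
    proof (rule Suc.IH)
      fix z assume "z \<in> Yf k" "x - of_int a * \<beta> ^ k < z" "z < y - of_int a * \<beta> ^ k"
      then show False using Suc.prems(4)[of "z + of_int a * \<beta> ^ k"] up a by auto
    qed (use Suc.prems in simp)
    then show ?thesis by simp
  next
    case False
    have xe: "x = of_int a * \<beta> ^ k + M"
      using Suc.prems(4)[OF up[OF M(1) a(1,2)]] a(4) False by argo
    obtain b where b: "0 \<le> b" "b \<le> m" "of_int b * \<beta> ^ k \<le> y" "y \<le> of_int b * \<beta> ^ k + M"
      using digit Suc.prems(2) by blast
    have "of_int a * \<beta> ^ k < of_int b * \<beta> ^ k" using b(4) False by linarith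
    then have ab: "a < b" using pow_pos[of k] by simp
    have m1: "of_int (a + 1) * \<beta> ^ k \<in> Yf (Suc k)" using up[OF M(2), of "a + 1"] a ab b by simp
    have "x < of_int (a + 1) * \<beta> ^ k"
    proof (rule ccontr)
      assume "\<not> x < of_int (a + 1) * \<beta> ^ k"
      then have "a + 1 \<in> A" using a ab b pow_pos[of k] by (auto simp: A_def algebra_simps)
      then have "a + 1 \<le> a" unfolding a_def by (rule Max_ge[OF A(1)])
      then show False by simp
    qed
    moreover have "of_int (a + 1) * \<beta> ^ k \<le> y"
    proof -
      have "of_int (a + 1) * \<beta> ^ k \<le> of_int b * \<beta> ^ k" using ab pow_pos[of k] by (intro mult_right_mono) auto
      then show ?thesis using b(3) by simp
    qed
    ultimately have "y = of_int (a + 1) * \<beta> ^ k" using Suc.prems(4)[OF m1] by (metis order_le_less)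
    then have "y - x = dl k" using xe QP_sum[of k] by (simp add: M_def algebra_simps)
    then show ?thesis using Suc.prems(3) dl_pos_iff[of k] by auto
  qed
qed simp

end

context neg_base begin

section \<open>The expansion of unity and the antimorphism\<close>

text \<open>The orbit \<open>T_\<beta>^i(1)\<close>, with \<open>T_\<beta>\<close> applied also to 1, which is outside its domain \<open>[0, 1)\<close>.\<close>

primrec rem :: "nat \<Rightarrow> real" where
  "rem 0 = 1"
| "rem (Suc i) = \<beta> * rem i - of_int \<lfloor>\<beta> * rem i\<rfloor>"

abbreviation "r \<equiv> renyi_unity \<beta>"

lemma renyi_unity_eq: "r i = \<lfloor>\<beta> * rem i\<rfloor>"
proof -
  have "(pos_T \<beta> ^^ j) (\<beta> - of_int \<lfloor>\<beta>\<rfloor>) = rem (Suc j)" for j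
    by (induction j) (simp_all add: pos_T_def)
  then show ?thesis by (cases i) (simp_all add: renyi_unity_def pos_digits_def)
qed

lemma rem_Suc: "rem (Suc i) = \<beta> * rem i - of_int (r i)"
  by (simp add: renyi_unity_eq)

lemma rem_nonneg: "rem i \<ge> 0" and rem_less1: "rem (Suc i) < 1"
proof -
  have "0 \<le> rem (Suc i) \<and> rem (Suc i) < 1" for i by simp linarith
  then show "rem i \<ge> 0" "rem (Suc i) < 1" by (cases i; simp del: rem.simps(2) add: rem.simps(1))+
qed

lemma rem_dl: "dl i \<ge> 0 \<Longrightarrow> rem i = dl i"
proof (induction i)
  case (Suc i)
  then have e: "rem i = dl i" using dl_pred_pos by (simp add: less_imp_le)
  have "dl (Suc i) < 1" using dl_less[of 0 "Suc i"] by simp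
  then have "\<lfloor>\<beta> * dl i\<rfloor> = m" using Suc.prems by (intro floor_unique) (auto simp: dl_Suc)
  then show ?case using e by (simp add: dl_Suc)
qed simp

lemma renyi_dl: "dl (Suc i) \<ge> 0 \<Longrightarrow> r i = m"
  using rem_dl[of "Suc i"] rem_dl[of i] dl_pred_pos[of i]
  by (simp add: rem_Suc dl_Suc less_imp_le del: rem.simps(2))

lemma periodic_orbit:
  assumes "(T ^^ (i + p)) L = (T ^^ i) L" "p > 0" shows "ev_periodic l"
proof -
  have "l (j + p) = l j" if ji: "i \<le> j" for j
  proof -
    obtain s where s: "j = i + s" using le_Suc_ex[OF ji] by blast
    have e: "j + p = (i + p) + s" using s by simp
    have "l (j + p) = D ((T ^^ (i + p)) L) s" unfolding l_eq e by (rule D_shift)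
    also have "\<dots> = l j" unfolding l_eq s assms(1) by (rule D_shift[symmetric])
    finally show ?thesis .
  qed
  then show ?thesis using assms(2) unfolding ev_periodic_def periodic_from_def by blast
qed

lemma zmax_0: "zmax 0 = 0" and zmin_0: "zmin 0 = 0"
  by (simp_all add: zmax_def zmin_def Zf_0)

lemma gap_length_0: "gap_length \<beta> 0 = 1"
  by (simp add: gap_length_eq zmax_0 zmin_0)

lemma gap_length_QP:
  assumes "zmax k = Q k - i" "zmin k = - P k" "dl k + i \<ge> 0" shows "gap_length \<beta> k = dl k + i"
  using QP_sum[of k] assms unfolding gap_length_eq by simp

lemma letter_rep_eq:
  assumes "\<And>j. j < k \<Longrightarrow> gap_length \<beta> j \<noteq> gap_length \<beta> k" shows "letter_rep \<beta> k = k"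
  unfolding letter_rep_def using assms by (auto intro!: Least_equality simp: not_less[symmetric])

lemma letter_rep_0: "letter_rep \<beta> 0 = 0" by (rule letter_rep_eq) simp

lemma beta_P: "- \<beta> * (- P k) = Q (Suc k) - of_int m" by (simp add: Q_Suc)

lemma beta_Q: "- \<beta> * Q k = - P (Suc k)" by (simp add: P_Suc)

end

section \<open>Letters and images of the antimorphism under condition (1)\<close>

context confluent_base begin

lemma dl_nonneg_if: "k < d \<or> (k = d \<and> even d) \<Longrightarrow> dl k \<ge> 0"
  using dl_pos_iff[of k] dl_d n_eq_m by auto

lemma zmax_eq_Q: "k < d \<Longrightarrow> zmax k = Q k"
proof (cases "k = 0")
  case False
  assume k: "k < d"
  have "zmax k = Q k - of_int 0"
  proof (rule zmax_eq)
    show "if even k then dl k + of_int 0 * (\<beta> + 1) > 0 else dl (Suc k) + of_int 0 * (\<beta> + 1) \<ge> 0"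
      using k dl_pos_iff[of k] dl_nonneg_if[of "Suc k"] by (cases "Suc k = d") auto
  qed (use False m_pos in auto)
  then show ?thesis by simp
qed (simp add: zmax_0)

lemma zmin_eq_P: "k \<le> d \<Longrightarrow> zmin k = - P k"
proof (rule zmin_eq)
  assume "k \<le> d"
  then show "if even k then dl k \<ge> 0 else dl (k - 1) > 0"
    using dl_nonneg_if[of k] dl_pos_iff[of "k - 1"] d_pos by (cases "k = d") auto
qed

lemma top_margin: "odd d \<Longrightarrow> dl (Suc d) + of_int (m - n + 1) * (\<beta> + 1) = \<beta> + 1 - of_int n"
  "odd d \<Longrightarrow> dl (Suc d) + of_int (m - n) * (\<beta> + 1) = - of_int n"
  by (simp_all add: dl_Suc dl_d algebra_simps)

text \<open>For even \<open>d\<close> we have \<open>dl d = 0\<close>, which excludes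
  \<open>Q d\<close> itself and nothing more. For odd \<open>d\<close> the margins in
  \<open>top_margin\<close> show that \<open>Q d - (m - n)\<close> is still outside the tile, while
  one unit less is inside because n \<le> \<beta>.\<close>

lemma zmax_d: "zmax d = Q d - of_int (m - n + 1)"
proof (rule zmax_eq)
  have "of_int n \<le> \<beta>" using n_le_m m_le by (metis of_int_le_iff order_trans)
  then show "if even d then dl d + of_int (m - n + 1) * (\<beta> + 1) > 0
        else dl (Suc d) + of_int (m - n + 1) * (\<beta> + 1) \<ge> 0"
    using top_margin dl_d n_eq_m beta_gt1 by auto
  show "if even d then dl d + of_int (m - n + 1 - 1) * (\<beta> + 1) \<le> 0
        else dl (Suc d) + of_int (m - n + 1 - 1) * (\<beta> + 1) < 0"
    using top_margin(2) dl_d n_eq_m n_ge1 by auto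
qed (use d_pos n_le_m n_ge1 in auto)

lemma zmax_d_JO: "Q d - of_int (m - n + 1) \<in> JO d"
proof -
  have "of_int n \<le> \<beta>" using n_le_m m_le by (metis of_int_le_iff order_trans)
  then have "if even d then dl d + of_int (m - n + 1) * (\<beta> + 1) > 0
        else dl (Suc d) + of_int (m - n + 1) * (\<beta> + 1) > 0"
    using top_margin dl_d n_eq_m beta_gt1 by auto
  then show ?thesis using Q_JO_iff[of d "m - n + 1"] d_pos n_le_m n_ge1 by auto
qed

lemma gap_length_less: "k < d \<Longrightarrow> gap_length \<beta> k = dl k"
  using gap_length_QP[of k 0] zmax_eq_Q zmin_eq_P dl_pos_iff[of k] by simp

lemma gap_length_d: "gap_length \<beta> d = 1"
  using gap_length_QP[of d "of_int (m - n + 1)"] zmax_d zmin_eq_P dl_d by simp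

text \<open>The gap separates the largest value in one tile from the least value in the adjacent
  one. Both are digit sums of length \<open>k + 1\<close> (after a shift by -\<beta>^k if
  \<open>k\<close> is odd), and they are neighbours among these, so \<open>Yf_gap\<close> applies.
  This bounds the alphabet after identification.\<close>

lemma gap_length_cases: "\<exists>i<d. gap_length \<beta> k = dl i"
proof -
  define x y where "x = (if even k then zmax k else zmax k - \<beta> ^ k)"
    and "y = (if even k then \<beta> ^ k + zmin k else zmin k)"
  have in_Xf: "zmax k \<in> Xf k" "zmin k \<in> Xf k" using zmax_in zmin_in Zf_sub_Xf by blast+
  have Jmax: "zmax k \<in> J k" and Jmin: "zmin k \<in> J k" using zmax_in zmin_in Zf_sub_J by blast+
  have "x \<in> Xf (Suc k)" unfolding digit_sums_Suc_iff using in_Xf m_pos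
    by (intro exI[of _ "if even k then 0 else 1"]) (auto simp: x_def)
  moreover have "y \<in> Xf (Suc k)" unfolding digit_sums_Suc_iff using in_Xf m_pos
    by (intro exI[of _ "if even k then 1 else 0"]) (auto simp: y_def)
  moreover have "x < y"
  proof -
    have "zmax k * (\<beta> + 1) < (\<beta> ^ k + zmin k) * (\<beta> + 1)"
      using Jmax Jmin unfolding J_iff by (auto simp: algebra_simps split: if_splits)
    then have "zmax k < \<beta> ^ k + zmin k" using mult_less_cancel_right_pos[OF beta_plus1] by blast
    then show ?thesis by (auto simp: x_def y_def)
  qed
  moreover have False if z: "z \<in> Xf (Suc k)" "x < z" "z < y" for z
  proof -
    define a b where "a = (if even k then 0 else 1 :: int)" and "b = (if even k then 1 else 0 :: int)"
    define u where "u = z - of_int a * (- \<beta>) ^ k"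
    have u: "u - \<beta> ^ k = z - of_int b * (- \<beta>) ^ k" by (simp add: u_def a_def b_def)
    have gt: "zmax k < u" and lt: "u - \<beta> ^ k < zmin k"
      using z by (auto simp: u_def a_def x_def y_def split: if_splits)
    have gt': "zmax k * (\<beta> + 1) < u * (\<beta> + 1)" and lt': "(u - \<beta> ^ k) * (\<beta> + 1) < zmin k * (\<beta> + 1)"
      using gt lt beta_gt1 by (auto intro: mult_strict_right_mono)
    have e: "(u - \<beta> ^ k) * (\<beta> + 1) = u * (\<beta> + 1) - \<beta> ^ Suc k - \<beta> ^ k" by (simp add: algebra_simps)
    \<comment> \<open>The tile and its translate by \<beta>^k are adjacent and leave no room between
      \<open>zmax k\<close> and \<beta>^k + zmin k.\<close>
    have "u \<in> J k \<or> u - \<beta> ^ k \<in> J k"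
      using Jmax Jmin gt' lt' unfolding J_iff e by (auto split: if_splits)
    then have "u \<in> Zf k \<or> u - \<beta> ^ k \<in> Zf k"
      using Xf_tile[OF z(1), of a] Xf_tile[OF z(1), of b] Xf_J_Zf u u_def by metis
    then show False using gt lt zmax_ge zmin_le by fastforce
  qed
  ultimately have "\<exists>i<d. (y + P (Suc k)) - (x + P (Suc k)) = dl i"
  proof (intro Yf_gap)
    fix z assume z: "z \<in> Yf (Suc k)" "x + P (Suc k) < z" "z < y + P (Suc k)"
    have "z - P (Suc k) \<in> Xf (Suc k)" unfolding Xf_Yf using z by simp
    then show False using \<open>\<And>z. z \<in> Xf (Suc k) \<Longrightarrow> x < z \<Longrightarrow> z < y \<Longrightarrow> False\<close>[of "z - P (Suc k)"] z by simp
  qed (auto simp: Xf_Yf)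
  moreover have "gap_length \<beta> k = y - x"
    using \<open>x < y\<close> unfolding gap_length_eq by (auto simp: x_def y_def)
  ultimately show ?thesis by simp
qed

text \<open>The orbit of \<open>L\<close> starts with the digits m, 0, m, 0 and so on, and at even
  times 2j \<le> d it is at -\<beta> dl (2j) / (\<beta> + 1). For even \<open>d\<close> it reaches 0
  at time \<open>d\<close>; for odd \<open>d\<close> it reaches the fixed point -n / (\<beta> + 1)
  at time \<open>d - 1\<close>. Hence letters are identified.\<close>

lemma ell_periodic: "ev_periodic l"
proof -
  have orb: "(T ^^ (2 * j)) L * (\<beta> + 1) = - \<beta> * dl (2 * j)" if "2 * j \<le> d" for j
    using that
  proof (induction j)
    case 0 then show ?case using ell_mult by simp
  next
    case (Suc j)
    define u where "u = (T ^^ (2 * j)) L"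
    define v where "v = dl (2 * Suc j) / (\<beta> + 1)"
    have u: "u * (\<beta> + 1) = - \<beta> * dl (2 * j)" using Suc by (simp add: u_def)
    have dlv: "v * (\<beta> + 1) = dl (2 * Suc j)" using beta_gt1 by (simp add: v_def)
    have "dl (2 * Suc j) \<ge> 0" using dl_nonneg_if[of "2 * Suc j"] Suc.prems by fastforce
    have "dl (2 * Suc j) < 1" using dl_less[of 0 "2 * Suc j"] by simp
    have inU: "w \<in> U" if "- \<beta> \<le> w * (\<beta> + 1)" "w * (\<beta> + 1) < 1" for w
    proof -
      have "L * (\<beta> + 1) \<le> w * (\<beta> + 1)" "w * (\<beta> + 1) < (L + 1) * (\<beta> + 1)"
        unfolding ell_mult using that by auto
      then show ?thesis using beta_plus1 by (simp add: mult_le_cancel_right mult_less_cancel_right)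
    qed
    have "(- \<beta> * u - of_int m) * (\<beta> + 1) = v * (\<beta> + 1)"
    proof -
      have "(- \<beta> * u - of_int m) * (\<beta> + 1) = - \<beta> * (u * (\<beta> + 1)) - of_int m * (\<beta> + 1)" by (simp add: algebra_simps)
      also have "\<dots> = dl (2 * Suc j)" unfolding u by (simp add: dl_Suc algebra_simps)
      finally show ?thesis using dlv by simp
    qed
    then have e1: "- \<beta> * u - of_int m = v" using beta_plus1 by simp
    have "v \<in> U" using \<open>dl (2 * Suc j) \<ge> 0\<close> \<open>dl (2 * Suc j) < 1\<close> dlv beta_gt1 by (intro inU) auto
    then have T1: "T u = v" using T_eq(1)[of u m] e1 by simp
    have m2: "(- \<beta> * v - of_int 0) * (\<beta> + 1) = - (\<beta> * dl (2 * Suc j))"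
      unfolding dlv[symmetric] by (simp only: of_int_0 diff_0_right mult.assoc mult_minus_left)
    have "\<beta> * dl (2 * Suc j) \<ge> 0" "\<beta> * dl (2 * Suc j) \<le> \<beta>"
      using \<open>dl (2 * Suc j) \<ge> 0\<close> \<open>dl (2 * Suc j) < 1\<close> beta_gt1 by simp_all
    then have "- \<beta> * v - of_int 0 \<in> U" using beta_gt1 by (intro inU; unfold m2; linarith)
    then have "T v = - \<beta> * v" using T_eq(1)[of v 0] by simp
    moreover have "(T ^^ (2 * Suc j)) L = T (T u)" by (simp add: u_def)
    ultimately show ?case using T1 m2 by (metis diff_0_right minus_mult_left of_int_0)
  qed
  show ?thesis
  proof (cases "even d")
    case True
    then have "(T ^^ d) L * (\<beta> + 1) = 0" using orb[of "d div 2"] dl_d n_eq_m by simp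
    then have "(T ^^ d) L = 0" using beta_plus1 by simp
    then show ?thesis using T_zero by (intro periodic_orbit[of d 1]) auto
  next
    case False
    define x where "x = (T ^^ (d - 1)) L"
    have "x * (\<beta> + 1) = - of_int n" using orb[of "d div 2"] False dl_d_pred by (simp add: x_def odd_two_times_div_two_nat)
    then have x: "- \<beta> * x - of_int n = x" by (simp add: algebra_simps)
    moreover have "x \<in> U" unfolding x_def using L_in_U by (rule T_pow_mem)
    ultimately have "T x = x" using T_eq(1)[of x n] by simp
    then show ?thesis by (intro periodic_orbit[of "d - 1" 1]) (auto simp: x_def)
  qed
qed

lemma letter_rep_less: "k < d \<Longrightarrow> letter_rep \<beta> k = k"
  by (rule letter_rep_eq) (use gap_length_less dl_less in force)

lemma letter_rep_if_unit: "gap_length \<beta> k = 1 \<Longrightarrow> letter_rep \<beta> k = 0"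
  using gap_length_0 by (simp add: letter_rep_def ell_periodic Least_eq_0)

lemma psi_alphabet: "psi_alphabet \<beta> = {..<d}"
proof
  show "psi_alphabet \<beta> \<subseteq> {..<d}"
  proof
    fix x assume "x \<in> psi_alphabet \<beta>"
    then obtain k where k: "x = (LEAST j. gap_length \<beta> j = gap_length \<beta> k)"
      by (auto simp: psi_alphabet_def letter_rep_def ell_periodic)
    obtain i where "i < d" "gap_length \<beta> i = gap_length \<beta> k" using gap_length_cases gap_length_less by metis
    then have "x \<le> i" unfolding k by (intro Least_le)
    then show "x \<in> {..<d}" using \<open>i < d\<close> by simp
  qed
  show "{..<d} \<subseteq> psi_alphabet \<beta>" using letter_rep_less unfolding psi_alphabet_def
    by (metis lessThan_iff rangeI subsetI)
qed

text \<open>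
  For even \<open>d\<close>, the number \<open>Q (d - 1)\<close> lies on the boundary of its tile, and its expansion is not
  \<open>m0m\<dots>0m\<close> but \<open>1m0m0\<dots>m0\<close>, of length \<open>d + 1\<close>.
\<close>

lemma edge_gap_letter:
  assumes "even d" shows "gap_letter \<beta> (Q (d - 1) - 1) (Q (d - 1)) = d"
proof -
  \<comment> \<open>These digits come from \<open>dl d = 0\<close>, which gives
    \<open>Q (d - 1) = Q d\<close> = \<beta>^d - P d, where \<beta>^d = (-\<beta>)^d.\<close>
  define a where "a j = (if j = d then 1 else if odd j then m else 0)" for j
  define s where "s j = (\<Sum>i<j. of_int (a i) * (- \<beta>) ^ i)" for j
  have d2: "d \<ge> 2" using assms d_pos by (metis dvd_1_iff_1 One_nat_def Suc_leI le_antisym not_less_eq_eq numeral_2_eq_2 odd_one)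
  have s_le: "s j = - P j" if "j \<le> d" for j
    unfolding s_def P_def by (auto simp: a_def that intro!: sum.cong split: if_splits) (use that in auto)
  have QdQ: "Q d = Q (d - 1)" using Q_add[of "d - 1"] assms d2 by simp
  have sS: "s (Suc d) = Q (d - 1)"
    using s_le[of d] QP_sum[of d] dl_d n_eq_m assms QdQ by (simp add: s_def a_def)
  have JS: "Q (d - 1) \<in> JO (Suc d)"
  proof -
    have "Q (d - 1) * (\<beta> + 1) = \<beta> ^ d" using Q_mult[of d] QdQ assms dl_d n_eq_m by simp
    moreover have "\<beta> ^ d < \<beta> ^ Suc (Suc d)" using beta_gt1 by (intro power_strict_increasing) auto
    ultimately show ?thesis using pow_pos[of "Suc d"] pow_pos[of d] assms unfolding JO_iff by auto
  qed
  have "s j \<in> J j" if "j \<le> Suc d" for j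
  proof (cases "j = Suc d")
    case True then show ?thesis using JS sS JO_sub by auto
  next
    case False
    then have "j \<le> d" using that by simp
    then show ?thesis using s_le zmin_eq_P zmin_in Zf_sub_J by (metis subsetD)
  qed
  then have dig: "D (Q (d - 1) / (- \<beta>) ^ Suc d) j = a (d - j)" if "j < Suc d" for j
    using digit_string(2)[of "Suc d" a j] that sS unfolding s_def[symmetric] by simp
  have e1: "neg_expansion \<beta> (Q (d - 1)) (int p) = (if p \<le> d then a p else 0)" for p
  proof (cases "p \<le> d")
    case True
    then have "nat (int (Suc d) - 1 - int p) = d - p" by simp
    then show ?thesis unfolding neg_expansion_eq[OF JS] using dig[of "d - p"] True by simp
  next
    case False then show ?thesis unfolding neg_expansion_eq[OF JS] by simp
  qed
  have "Q (d - 1) - of_int 1 \<in> JO (d - 1)"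
    using Q_JO_iff[of "d - 1" 1] d2 assms m_pos dl_d n_eq_m beta_gt1 by simp
  then have e2: "neg_expansion \<beta> (Q (d - 1) - 1) (int p) = (if p < d - 1 then qdig 1 p else 0)" for p
    using neg_expansion_Q[of "d - 1" 1 p] d2 m_pos by simp
  show ?thesis unfolding gap_letter_def e1 e2
  proof (rule Max_eqI)
    show "finite {i. (if i < d - 1 then qdig 1 i else 0) \<noteq> (if i \<le> d then a i else 0)}"
      by (rule finite_subset[of _ "{..d}"]) (auto split: if_splits)
  qed (auto simp: a_def split: if_splits)
qed

text \<open>The second gap word is empty, and the first one climbs in unit steps from
  \<open>Q (k + 1) - m\<close> to \<open>zmax (k + 1)\<close>. For \<open>k = d - 1\<close> there
  are \<open>n - 1\<close> such steps, and the letter \<open>d\<close> becomes one more 0, since its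
  gap has length 1.\<close>

lemma psi_eq: "k < d \<Longrightarrow> psi \<beta> k = (if Suc k < d then replicate (nat m) 0 @ [Suc k] else replicate (nat n) 0)"
proof -
  assume k: "k < d"
  define K where "K = Suc k"
  have K: "K \<ge> 1" "K \<le> d" using k by (auto simp: K_def)
  have psi_nat: "psi_nat \<beta> k = gap_word \<beta> (Q K - of_int m) (zmax K) @ [K]"
    unfolding psi_nat_eq zmax_eq_Q[OF k] beta_Q
    using zmin_eq_P[of k] zmin_eq_P[of K] k beta_P[of k] by (simp add: gap_word_same K_def)
  show ?thesis
  proof (cases "K < d")
    case False
    then have "K = d" using K by simp
    then have "psi_nat \<beta> k = replicate (nat (n - 1)) 0 @ [d]"
      using psi_nat gap_word_top[OF d_pos _ _ zmax_d_JO] zmax_d n_le_m n_ge1 by (simp add: diff_diff_eq2)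
    then have "psi \<beta> k = replicate (nat (n - 1)) 0 @ [0]"
      using letter_rep_if_unit[OF gap_length_d] letter_rep_0 by (simp add: psi_def)
    also have "\<dots> = replicate (nat n) 0"
    proof -
      have "nat n = Suc (nat (n - 1))" using n_ge1 by simp
      then show ?thesis by (simp add: replicate_append_same)
    qed
    finally show ?thesis using False by (simp add: K_def)
  next
    case True
    have zK: "zmax K = Q K - of_int 0" using zmax_eq_Q[OF True] by simp
    have J: "Q K - of_int 0 \<in> J K" using zK zmax_in Zf_sub_J by (metis subsetD)
    have Z: "Q K - of_int 0 \<in> neg_integers \<beta>"
      unfolding Z_eq_X X_set_iff using Q_in_Xf[of K 0] K m_pos by auto
    have rep: "letter_rep \<beta> (gap_letter \<beta> (Q K - of_int (i + 1)) (Q K - of_int i)) = 0"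
      if i: "0 \<le> i" "i < m" for i
    proof (cases "Q K - of_int i \<in> JO K")
      case True
      then show ?thesis using gap_letter_Q[OF K(1) i] letter_rep_0 by simp
    next
      case False
      \<comment> \<open>A boundary point arises only for \<open>i = 0\<close> and
        \<open>d = K + 1\<close> even; the letter is then \<open>d\<close>, which is identified with
        0.\<close>
      have pos: "dl K > 0" using \<open>K < d\<close> dl_pos_iff by simp
      have ib: "of_int i * (\<beta> + 1) \<ge> 0" using i beta_gt1 by simp
      have nn: "odd K \<Longrightarrow> dl (Suc K) \<ge> 0" using \<open>K < d\<close> dl_nonneg_if[of "Suc K"] by (cases "Suc K = d") auto
      have odd: "odd K" and le: "dl (Suc K) + of_int i * (\<beta> + 1) \<le> 0"
        using False Q_JO_iff[OF K(1), of i] i pos ib by (auto split: if_splits)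
      then have "of_int i * (\<beta> + 1) = 0" "dl (Suc K) = 0" using nn[OF odd] ib le by linarith+
      then have "i = 0" using beta_gt1 by simp
      have "\<not> Suc K < d" using \<open>dl (Suc K) = 0\<close> dl_pos_iff[of "Suc K"] by auto
      then have "d = Suc K" using \<open>K < d\<close> by simp
      then show ?thesis using edge_gap_letter odd \<open>i = 0\<close> letter_rep_if_unit[OF gap_length_d] by simp
    qed
    have "map (letter_rep \<beta>) (gap_word \<beta> (Q K - of_int m) (Q K - of_int 0)) = replicate (nat m) 0"
    proof (rule nth_equalityI)
      fix t assume "t < length (map (letter_rep \<beta>) (gap_word \<beta> (Q K - of_int m) (Q K - of_int 0)))"
      then have t: "t < nat m" using gap_word_top_map[OF K(1) _ _ J Z] m_pos by simp
      have mt: "m - int t = (m - int (Suc t)) + 1" by simp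
      show "map (letter_rep \<beta>) (gap_word \<beta> (Q K - of_int m) (Q K - of_int 0)) ! t = replicate (nat m) 0 ! t"
        using gap_word_top_map[OF K(1) _ _ J Z] m_pos t rep[of "m - int (Suc t)"] unfolding mt by simp
    qed (use gap_word_top_map[OF K(1) _ _ J Z] m_pos in simp)
    then have "psi \<beta> k = replicate (nat m) 0 @ [K]"
      using psi_nat zK letter_rep_less[OF True] by (simp add: psi_def)
    then show ?thesis using True by (simp add: K_def)
  qed
qed

section \<open>The canonical morphism under condition (1), and the conjugacy\<close>

lemma renyi_conf: "Suc i < d \<Longrightarrow> r i = m" "r (d - 1) = n" "i \<ge> d \<Longrightarrow> r i = 0"
proof -
  show "Suc i < d \<Longrightarrow> r i = m" using renyi_dl dl_pos_iff by (simp add: less_imp_le)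
  have "rem (d - 1) = dl (d - 1)" using rem_dl dl_pos_iff[of "d - 1"] d_pos by simp
  then show rd: "r (d - 1) = n" using dl_d_pred by (simp add: renyi_unity_eq)
  have "rem d = 0" using rem_Suc[of "d - 1"] rd dl_d_pred \<open>rem (d - 1) = dl (d - 1)\<close> d_pos by simp
  have "i \<ge> d \<Longrightarrow> rem i = 0"
    by (induction i rule: dec_induct) (use \<open>rem d = 0\<close> in auto)
  then show "i \<ge> d \<Longrightarrow> r i = 0" by (simp add: renyi_unity_eq)
qed

lemma simple: "simple_parry \<beta>" "simple_length \<beta> = d"
proof -
  show "simple_parry \<beta>" unfolding simple_parry_def using renyi_conf(3) by blast
  show "simple_length \<beta> = d" unfolding simple_length_def
  proof (rule Least_equality)
    fix k assume k: "\<forall>i\<ge>k. r i = 0"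
    show "d \<le> k"
    proof (rule ccontr)
      assume "\<not> d \<le> k"
      then have "r (d - 1) = 0" using k by simp
      then show False using renyi_conf(2) n_ge1 by simp
    qed
  qed (use renyi_conf(3) in blast)
qed

lemma phi_eq: "k < d \<Longrightarrow> phi \<beta> k = (if Suc k < d then replicate (nat m) 0 @ [Suc k] else replicate (nat n) 0)"
proof -
  assume "k < d"
  then consider "Suc k < d" | "k = d - 1" "\<not> Suc k < d" by linarith
  then show ?thesis by cases (simp_all add: phi_def simple renyi_conf renyi_conf(2)[unfolded One_nat_def])
qed

lemma replicate_letters_commute:
  "concat (replicate i u) @ concat (replicate j u) = concat (replicate j u) @ concat (replicate i u)"
  by (metis add.commute concat_append replicate_add)

text \<open>For a < d - 1 the square of \<phi> gives \<phi>(0)^m \<phi>(a + 1), while the reversal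
  in an antimorphism gives \<phi>(a + 1) \<phi>(0)^m for \<psi>. For a = d - 1 both squares are
  \<phi>(0)^n, which commutes with \<phi>(0)^m.\<close>

lemma confluent_imp_conjugated:
  "phi_alphabet \<beta> = psi_alphabet \<beta> \<and> conjugated_on (phi_alphabet \<beta>) (phi_sq \<beta>) (psi_sq \<beta>)"
proof -
  have alph: "phi_alphabet \<beta> = {..<d}" by (simp add: phi_alphabet_def simple)
  define w where "w = concat (replicate (nat m) (phi \<beta> 0))"
  have "set (phi \<beta> 0) \<subseteq> {..<d}" using phi_eq[of 0] d_pos by (auto split: if_splits)
  then have "w \<in> lists {..<d}" by (auto simp: w_def)
  moreover have "phi_sq \<beta> a @ w = w @ psi_sq \<beta> a" if "a < d" for a
  proof (cases "Suc a < d")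
    case True
    have "phi \<beta> (Suc a) = psi \<beta> (Suc a)" "phi \<beta> 0 = psi \<beta> 0" using True d_pos phi_eq psi_eq by simp_all
    moreover have "phi_sq \<beta> a = w @ phi \<beta> (Suc a)"
      using phi_eq[OF that] True by (simp add: phi_sq_def morphism_ext_def w_def)
    moreover have "psi_sq \<beta> a = psi \<beta> (Suc a) @ concat (replicate (nat m) (psi \<beta> 0))"
      using psi_eq[OF that] True by (simp add: psi_sq_def antimorphism_ext_def)
    ultimately show ?thesis by (simp add: w_def)
  next
    case False
    have "phi \<beta> 0 = psi \<beta> 0" using d_pos phi_eq psi_eq by simp
    moreover have "phi_sq \<beta> a = concat (replicate (nat n) (phi \<beta> 0))"
      using phi_eq[OF that] False by (simp add: phi_sq_def morphism_ext_def)
    moreover have "psi_sq \<beta> a = concat (replicate (nat n) (psi \<beta> 0))"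
      using psi_eq[OF that] False by (simp add: psi_sq_def antimorphism_ext_def)
    ultimately show ?thesis using replicate_letters_commute by (simp add: w_def)
  qed
  ultimately show ?thesis unfolding alph psi_alphabet conjugated_on_def by blast
qed

end

section \<open>Conjugacy of the squares implies the first condition\<close>

lemma count_list_concat_ge:
  "count_list xs x * count_list (f x) y \<le> count_list (concat (map f xs)) y"
  by (induction xs) auto

lemma count_list_concat_replicate:
  "count_list (concat (replicate k u)) y = k * count_list u y"
  by (induction k) auto

lemma count_list_replicate: "count_list (replicate k x) y = (if x = y then k else 0)"
  by (induction k) auto

lemma conjugate_count:
  assumes "u @ w = w @ v \<or> w @ u = v @ w"
  shows "count_list u y = count_list v y" "length u = length v"
proof -
  have "count_list u y + count_list w y = count_list v y + count_list w y"
    using assms by (metis add.commute count_list_append)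
  then show "count_list u y = count_list v y" by simp
  have "length u + length w = length v + length w" using assms by (metis add.commute length_append)
  then show "length u = length v" by simp
qed

section \<open>The orbit of 1 and the shape of the canonical morphism\<close>

context neg_base begin

lemma renyi_nonneg: "r i \<ge> 0"
  using rem_nonneg[of i] beta_gt1 by (simp add: renyi_unity_eq)

lemma renyi_le_m: "r i \<le> m"
proof -
  have "rem i \<le> 1" using rem_less1[of "i - 1"] by (cases i) (auto simp del: rem.simps(2))
  then have "\<beta> * rem i \<le> \<beta>" using beta_gt1 by simp
  then show ?thesis unfolding renyi_unity_eq m_def by (rule floor_mono)
qed

lemma rem_less1': "i \<ge> 1 \<Longrightarrow> rem i < 1"
  using rem_less1[of "i - 1"] by simp

lemma rem_diff:
  assumes "\<And>j. r (a + j) = r (b + j)"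
  shows "rem (a + j) - rem (b + j) = \<beta> ^ j * (rem a - rem b)"
proof (induction j)
  case (Suc j)
  have "rem (a + Suc j) - rem (b + Suc j) = \<beta> * (rem (a + j) - rem (b + j))"
    using assms[of j] by (simp add: rem_Suc algebra_simps del: rem.simps(2))
  then show ?case by (simp add: Suc)
qed simp

text \<open>Equal digits make the distance of the two orbits grow like \<beta>^j, but it never
  exceeds 1.\<close>

lemma rem_determined:
  assumes "\<And>j. r (a + j) = r (b + j)" shows "rem a = rem b"
proof -
  have "\<beta> ^ j * \<bar>rem a - rem b\<bar> \<le> 1" for j
  proof -
    have "rem i \<le> 1" for i using rem_less1'[of i] by (cases i) (auto simp del: rem.simps(2))
    then have "\<bar>rem (a + j) - rem (b + j)\<bar> \<le> 1"
      using rem_nonneg[of "a + j"] rem_nonneg[of "b + j"] by (smt (verit))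
    then show ?thesis using rem_diff[OF assms] beta_gt1 by (simp add: abs_mult)
  qed
  then show ?thesis using eventually_power_gt[OF beta_gt1] by fastforce
qed

lemma rem_zero: assumes "\<And>j. j \<ge> i \<Longrightarrow> r j = 0" shows "rem i = 0"
proof -
  have e: "rem (i + j) = \<beta> ^ j * rem i" for j
    by (induction j) (simp_all add: rem_Suc assms del: rem.simps(2))
  have "\<beta> ^ j * rem i \<le> 1" for j
    unfolding e[symmetric] using rem_less1'[of "i + j"] by (cases "i + j") (auto simp del: rem.simps(2))
  then have "rem i \<le> 0" by (rule eventually_power_gt[OF beta_gt1])
  then show ?thesis using rem_nonneg[of i] by simp
qed

abbreviation "A \<equiv> phi_alphabet \<beta>"

text \<open>The three definitions of \<phi> in one form: its image ends with a new letter, or with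
  an old letter \<open>k\<close> because the orbit of 1 returns to its value at \<open>k\<close>, or
  with 0 because the orbit reaches 0.\<close>

lemma phi_cases:
  assumes "i \<in> A"
  obtains "Suc i \<in> A" "phi \<beta> i = replicate (nat (r i)) 0 @ [Suc i]"
  | k where "Suc i \<notin> A" "1 \<le> k" "k \<le> i" "phi \<beta> i = replicate (nat (r i)) 0 @ [k]" "rem (Suc i) = rem k"
  | "Suc i \<notin> A" "phi \<beta> i = replicate (nat (r i)) 0" "r i \<ge> 1" "rem (Suc i) = 0"
proof (cases "simple_parry \<beta>")
  case True
  then have "\<exists>k. \<forall>i\<ge>k. r i = 0" by (simp add: simple_parry_def)
  then have z: "\<forall>i\<ge>simple_length \<beta>. r i = 0" unfolding simple_length_def by (rule LeastI_ex)
  have i: "i < simple_length \<beta>" using assms True by (simp add: phi_alphabet_def)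
  show ?thesis
  proof (cases "Suc i < simple_length \<beta>")
    case s: True
    then show ?thesis using that(1) True by (simp add: phi_alphabet_def phi_def)
  next
    case False
    then have N: "simple_length \<beta> = Suc i" using i by simp
    have "\<not> (\<forall>j\<ge>i. r j = 0)"
    proof
      assume "\<forall>j\<ge>i. r j = 0"
      then have "simple_length \<beta> \<le> i" unfolding simple_length_def by (rule Least_le)
      then show False using N by simp
    qed
    then have "r i \<noteq> 0" using z N by (metis Suc_leI le_neq_implies_less)
    moreover have "rem (Suc i) = 0" using z N by (intro rem_zero) simp
    ultimately show ?thesis using that(3) True N renyi_nonneg[of i] by (simp add: phi_alphabet_def phi_def del: rem.simps(2))
  qed
next
  case not_simple: False
  show ?thesis
  proof (cases "parry \<beta>")
    case False
    then show ?thesis using that(1) not_simple by (simp add: phi_alphabet_def phi_def)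
  next
    case True
    define k p where "k = preperiod r" and "p = period r"
    have per: "p > 0" "\<And>j. r (k + p + j) = r (k + j)"
    proof -
      have ev: "ev_periodic r" using True by (simp add: parry_def)
      show "p > 0" using ev_periodicD(1)[OF ev] by (simp add: p_def)
      show "r (k + p + j) = r (k + j)" for j
        using ev_periodicD(2)[OF ev, of "k + j"] by (simp add: k_def p_def ac_simps)
    qed
    have rem: "rem (k + p) = rem k" using per(2) by (rule rem_determined)
    have "k \<ge> 1"
    proof (rule ccontr)
      assume "\<not> k \<ge> 1"
      then have "k = 0" by simp
      then have "rem p = 1" using rem by simp
      then show False using rem_less1'[of p] per(1) by simp
    qed
    have i: "i < k + p" using assms True not_simple by (simp add: phi_alphabet_def k_def p_def)
    show ?thesis
    proof (cases "Suc i < k + p")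
      case s: True
      then show ?thesis using that(1) True not_simple by (simp add: phi_alphabet_def phi_def k_def p_def)
    next
      case False
      then have N: "k + p = Suc i" using i by simp
      then have "k \<le> i" using per(1) by simp
      then show ?thesis using that(2)[of k] True not_simple N rem \<open>k \<ge> 1\<close>
        by (simp add: phi_alphabet_def phi_def k_def[symmetric] p_def[symmetric] del: rem.simps(2))
    qed
  qed
qed

lemma zero_in_A: "0 \<in> A"
proof -
  have "r 0 = m" by (simp add: renyi_unity_def m_def)
  then have "r 0 \<noteq> 0" using m_pos by simp
  have "0 < simple_length \<beta>" if "simple_parry \<beta>"
  proof -
    have "\<exists>k. \<forall>i\<ge>k. r i = 0" using that by (simp add: simple_parry_def)
    then have "\<forall>i\<ge>simple_length \<beta>. r i = 0" unfolding simple_length_def by (rule LeastI_ex)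
    then show ?thesis using \<open>r 0 \<noteq> 0\<close> by (metis gr0I le0)
  qed
  moreover have "parry \<beta> \<Longrightarrow> 0 < period r" using ev_periodicD(1) by (simp add: parry_def)
  ultimately show ?thesis by (simp add: phi_alphabet_def)
qed

lemma A_downward: "j \<in> A \<Longrightarrow> i \<le> j \<Longrightarrow> i \<in> A"
  by (auto simp: phi_alphabet_def split: if_splits)

text \<open>The alphabet ends only where the orbit of 1 returns to an earlier value or reaches 0.
  Neither happens while the orbit follows the positive, strictly decreasing
  \<open>dl\<close>.\<close>

lemma dl_pos_in_A: "dl i > 0 \<Longrightarrow> i \<in> A"
proof (induction i)
  case 0 show ?case by (rule zero_in_A)
next
  case (Suc i)
  then have iA: "i \<in> A" using dl_pred_pos[of i] by simp
  have rS: "rem (Suc i) = dl (Suc i)" using Suc.prems by (intro rem_dl) simp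
  from iA show ?case
  proof (cases rule: phi_cases)
    case (2 k)
    then have "dl k > dl (Suc i)" by (intro dl_less) simp
    moreover from this have "rem k = dl k" using Suc.prems by (intro rem_dl) simp
    ultimately show ?thesis using 2(5) rS by simp
  next
    case 3 then show ?thesis using rS Suc.prems by simp
  qed simp
qed

lemma phi_nonempty: "i \<in> A \<Longrightarrow> phi \<beta> i \<noteq> []"
  by (erule phi_cases) simp_all

lemma zmax_eq_Q_if: "if even k then dl k > 0 else dl (Suc k) \<ge> 0 \<Longrightarrow> zmax k = Q k"
proof (cases "k = 0")
  case False
  assume "if even k then dl k > 0 else dl (Suc k) \<ge> 0"
  then have "zmax k = Q k - of_int 0" using False m_pos by (intro zmax_eq) auto
  then show ?thesis by simp
qed (simp add: zmax_0)

lemma psi_nat_hull: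
  assumes "zmax k = Q k" "zmin k = - P k" "zmax (Suc k) = Q (Suc k) - of_int i" "zmin (Suc k) = - P (Suc k)"
    and "0 \<le> i" "i \<le> m" "Q (Suc k) - of_int i \<in> JO (Suc k)"
  shows "psi_nat \<beta> k = replicate (nat (m - i)) 0 @ [Suc k]"
  unfolding psi_nat_eq assms(1-4) beta_P beta_Q using gap_word_top[of "Suc k" i] assms(5-7)
  by (simp add: gap_word_same)

lemma Zf_shift: "x \<in> Zf k \<Longrightarrow> - \<beta> * x \<in> Zf (Suc k)"
proof -
  assume x: "x \<in> Zf k"
  have e: "(- \<beta> * x) / (- \<beta>) ^ Suc k = x / (- \<beta>) ^ k" using beta_gt1 by simp
  have "(T ^^ Suc k) (x / (- \<beta>) ^ k) = 0" using x T_zero by (simp add: Zf_def)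
  then show ?thesis using x unfolding Zf_def J_def mem_Collect_eq e by simp
qed

text \<open>Here \<open>Q 1 = m\<close> is outside its tile, so \<psi>(0) = 0^(m-1) 1. Counting
  (-\<beta>)-integers gives at most 2m letters in \<psi>(1), so the square of \<psi> maps 0 to at
  most m(m + 1) letters, and that of \<phi> to more.\<close>

lemma psi_length_contra:
  assumes "dl 1 > 0" "dl 2 < 0" "w @ phi_sq \<beta> 0 = psi_sq \<beta> 0 @ w \<or> phi_sq \<beta> 0 @ w = w @ psi_sq \<beta> 0"
  shows False
proof -
  define M where "M = nat m"
  have M: "M \<ge> 1" "int M = m" using m_pos by (auto simp: M_def)
  have Q1: "Q 1 = of_int m" "P 1 = 0" "Q 2 = of_int m" using Q_add[of 0] P_add[of 0] Q_add[of 1]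
    by (simp_all add: numeral_2_eq_2)
  have d2: "dl 2 = \<beta> * dl 1 - of_int m" using dl_Suc[of 1] by (simp add: numeral_2_eq_2)
  then have ge: "dl 2 + (\<beta> + 1) > 0"
  proof -
    have "\<beta> * dl 1 > 0" using assms(1) beta_gt1 by simp
    then show ?thesis using d2 m_le by linarith
  qed
  have A1: "1 \<in> A" using assms(1) by (rule dl_pos_in_A)
  have phi0: "phi \<beta> 0 = replicate M 0 @ [1]"
    using zero_in_A
  proof (cases rule: phi_cases)
    case 1 then show ?thesis using renyi_dl[of 0] assms(1) by (simp add: M_def)
  qed (use A1 in auto)
  have "length (phi_sq \<beta> 0) = M * (M + 1) + length (phi \<beta> 1)"
    by (simp add: phi_sq_def morphism_ext_def phi0 length_concat sum_list_replicate)
  then have len_phi: "length (phi_sq \<beta> 0) > M * (M + 1)" using phi_nonempty[OF A1] by simp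
  have zmax1: "zmax 1 = Q 1 - of_int 1"
    by (rule zmax_eq) (use assms(2) ge m_pos in \<open>auto simp: numeral_2_eq_2\<close>)
  have zmin1: "zmin 1 = - P 1" by (rule zmin_eq) simp
  have zmax2: "zmax 2 = Q 2 - of_int 1"
    by (rule zmax_eq) (use assms(2) ge m_pos in auto)
  have JO1: "Q 1 - of_int 1 \<in> JO 1" using Q_JO_iff[of 1 1] ge m_pos by (simp add: numeral_2_eq_2)
  have JO2: "Q 2 - of_int 1 \<in> JO 2" using Q_JO_iff[of 2 1] ge m_pos by simp
  have psi_nat0: "psi_nat \<beta> 0 = replicate (M - 1) 0 @ [1]"
    using psi_nat_hull[of 0 1] zmax_0 zmin_0 zmax1 zmin1 JO1 m_pos by (simp add: M_def nat_diff_distrib)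
  have "gap_length \<beta> 1 = dl 1 + 1"
    using gap_length_QP[of 1 1] zmax1 zmin1 assms(1) by simp
  then have "letter_rep \<beta> 1 = 1" using gap_length_0 assms(1) by (intro letter_rep_eq) simp
  then have psi0: "psi \<beta> 0 = replicate (M - 1) 0 @ [1]"
    using psi_nat0 letter_rep_0 by (simp add: psi_def)
  have "length (gap_word \<beta> (- \<beta> * zmin 1) (zmax 2)) = M - 1"
    using gap_word_top[of 2 1] JO2 m_pos zmin1 Q1 zmax2 by (simp add: M_def nat_diff_distrib)
  moreover have "length (gap_word \<beta> (- \<beta> * zmax 1) (zmin 2)) \<le> M"
  proof -
    define b where "b = - \<beta> * zmax 1"
    have bZ: "b \<in> Zf 2" using Zf_shift[OF zmax_in[of 1]] by (simp add: b_def numeral_2_eq_2)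
    have "zmin 2 \<le> b" using bZ by (rule zmin_le)
    \<comment> \<open>The elements are y - c \<beta> with y in {0..m-1}; leading digit
      \<open>c = m\<close> gives \<open>m\<close> points, and a smaller \<open>c\<close> cannot give
      a point below \<open>b\<close>.\<close>
    have sub: "neg_integers \<beta> \<inter> {zmin 2..b} \<subseteq> insert b ((\<lambda>i. - \<beta> * of_int m + real i) ` {..<M})"
    proof
      fix x assume x: "x \<in> neg_integers \<beta> \<inter> {zmin 2..b}"
      have xZ: "x \<in> Zf 2"
      proof (cases "x = zmin 2 \<or> x = b")
        case True then show ?thesis using bZ zmin_in by auto
      next
        case False
        then have "zmin 2 < x" "x < b" using x by auto
        then have "x \<in> JO 2" using J_between bZ zmin_in Zf_sub_J by blast
        then show ?thesis using x neg_integers_iff by blast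
      qed
      then obtain c where c: "0 \<le> c" "c \<le> m" "x - of_int c * (- \<beta>) ^ 1 \<in> Zf 1"
        using Zf_Suc[of x 1] by (auto simp: numeral_2_eq_2)
      define y where "y = x - of_int c * (- \<beta>) ^ 1"
      have xy: "x = y - of_int c * \<beta>" by (simp add: y_def)
      have "y \<in> Xf (Suc 0)" using c(3) Zf_sub_Xf[of 1] by (auto simp: y_def)
      then obtain i where i: "0 \<le> i" "y = of_int i" unfolding digit_sums_Suc_iff by auto
      have "y \<le> zmax 1" using c(3) zmax_ge y_def by blast
      then have "i < m" using i Q1 zmax1 by simp
      show "x \<in> insert b ((\<lambda>i. - \<beta> * of_int m + real i) ` {..<M})"
      proof (cases "c = m")
        case True
        then have "x = - \<beta> * of_int m + real (nat i)" using xy i by simp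
        moreover have "nat i \<in> {..<M}" using \<open>i < m\<close> i M by auto
        ultimately show ?thesis by blast
      next
        case False
        then have "of_int c * \<beta> \<le> of_int (m - 1) * \<beta>" using c beta_gt1 by (intro mult_right_mono) auto
        moreover have "zmax 1 = of_int (m - 1)" using zmax1 Q1 by simp
        then have "b = - (of_int (m - 1) * \<beta>)" unfolding b_def by simp
        moreover have "y \<ge> 0" using i by simp
        ultimately have "x \<ge> b" using xy by linarith
        then show ?thesis using x by auto
      qed
    qed
    have "card (neg_integers \<beta> \<inter> {zmin 2..b}) \<le> card (insert b ((\<lambda>i. - \<beta> * of_int m + real i) ` {..<M}))"
      by (rule card_mono[OF _ sub]) simp
    also have "\<dots> \<le> Suc (card ((\<lambda>i. - \<beta> * of_int m + real i) ` {..<M}))" by (rule card_insert_le_m1) simp_all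
    also have "\<dots> \<le> Suc M" using card_image_le[of "{..<M}"] by simp
    finally have "card (neg_integers \<beta> \<inter> {zmin 2..b}) - 1 \<le> M" by simp
    moreover have "min b (zmin 2) = zmin 2" "max b (zmin 2) = b" using \<open>zmin 2 \<le> b\<close> by auto
    ultimately show ?thesis unfolding length_gap_word b_def[symmetric] by simp
  qed
  ultimately have "length (psi_nat \<beta> 1) \<le> M - 1 + 1 + M"
    unfolding psi_nat_eq by (simp add: numeral_2_eq_2)
  then have "length (psi \<beta> 1) \<le> 2 * M" using M by (simp add: psi_def)
  moreover have "length (psi_sq \<beta> 0) = length (psi \<beta> 1) + (M - 1) * M"
    using M by (simp add: psi_sq_def antimorphism_ext_def psi0 length_concat sum_list_replicate)
  ultimately have "length (psi_sq \<beta> 0) \<le> 2 * M + (M - 1) * M" by simp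
  also have "\<dots> = M * (M + 1)" using M by (cases M) auto
  also have "length (psi_sq \<beta> 0) = length (phi_sq \<beta> 0)"
    by (rule conjugate_count(2)[symmetric, of _ w]) (use assms(3) in blast)
  finally show False using len_phi by simp
qed

end

section \<open>Words: repeated blocks, common prefixes and suffixes\<close>

lemma concat_map_replicate_snoc:
  "concat (map f (replicate k x @ [y])) = concat (replicate k (f x)) @ f y"
  "concat (map f (rev (replicate k x @ [y]))) = f y @ concat (replicate k (f x))"
  by simp_all

lemma concat_replicate_split:
  "k \<le> n \<Longrightarrow> concat (replicate n u) = concat (replicate k u) @ concat (replicate (n - k) u)"
  by (metis concat_append le_add_diff_inverse replicate_add)

lemma prefix_block_nth:
  assumes "x @ y = (replicate M a @ [b]) @ z"
  shows "i < M \<Longrightarrow> (x @ y) ! i = a" "(x @ y) ! M = b"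
  using assms by (simp_all add: nth_append)

lemma common_suffix:
  assumes "xs @ u = ys @ w" "length u \<le> length w" shows "\<exists>z. w = z @ u"
proof -
  obtain us where "xs = ys @ us \<and> us @ u = w \<or> xs @ us = ys \<and> u = us @ w"
    using assms(1) unfolding append_eq_append_conv2 by blast
  then show ?thesis using assms(2) by auto
qed

text \<open>
  The position of the only letter 2 on the two sides shows that \<open>w\<close> is not shorter than \<open>B\<close>.
\<close>

lemma conjugator_prefix:
  assumes eq: "B @ replicate M 0 @ [2::nat] @ w = w @ replicate M 0 @ [2] @ v"
    and B: "set B \<subseteq> {0, 1}"
  shows "\<exists>w'. w = B @ w'"
proof -
  have "length B \<le> length w"
  proof (rule ccontr)
    assume short: "\<not> length B \<le> length w"
    define p where "p = length w + M"
    have "(w @ replicate M 0 @ [2] @ v) ! p = 2" by (simp add: p_def nth_append)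
    moreover have "(B @ replicate M 0 @ [2::nat] @ w) ! p \<in> {0, 1}"
    proof (cases "p < length B")
      case True
      then have "B ! p \<in> {0, 1}" using B nth_mem[OF True] by blast
      then show ?thesis using True by (simp add: nth_append)
    next
      case False
      then show ?thesis using short by (simp add: nth_append p_def)
    qed
    ultimately show False unfolding eq by simp
  qed
  have "take (length B) (B @ replicate M 0 @ [2::nat] @ w) = B" by simp
  then have "B = take (length B) w" unfolding eq using \<open>length B \<le> length w\<close> by simp
  then show ?thesis by (metis append_take_drop_id)
qed

section \<open>From a conjugating word to the polynomial condition\<close>

context neg_base begin

text \<open>Let \<open>e\<close> be the number of zeros in \<phi>(c). If a letter c' follows them,
  then e < m puts it too early, and e = m forces c' = 1; then the orbit of 1 would be back at 1 at
  time \<open>c\<close>. If no letter follows, then e \<ge> 1 and the zeros at the start of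
  \<open>w\<close> put a 0 at index \<open>m\<close>.\<close>

lemma phi_prefix_contra:
  assumes "c \<in> A" "c \<ge> 1" and w: "w = replicate (nat m) 0 @ [1] @ v"
    and pre: "phi \<beta> c @ w = (replicate (nat m) 0 @ [1]) @ z"
  shows False
proof -
  define M where "M = nat m"
  have M: "M \<ge> 1" "int M = m" using m_pos by (auto simp: M_def)
  define e where "e = nat (r c)"
  have e: "e \<le> M" using renyi_le_m renyi_nonneg by (simp add: e_def M_def nat_mono)
  have nth: "i < M \<Longrightarrow> (phi \<beta> c @ w) ! i = 0" "(phi \<beta> c @ w) ! M = 1" for i
    using prefix_block_nth[OF pre] by (auto simp: M_def)
  have key: False if c': "phi \<beta> c = replicate e 0 @ [c']" "c' \<ge> 1" "rem (Suc c) = rem c'" for c'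
  proof (cases "e < M")
    case True
    then show False using nth(1)[of e] c' by (simp add: nth_append)
  next
    case False
    then have "e = M" using e by simp
    then have "c' = 1" using nth(2) c' by (simp add: nth_append)
    have "r c = m" using \<open>e = M\<close> M renyi_nonneg[of c] by (simp add: e_def)
    have "\<beta> * rem c - of_int m = \<beta> - of_int m"
      using c'(3) \<open>r c = m\<close> \<open>c' = 1\<close> rem_Suc[of c] by (simp add: m_def)
    then have "rem c = 1" using beta_gt1 by simp
    then show False using rem_less1'[OF assms(2)] by simp
  qed
  from assms(1) show False
  proof (cases rule: phi_cases)
    case 1 then show ?thesis using key[of "Suc c"] by (simp add: e_def del: rem.simps(2))
  next
    case (2 k) then show ?thesis using key[of k] by (simp add: e_def del: rem.simps(2))
  next
    case 3
    then have "e \<ge> 1" by (simp add: e_def)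
    moreover have "(phi \<beta> c @ w) ! M = 0"
      using 3 e \<open>e \<ge> 1\<close> M by (simp add: nth_append e_def[symmetric] w M_def[symmetric])
    ultimately show ?thesis using nth(2) by simp
  qed
qed

lemma conjugated_imp_confluent:
  assumes alph: "A = psi_alphabet \<beta>" and conj: "conjugated_on A (phi_sq \<beta>) (psi_sq \<beta>)"
  shows "\<exists>d n. confluent d n"
proof -
  obtain t where t: "dl t > 0" "dl (Suc t) \<le> 0" using ex_last_pos by blast
  obtain w where w: "(\<forall>a\<in>A. w @ phi_sq \<beta> a = psi_sq \<beta> a @ w) \<or> (\<forall>a\<in>A. phi_sq \<beta> a @ w = w @ psi_sq \<beta> a)"
    using conj unfolding conjugated_on_def by blast
  have cnt: "count_list (phi_sq \<beta> a) y = count_list (psi_sq \<beta> a) y" if "a \<in> A" for a y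
    by (rule conjugate_count(1)[of _ w]) (use w that in blast)
  have inA: "i \<in> A" if "i \<le> t" for i using dl_le[OF that] t(1) by (intro dl_pos_in_A) simp
  define M where "M = nat m"
  have M: "M \<ge> 1" "int M = m" using m_pos by (auto simp: M_def)
  show ?thesis
  proof (cases "dl (Suc t) = 0")
    case True then show ?thesis using confluent_if_zero by blast
  next
    case False
    then have neg: "dl (Suc t) < 0" using t by simp
    have t0: "t \<noteq> 0" using neg m_le by (auto simp: dl_Suc intro: Nat.gr0I)
    have t1: "t \<noteq> 1"
    proof
      assume "t = 1"
      then show False using psi_length_contra[of w] t neg w zero_in_A by (auto simp: numeral_2_eq_2)
    qed
    then have t2: "t \<ge> 2" using t0 by simp
    have pos: "dl i > 0" if "i \<le> t" for i using dl_le[OF that] t(1) by simp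
    have pos': "dl (Suc 0) > 0" "dl 2 > 0" "dl (Suc (Suc 0)) > 0" using pos t2 by (auto simp: numeral_2_eq_2)
    have zmax: "zmax i = Q i" if "i < t" for i using pos that by (intro zmax_eq_Q_if) (simp add: less_imp_le)
    have zmax2: "zmax 2 = Q 2" using pos' by (intro zmax_eq_Q_if) simp
    have zmin: "zmin i = - P i" if "i \<le> t" for i
      using pos[OF that] pos[of "i - 1"] that by (intro zmin_eq) (simp add: less_imp_le)
    have gap: "gap_length \<beta> i = dl i" if "i \<le> t" "zmax i = Q i" for i
      using gap_length_QP[of i 0] that zmin pos[of i] by (simp add: less_imp_le)
    have rep: "letter_rep \<beta> i = i" if "i \<le> t" "zmax i = Q i" for i
    proof (rule letter_rep_eq)
      fix j assume "j < i"
      then show "gap_length \<beta> j \<noteq> gap_length \<beta> i" using gap[OF that] gap[of j] zmax[of j] dl_less[of j i] that by simp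
    qed
    have phi: "phi \<beta> i = replicate M 0 @ [Suc i]" if "Suc i \<in> A" "dl (Suc i) \<ge> 0" for i
    proof -
      have "i \<in> A" using that A_downward by (metis lessI less_imp_le)
      then show ?thesis by (cases rule: phi_cases) (use that renyi_dl in \<open>auto simp: M_def\<close>)
    qed
    have phi0: "phi \<beta> 0 = replicate M 0 @ [1]" and phi1: "phi \<beta> 1 = replicate M 0 @ [2]"
      using phi[of 0] phi[of 1] inA[of 1] inA[of 2] t2 pos[of 1] pos[of 2] by (simp_all add: numeral_2_eq_2)
    have psi0: "psi \<beta> 0 = replicate M 0 @ [1]"
    proof -
      have "psi_nat \<beta> 0 = replicate M 0 @ [Suc 0]"
        unfolding M_def using psi_nat_hull[of 0 0] zmax[of 0] zmax[of "Suc 0"] zmin[of 0] zmin[of "Suc 0"] t2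
          Q_JO_iff[of "Suc 0" 0] pos' m_pos by simp
      then show ?thesis using rep[of "Suc 0"] zmax t2 letter_rep_0 by (simp add: psi_def)
    qed
    have psi1: "psi \<beta> 1 = replicate M 0 @ [2]"
    proof -
      have "psi_nat \<beta> 1 = replicate M 0 @ [2]"
        unfolding M_def using psi_nat_hull[of 1 0] zmax[of 1] zmax2 zmin[of 1] zmin[of 2] t2
          Q_JO_iff[of 2 0] pos' m_pos by (simp add: numeral_2_eq_2)
      then show ?thesis using rep[of 2] zmax2 t2 letter_rep_0 by (simp add: psi_def)
    qed
    define B where "B = concat (replicate M (replicate M (0::nat) @ [1]))"
    have setB: "set B \<subseteq> {0, 1}" by (auto simp: B_def split: if_splits)
    have phisq0: "phi_sq \<beta> 0 = B @ replicate M 0 @ [2]"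
      unfolding phi_sq_def morphism_ext_def phi0 concat_map_replicate_snoc(1) phi1 B_def ..
    have psisq0: "psi_sq \<beta> 0 = replicate M 0 @ [2] @ B"
      unfolding psi_sq_def antimorphism_ext_def psi0 concat_map_replicate_snoc(2) psi1 B_def by simp
    have Bsplit: "B = concat (replicate k (phi \<beta> 0)) @ concat (replicate (M - k) (phi \<beta> 0))" if "k \<le> M" for k
      unfolding B_def phi0[symmetric] using that by (rule concat_replicate_split)
    have BM: "B = (replicate M 0 @ [1]) @ concat (replicate (M - 1) (phi \<beta> 0))"
      using Bsplit[OF M(1)] phi0 by simp
    \<comment> \<open>The other orientation is refuted at the right end: the letter 0 shows that
      \<open>w\<close> ends with 0^m 2, and the letter 1 that so does \<open>w\<close> followed by
      the square image B \<phi>(2). But \<phi>(2) cannot end with m zeros and a 2, and with fewer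
      zeros the final 1 of \<open>B\<close> is in the way.\<close>
    have "\<forall>a\<in>A. phi_sq \<beta> a @ w = w @ psi_sq \<beta> a"
    proof (rule ccontr)
      assume "\<not> ?thesis"
      then have d1: "w @ phi_sq \<beta> a = psi_sq \<beta> a @ w" if "a \<in> A" for a using w that by blast
      have eq0: "w @ B @ replicate M 0 @ [2] = replicate M 0 @ [2] @ B @ w"
        using d1[OF inA[of 0]] phisq0 psisq0 by simp
      have "\<not> length w \<le> M"
      proof
        assume lw: "length w \<le> M"
        have "w = take (length w) (w @ B @ replicate M 0 @ [2])" by simp
        also have "\<dots> = replicate (length w) 0" unfolding eq0 using lw by simp
        finally have w0: "w = replicate (length w) 0" .
        show False
        proof (cases "w = []")
          case True
          then have "(B @ replicate M 0 @ [2]) ! M = (replicate M 0 @ [2] @ B) ! M" using eq0 by simp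
          then show False unfolding BM by (simp add: nth_append)
        next
          case False
          have "last (w @ B @ replicate M 0 @ [2]) = last w" unfolding eq0 using False by simp
          then have "last w = 2" by simp
          moreover have "set w \<subseteq> {0}" by (subst w0) (simp add: set_replicate_conv_if)
          ultimately show False using last_in_set[OF False] by auto
        qed
      qed
      then have "length (replicate M 0 @ [2::nat]) \<le> length w" by simp
      moreover have "(w @ B) @ (replicate M 0 @ [2]) = (replicate M 0 @ [2] @ B) @ w" using eq0 by simp
      ultimately obtain w2 where w2: "w = w2 @ replicate M 0 @ [2]" using common_suffix by blast
      have phisq1: "phi_sq \<beta> 1 = B @ phi \<beta> 2"
        unfolding phi_sq_def morphism_ext_def phi1 concat_map_replicate_snoc(1) phi0 B_def ..
      obtain Y where Y: "w @ B @ phi \<beta> 2 = Y @ replicate M 0 @ [2]"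
        using d1[OF inA[of 1]] t2 phisq1 w2 by (metis append.assoc one_le_numeral order_trans)
      obtain B' where B': "B = B' @ [1]"
      proof
        have "concat (replicate (Suc k) u) = concat (replicate k u) @ u" for k and u :: "nat list"
          by (induction k) auto
        from this[of "M - 1" "replicate M 0 @ [1]"]
        show "B = (concat (replicate (M - 1) (replicate M 0 @ [1])) @ replicate M 0) @ [1]"
          using M(1) by (simp add: B_def del: replicate_Suc)
      qed
      have tail: False if k: "phi \<beta> 2 = replicate (nat (r 2)) 0 @ [k]" "rem (Suc 2) = rem k" for k
      proof -
        have "last (w @ B @ phi \<beta> 2) = k" using k(1) by simp
        then have "k = 2" unfolding Y by simp
        define e where "e = nat (r 2)"
        have "e \<le> M" using renyi_le_m by (simp add: e_def M_def nat_mono)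
        show False
        proof (cases "e = M")
          case True
          then have "r 2 = m" using M renyi_nonneg[of 2] by (simp add: e_def)
          then have "(\<beta> - 1) * rem 2 = of_int m" using k(2) \<open>k = 2\<close> rem_Suc[of 2] by (simp add: algebra_simps)
          moreover have "(\<beta> - 1) * rem 2 \<le> (\<beta> - 1) * 1"
            using rem_less1'[of 2] beta_gt1 by (intro mult_left_mono) auto
          ultimately show False using m_gt by simp
        next
          case False
          define f where "f = M - e - 1"
          have "replicate M (0::nat) = replicate f 0 @ [0] @ replicate e 0"
          proof -
            have "M = f + Suc e" using False \<open>e \<le> M\<close> by (simp add: f_def)
            then show ?thesis by (simp only: replicate_add replicate_Suc append_Cons append_Nil)
          qed
          then have "(w @ B') @ [1] @ replicate e 0 = (Y @ replicate f 0) @ [0] @ replicate e 0"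
            using Y k(1) B' \<open>k = 2\<close> by (simp add: e_def[symmetric])
          then show False by simp
        qed
      qed
      from inA[OF t2] show False
      proof (cases rule: phi_cases)
        case 1 then show False using tail[of "Suc 2"] by simp
      next
        case (2 k) then show False using tail[of k] by simp
      next
        case 3
        then have "last (w @ B @ phi \<beta> 2) = 0" by (simp add: last_append last_replicate)
        then show False unfolding Y by simp
      qed
    qed
    then have d2: "phi_sq \<beta> a @ w = w @ psi_sq \<beta> a" if "a \<in> A" for a using that by blast
    have "B @ replicate M 0 @ [2] @ w = w @ replicate M 0 @ [2] @ B"
      using d2[OF inA[of 0]] phisq0 psisq0 by simp
    then obtain w' where w': "w = B @ w'" using conjugator_prefix setB by blast
    then have w1: "w = replicate (nat m) 0 @ [1] @ (concat (replicate (M - 1) (phi \<beta> 0)) @ w')"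
      using BM by (simp add: M_def)
    have bt: "\<beta> * dl t = dl (Suc t) + of_int m" by (simp add: dl_Suc)
    have remt: "rem t = dl t" using t by (intro rem_dl) simp
    have rt: "r t < m" using bt neg by (simp add: renyi_unity_eq remt floor_less_iff)
    define n where "n = nat (r t)"
    have n: "n < M" "int n = r t" using rt renyi_nonneg[of t] by (auto simp: n_def M_def)
    \<comment> \<open>Cancelling \<phi>(0)^n on both sides leaves at least one block \<phi>(0) = 0^m
      1 at the start of \<phi>(c) w, since n < m.\<close>
    have contra: False if c: "c \<in> A" "c \<ge> 1" "phi \<beta> t = replicate n 0 @ [c]" for c
    proof -
      have "phi_sq \<beta> t = concat (replicate n (phi \<beta> 0)) @ phi \<beta> c"
        unfolding phi_sq_def morphism_ext_def c(3) concat_map_replicate_snoc(1) ..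
      then have "concat (replicate n (phi \<beta> 0)) @ phi \<beta> c @ w = B @ w' @ psi_sq \<beta> t"
        using d2[OF inA[of t]] w' by simp
      then have "phi \<beta> c @ w = concat (replicate (M - n) (phi \<beta> 0)) @ w' @ psi_sq \<beta> t"
        using Bsplit[of n] n by simp
      moreover have "M - n = Suc (M - n - 1)" using n by simp
      ultimately have "phi \<beta> c @ w = (replicate (nat m) 0 @ [1]) @ concat (replicate (M - n - 1) (phi \<beta> 0)) @ w' @ psi_sq \<beta> t"
        unfolding M_def[symmetric] phi0[symmetric] by (metis append.assoc concat.simps(2) replicate_Suc)
      then show False using phi_prefix_contra[OF c(1,2) w1] by blast
    qed
    from inA[OF order_refl] have "phi \<beta> t = replicate n 0 \<and> n \<ge> 1 \<and> rem (Suc t) = 0"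
    proof (cases rule: phi_cases)
      case 1
      have False by (rule contra[OF 1(1)]) (use 1(2) in \<open>simp_all add: n_def\<close>)
      then show ?thesis ..
    next
      case (2 k)
      have False by (rule contra[OF inA[OF 2(3)] 2(2)]) (use 2(4) in \<open>simp add: n_def\<close>)
      then show ?thesis ..
    next
      case 3 then show ?thesis by (auto simp: n_def)
    qed
    then have phit: "phi \<beta> t = replicate n 0" and n1: "n \<ge> 1" and "rem (Suc t) = 0" by auto
    then have dlT: "dl (Suc t) = of_int (int n) - of_int m" using rem_Suc[of t] bt remt n by simp
    show ?thesis
      \<comment> \<open>For odd \<open>t\<close>, counting the letters 0 of the images of \<open>t - 1\<close> gives \<open>m + n\<close> zeros in \<open>\<psi>(t)\<close>, hence too
          many letters 1 in \<open>\<psi>\<^sup>2(t)\<close>.\<close>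
    proof (cases "odd (Suc t)")
      case True
      have "confluent (Suc t) (int n)" unfolding confluent_def using True dlT n n1 M by auto
      then show ?thesis by blast
    next
      case False
      define s where "s = t - 1"
      have s: "t = Suc s" "s < t" "s \<ge> 2" using t2 False by (auto simp: s_def elim: oddE)
      have marg: "dl (Suc t) + of_int 1 * (\<beta> + 1) > 0" using dlT n1 m_le by simp
      \<comment> \<open>For odd \<open>t\<close> the negative \<open>dl (Suc t)\<close> puts
        \<open>Q t\<close> outside its tile, so \<psi>(t - 1) has one 0 less than \<phi>(t -
        1).\<close>
      have zt: "zmax t = Q t - of_int 1"
        by (rule zmax_eq) (use marg neg t2 m_pos False in auto)
      have JOt: "Q t - of_int 1 \<in> JO t" using Q_JO_iff[of t 1] marg False t2 m_pos by simp
      have "psi_nat \<beta> s = replicate (M - 1) 0 @ [t]"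
        using psi_nat_hull[of s 1] zmax[OF s(2)] zmin[of s] zmin[of t] zt JOt s m_pos
        by (simp add: M_def nat_diff_distrib)
      moreover have "letter_rep \<beta> t = t"
      proof (rule letter_rep_eq)
        fix j assume "j < t"
        have "gap_length \<beta> t = dl t + 1" using gap_length_QP[of t 1] zt zmin[of t] t by simp
        then show "gap_length \<beta> j \<noteq> gap_length \<beta> t" using gap[of j] zmax[OF \<open>j < t\<close>] \<open>j < t\<close> dl_le1[of j] t by simp
      qed
      ultimately have psis: "psi \<beta> s = replicate (M - 1) 0 @ [t]" using letter_rep_0 by (simp add: psi_def)
      have phis: "phi \<beta> s = replicate M 0 @ [t]" using phi[of s] s inA[of t] pos[of t] by (simp add: less_imp_le)
      have phi_sq_s: "phi_sq \<beta> s = B @ replicate n 0"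
        unfolding phi_sq_def morphism_ext_def phis concat_map_replicate_snoc(1) phit B_def phi0 ..
      have psi_sq_s: "psi_sq \<beta> s = psi \<beta> t @ concat (replicate (M - 1) (psi \<beta> 0))"
        unfolding psi_sq_def antimorphism_ext_def psis concat_map_replicate_snoc(2) ..
      have "M * M + n = count_list (psi \<beta> t) 0 + (M - 1) * M"
        using cnt[OF inA[of s], of 0] s unfolding phi_sq_s psi_sq_s
        by (simp add: B_def count_list_concat_replicate count_list_replicate psi0)
      moreover have "M * M = (M - 1) * M + M" using M by (cases M) auto
      ultimately have "count_list (psi \<beta> t) 0 = M + n" by linarith
      then have "M + n \<le> count_list (psi_sq \<beta> t) 1"
        using count_list_concat_ge[of "rev (psi \<beta> t)" 0 "psi \<beta>" 1]
        by (simp add: psi_sq_def antimorphism_ext_def psi0 count_list_replicate)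
      moreover have "count_list (phi_sq \<beta> t) 1 = n"
        by (simp add: phi_sq_def morphism_ext_def phit phi0 count_list_concat_replicate count_list_replicate)
      ultimately show ?thesis using cnt[OF inA[of t], of 1] M by simp
    qed
  qed
qed

end

theorem theorem1p1:
  fixes \<beta> :: real
  assumes "\<beta> > 1"
  shows "((\<exists>(d::nat) (m::int) (n::int). d \<ge> 1 \<and> m \<ge> n \<and> n \<ge> 1 \<and> (even d \<longrightarrow> n = m) \<and>
             \<beta> ^ d - (\<Sum>i=1..<d. of_int m * \<beta> ^ i) - of_int n = 0)
          \<longleftrightarrow> (phi_alphabet \<beta> = psi_alphabet \<beta> \<and>
               conjugated_on (phi_alphabet \<beta>) (phi_sq \<beta>) (psi_sq \<beta>)))
       \<and> ((phi_alphabet \<beta> = psi_alphabet \<beta> \<and>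
           conjugated_on (phi_alphabet \<beta>) (phi_sq \<beta>) (psi_sq \<beta>))
          \<longleftrightarrow> neg_integers \<beta> = X_set \<beta>)"
proof -
  interpret neg_base \<beta> using assms by unfold_locales
  have X: "(\<exists>d n. confluent d n) \<longleftrightarrow> neg_integers \<beta> = X_set \<beta>"
  proof
    assume "\<exists>d n. confluent d n"
    then obtain d n where "confluent d n" by blast
    then interpret confluent_base \<beta> d n by unfold_locales
    show "neg_integers \<beta> = X_set \<beta>" by (rule Z_eq_X)
  qed (rule X_eq_imp_confluent)
  have psi: "(\<exists>d n. confluent d n) \<longleftrightarrow>
      phi_alphabet \<beta> = psi_alphabet \<beta> \<and> conjugated_on (phi_alphabet \<beta>) (phi_sq \<beta>) (psi_sq \<beta>)"
  proof
    assume "\<exists>d n. confluent d n"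
    then obtain d n where "confluent d n" by blast
    then interpret confluent_base \<beta> d n by unfold_locales
    show "phi_alphabet \<beta> = psi_alphabet \<beta> \<and> conjugated_on (phi_alphabet \<beta>) (phi_sq \<beta>) (psi_sq \<beta>)"
      by (rule confluent_imp_conjugated)
  qed (use conjugated_imp_confluent in blast)
  show ?thesis unfolding confluent_iff using X psi by blast
qed

end
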